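(* Let $M$ be a pointed metric space and let $\mathbb{Y}$ be a real Banach space such that either $\mathcal{F}(M)$ or $\mathbb{Y}^*$ has the Radon-Nikodým property (RNP). Then $\operatorname{Lip}_0(M,\mathbb{Y})$ has the BCP if and only if both $\operatorname{Lip}_0(M)$ and $\mathbb{Y}$ have the BCP.
   Context: $(M,d)$ is a metric space with a distinguished point $0$, and $\mathbb{Y}^*$ is the dual space of $\mathbb{Y}$. $\operatorname{Lip}_0(M,\mathbb{Y})$ is the space of Lipschitz maps $f:M\to\mathbb{Y}$ with $f(0)=0$, normed by $\|f\|_L=\sup\{\|f(t)-f(s)\|/d(t,s): t,s\in M,\ t\ne s\}$; $\operatorname{Lip}_0(M):=\operatorname{Lip}_0(M,\mathbb{R})$. The Lipschitz-free space is $\mathcal{F}(M)=\overline{\operatorname{span}}\{\delta_t:t\in M\}\subseteq\operatorname{Lip}_0(M)^*$, where $\delta_t(f)=f(t)$. A Banach space $\mathbb{Z}$ has the Ball Covering Property (BCP) if its unit sphere $S_{\mathbb{Z}}$ can be covered by countably many balls, none of which contains the origin; in other words, there is a sequence of open balls $\{B(z_n,r_n)\}_{n=1}^{\infty}$ (center $z_n$, radius $r_n>0$) with $r_n\le\|z_n\|$ for each $n\in\mathbb{N}$ such that $S_{\mathbb{Z}}\subseteq\bigcup_n B(z_n,r_n)$. *)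

theory Defs
  imports "HOL-Analysis.Analysis"
begin

section \<open>The space of Lipschitz maps vanishing at the base point\<close>

text \<open>
  A pointed metric space is a type of sort \<open>{metric_space, zero}\<close>. The class \<open>zero\<close> carries no
  axioms, so the distinguished point \<open>0\<close> is an arbitrary point.
\<close>

typedef (overloaded) ('m, 'y) lip0 =
  "{f :: 'm::{metric_space, zero} \<Rightarrow> 'y::real_normed_vector. f 0 = 0 \<and> (\<exists>C. C-lipschitz_on UNIV f)}"
  morphisms lip0_apply Lip0
  by (intro exI[of _ "\<lambda>_. 0"]) (auto simp: lipschitz_on_def)

setup_lifting type_definition_lip0

instantiation lip0 :: ("{metric_space, zero}", real_normed_vector) real_vector
begin

lift_definition zero_lip0 :: "('a, 'b) lip0" is "\<lambda>_. 0"
  by (auto simp: lipschitz_on_def)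

lift_definition plus_lip0 :: "('a, 'b) lip0 \<Rightarrow> ('a, 'b) lip0 \<Rightarrow> ('a, 'b) lip0"
  is "\<lambda>f g x. f x + g x"
  using lipschitz_on_add by fastforce

lift_definition uminus_lip0 :: "('a, 'b) lip0 \<Rightarrow> ('a, 'b) lip0" is "\<lambda>f x. - f x"
  by (simp add: lipschitz_on_def dist_minus)

lift_definition minus_lip0 :: "('a, 'b) lip0 \<Rightarrow> ('a, 'b) lip0 \<Rightarrow> ('a, 'b) lip0"
  is "\<lambda>f g x. f x - g x"
  using lipschitz_on_diff by fastforce

lift_definition scaleR_lip0 :: "real \<Rightarrow> ('a, 'b) lip0 \<Rightarrow> ('a, 'b) lip0" is "\<lambda>c f x. c *\<^sub>R f x"
  using lipschitz_on_cmult by fastforce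

instance
  by standard (transfer; force simp: algebra_simps)+

end

lemma lip0_apply_zero [simp]: "lip0_apply f 0 = 0"
  using lip0_apply[of f] by simp

lemma lip0_lipschitz: "\<exists>C. C-lipschitz_on UNIV (lip0_apply f)"
  using lip0_apply[of f] by simp

instantiation lip0 :: ("{metric_space, zero}", real_normed_vector) real_normed_vector
begin

text \<open>
  Inserting \<open>0\<close> does not change the supremum of a nonempty set of quotients; it gives the
  supremum the right value \<open>0\<close> when the metric space has only one point.
\<close>

definition norm_lip0 :: "('a, 'b) lip0 \<Rightarrow> real" where
  "norm_lip0 f = Sup (insert 0 {norm (lip0_apply f t - lip0_apply f s) / dist t s | t s. t \<noteq> s})"

definition dist_lip0 :: "('a, 'b) lip0 \<Rightarrow> ('a, 'b) lip0 \<Rightarrow> real" where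
  "dist_lip0 f g = norm (f - g)"

definition sgn_lip0 :: "('a, 'b) lip0 \<Rightarrow> ('a, 'b) lip0" where
  "sgn_lip0 f = f /\<^sub>R norm f"

definition [code del]:
  "(uniformity :: (('a, 'b) lip0 \<times> ('a, 'b) lip0) filter) =
    (INF e\<in>{0<..}. principal {(x, y). dist x y < e})"

definition open_lip0 :: "('a, 'b) lip0 set \<Rightarrow> bool" where [code del]:
  "open_lip0 S = (\<forall>x\<in>S. \<forall>\<^sub>F (x', y) in uniformity. x' = x \<longrightarrow> y \<in> S)"

lemma norm_lip0_bdd:
  fixes f :: "('a, 'b) lip0"
  shows "bdd_above (insert 0 {norm (lip0_apply f t - lip0_apply f s) / dist t s | t s. t \<noteq> s})"
proof -
  obtain C where C: "C-lipschitz_on UNIV (lip0_apply f)"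
    using lip0_lipschitz by blast
  show ?thesis
    by (rule bdd_aboveI[of _ C])
      (use C in \<open>auto simp: lipschitz_on_def dist_norm divide_le_eq\<close>)
qed

lemma norm_lip0_nonneg: "0 \<le> norm (f :: ('a, 'b) lip0)"
  unfolding norm_lip0_def by (rule cSup_upper[OF _ norm_lip0_bdd]) simp

lemma norm_lip0_le:
  fixes f :: "('a, 'b) lip0"
  assumes "0 \<le> C" "\<And>t s. norm (lip0_apply f t - lip0_apply f s) \<le> C * dist t s"
  shows "norm f \<le> C"
  unfolding norm_lip0_def
  by (rule cSup_least) (use assms in \<open>auto simp: divide_le_eq\<close>)

lemma norm_lip0_bound:
  fixes f :: "('a, 'b) lip0"
  shows "norm (lip0_apply f t - lip0_apply f s) \<le> norm f * dist t s"
proof (cases "t = s")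
  case False
  then have "norm (lip0_apply f t - lip0_apply f s) / dist t s \<le> norm f"
    unfolding norm_lip0_def by (intro cSup_upper[OF _ norm_lip0_bdd]) auto
  then show ?thesis
    using False by (simp add: divide_le_eq)
qed simp

lemma norm_lip0_apply: "norm (lip0_apply f t) \<le> norm (f :: ('a, 'b) lip0) * dist t 0"
  using norm_lip0_bound[of f t 0] by simp

lemma norm_lip0_scaleR_le: "norm (c *\<^sub>R f) \<le> \<bar>c\<bar> * norm (f :: ('a, 'b) lip0)"
proof (rule norm_lip0_le)
  fix t s
  have "norm (lip0_apply (c *\<^sub>R f) t - lip0_apply (c *\<^sub>R f) s)
      = \<bar>c\<bar> * norm (lip0_apply f t - lip0_apply f s)"
    by (simp add: scaleR_lip0.rep_eq flip: scaleR_diff_right)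
  also have "\<dots> \<le> \<bar>c\<bar> * (norm f * dist t s)"
    by (intro mult_left_mono norm_lip0_bound) simp
  finally show "norm (lip0_apply (c *\<^sub>R f) t - lip0_apply (c *\<^sub>R f) s) \<le> \<bar>c\<bar> * norm f * dist t s"
    by (simp add: mult.assoc)
qed (simp add: norm_lip0_nonneg)

instance
proof
  fix f g :: "('a, 'b) lip0" and c :: real
  show "norm f = 0 \<longleftrightarrow> f = 0"
  proof
    assume "norm f = 0"
    then have "lip0_apply f t = 0" for t
      using norm_lip0_apply[of f t] by simp
    then show "f = 0"
      by (intro lip0_apply_inject[THEN iffD1] ext) (simp add: zero_lip0.rep_eq)
  next
    assume "f = 0"
    then show "norm f = 0"
      by (intro antisym norm_lip0_nonneg norm_lip0_le) (simp_all add: zero_lip0.rep_eq)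
  qed
  show "norm (f + g) \<le> norm f + norm g"
  proof (rule norm_lip0_le)
    fix t s
    have "norm (lip0_apply (f + g) t - lip0_apply (f + g) s)
        \<le> norm (lip0_apply f t - lip0_apply f s) + norm (lip0_apply g t - lip0_apply g s)"
      by (simp add: plus_lip0.rep_eq norm_diff_triangle_ineq)
    also have "\<dots> \<le> norm f * dist t s + norm g * dist t s"
      by (intro add_mono norm_lip0_bound)
    finally show "norm (lip0_apply (f + g) t - lip0_apply (f + g) s) \<le> (norm f + norm g) * dist t s"
      by (simp add: distrib_right)
  qed (simp add: norm_lip0_nonneg)
  show "norm (c *\<^sub>R f) = \<bar>c\<bar> * norm f"
  proof (cases "c = 0")
    case True
    then have "c *\<^sub>R f = 0" by simp
    with True show ?thesis
      using norm_lip0_scaleR_le[of 0 f] norm_lip0_nonneg[of "0::('a,'b) lip0"] by simp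
  next
    case False
    have "norm f = norm (inverse c *\<^sub>R (c *\<^sub>R f))"
      using False by simp
    also have "\<dots> \<le> \<bar>inverse c\<bar> * norm (c *\<^sub>R f)"
      by (rule norm_lip0_scaleR_le)
    finally have "\<bar>c\<bar> * norm f \<le> norm (c *\<^sub>R f)"
      using False by (simp add: field_simps)
    with norm_lip0_scaleR_le[of c f] show ?thesis by simp
  qed
qed (simp_all add: dist_lip0_def sgn_lip0_def uniformity_lip0_def open_lip0_def)

end

instance lip0 :: ("{metric_space, zero}", banach) banach
proof
  fix X :: "nat \<Rightarrow> ('a, 'b) lip0"
  assume X: "Cauchy X"
  have "convergent (\<lambda>n. lip0_apply (X n) t)" for t
  proof -
    have "Cauchy (\<lambda>n. lip0_apply (X n) t)"
    proof (rule CauchyI)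
      fix e :: real assume e: "0 < e"
      then have "0 < e / (dist t 0 + 1)"
        by (intro divide_pos_pos add_nonneg_pos) auto
      from CauchyD[OF X this] obtain N
        where N: "\<And>m n. m \<ge> N \<Longrightarrow> n \<ge> N \<Longrightarrow> norm (X m - X n) < e / (dist t 0 + 1)"
        by blast
      have "norm (lip0_apply (X m) t - lip0_apply (X n) t) < e" if "m \<ge> N" "n \<ge> N" for m n
      proof -
        have "norm (lip0_apply (X m) t - lip0_apply (X n) t) \<le> norm (X m - X n) * dist t 0"
          using norm_lip0_apply[of "X m - X n" t] by (simp add: minus_lip0.rep_eq)
        also have "\<dots> \<le> e / (dist t 0 + 1) * dist t 0"
          using N[OF that] by (intro mult_right_mono) auto
        also have "\<dots> < e"
          using e by (simp add: divide_less_eq add_nonneg_pos distrib_left)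
        finally show ?thesis .
      qed
      then show "\<exists>N. \<forall>m\<ge>N. \<forall>n\<ge>N. norm (lip0_apply (X m) t - lip0_apply (X n) t) < e"
        by blast
    qed
    then show ?thesis by (rule Cauchy_convergent)
  qed
  then obtain v where v: "\<And>t. (\<lambda>n. lip0_apply (X n) t) \<longlonglongrightarrow> v t"
    unfolding convergent_def by metis
  have key: "norm ((lip0_apply (X n) t - v t) - (lip0_apply (X n) s - v s)) \<le> e * dist t s"
    if N: "\<And>m n. m \<ge> N \<Longrightarrow> n \<ge> N \<Longrightarrow> norm (X m - X n) < e" and n: "n \<ge> N" for N n e t s
  proof (rule tendsto_upperbound)
    show "(\<lambda>m. norm ((lip0_apply (X n) t - lip0_apply (X m) t) - (lip0_apply (X n) s - lip0_apply (X m) s)))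
        \<longlonglongrightarrow> norm ((lip0_apply (X n) t - v t) - (lip0_apply (X n) s - v s))"
      by (intro tendsto_intros v)
    show "\<forall>\<^sub>F m in sequentially. norm ((lip0_apply (X n) t - lip0_apply (X m) t)
        - (lip0_apply (X n) s - lip0_apply (X m) s)) \<le> e * dist t s"
      using eventually_ge_at_top[of N]
    proof eventually_elim
      case (elim m)
      have "norm ((lip0_apply (X n) t - lip0_apply (X m) t) - (lip0_apply (X n) s - lip0_apply (X m) s))
          \<le> norm (X n - X m) * dist t s"
        using norm_lip0_bound[of "X n - X m" t s] by (simp add: minus_lip0.rep_eq)
      also have "\<dots> \<le> e * dist t s"
        using N[OF n elim] by (intro mult_right_mono) auto
      finally show ?case .
    qed
  qed simp
  have "v 0 = 0"
    using LIMSEQ_unique[OF v[of 0]] by simp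
  moreover have "\<exists>C. C-lipschitz_on UNIV v"
  proof -
    obtain N where N: "\<And>m n. m \<ge> N \<Longrightarrow> n \<ge> N \<Longrightarrow> norm (X m - X n) < 1"
      using CauchyD[OF X, of 1] by auto
    have "norm (v t - v s) \<le> (1 + norm (X N)) * dist t s" for t s
    proof -
      have "norm (v t - v s) \<le> norm (lip0_apply (X N) t - lip0_apply (X N) s)
          + norm ((lip0_apply (X N) t - v t) - (lip0_apply (X N) s - v s))"
        using norm_triangle_ineq4[of "lip0_apply (X N) t - lip0_apply (X N) s"
            "(lip0_apply (X N) t - v t) - (lip0_apply (X N) s - v s)"]
        by (simp add: algebra_simps)
      also have "\<dots> \<le> norm (X N) * dist t s + 1 * dist t s"
        by (intro add_mono norm_lip0_bound key[OF N]) auto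
      finally show ?thesis by (simp add: algebra_simps)
    qed
    then show ?thesis
      by (intro exI[of _ "1 + norm (X N)"])
        (simp add: lipschitz_on_def dist_norm)
  qed
  ultimately have V: "lip0_apply (Lip0 v) = v"
    by (intro Lip0_inverse) simp
  have "X \<longlonglongrightarrow> Lip0 v"
  proof (rule LIMSEQ_I)
    fix e :: real assume e: "0 < e"
    then obtain N where N: "\<And>m n. m \<ge> N \<Longrightarrow> n \<ge> N \<Longrightarrow> norm (X m - X n) < e / 2"
      using CauchyD[OF X, of "e / 2"] by auto
    have "norm (X n - Lip0 v) \<le> e / 2" if "n \<ge> N" for n
      by (rule norm_lip0_le)
        (use e key[OF N that] in \<open>auto simp: minus_lip0.rep_eq V\<close>)
    with e show "\<exists>N. \<forall>n\<ge>N. norm (X n - Lip0 v) < e"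
      by (intro exI[of _ N]) force
  qed
  then show "convergent X"
    unfolding convergent_def by blast
qed

section \<open>The Lipschitz-free space\<close>

lift_definition lip0_delta :: "'m::{metric_space, zero} \<Rightarrow> ('m, real) lip0 \<Rightarrow>\<^sub>L real"
  is "\<lambda>t f. lip0_apply f t"
proof (rule bounded_linear_intro)
  fix t :: 'm and f :: "('m, real) lip0"
  show "norm (lip0_apply f t) \<le> norm f * dist t 0"
    by (rule norm_lip0_apply)
qed (simp_all add: plus_lip0.rep_eq scaleR_lip0.rep_eq)

lemma subspace_closure_normed:
  fixes S :: "'a::real_normed_vector set"
  assumes "subspace S"
  shows "subspace (closure S)"
  unfolding subspace_def
proof (intro conjI ballI allI)
  show "0 \<in> closure S"
    using assms closure_subset subspace_0 by blast
next
  fix x y assume "x \<in> closure S" "y \<in> closure S"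
  then obtain a b where "\<And>n::nat. a n \<in> S" "a \<longlonglongrightarrow> x" "\<And>n::nat. b n \<in> S" "b \<longlonglongrightarrow> y"
    unfolding closure_sequential by blast
  then show "x + y \<in> closure S"
    unfolding closure_sequential
    by (intro exI[of _ "\<lambda>n. a n + b n"] conjI allI tendsto_add subspace_add[OF assms]) auto
next
  fix c :: real and x assume "x \<in> closure S"
  then obtain a where "\<And>n::nat. a n \<in> S" "a \<longlonglongrightarrow> x"
    unfolding closure_sequential by blast
  then show "c *\<^sub>R x \<in> closure S"
    unfolding closure_sequential
    by (intro exI[of _ "\<lambda>n. c *\<^sub>R a n"] conjI allI tendsto_scaleR tendsto_const
        subspace_scale[OF assms]) auto
qed

lemma subspace_closure_span: "subspace (closure (span S))" for S :: "'a::real_normed_vector set"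
  by (intro subspace_closure_normed subspace_span)

typedef (overloaded) 'm lip_free =
  "closure (span (range (lip0_delta :: 'm::{metric_space, zero} \<Rightarrow> ('m, real) lip0 \<Rightarrow>\<^sub>L real)))"
  morphisms lip_free_rep Lip_free
  using subspace_0[OF subspace_closure_span] by blast

setup_lifting type_definition_lip_free

instantiation lip_free :: ("{metric_space, zero}") real_vector
begin

lift_definition zero_lip_free :: "'a lip_free" is 0
  by (rule subspace_0[OF subspace_closure_span])

lift_definition plus_lip_free :: "'a lip_free \<Rightarrow> 'a lip_free \<Rightarrow> 'a lip_free" is "(+)"
  by (rule subspace_add[OF subspace_closure_span])

lift_definition uminus_lip_free :: "'a lip_free \<Rightarrow> 'a lip_free" is uminus
  by (rule subspace_neg[OF subspace_closure_span])

lift_definition minus_lip_free :: "'a lip_free \<Rightarrow> 'a lip_free \<Rightarrow> 'a lip_free" is "(-)"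
  by (rule subspace_diff[OF subspace_closure_span])

lift_definition scaleR_lip_free :: "real \<Rightarrow> 'a lip_free \<Rightarrow> 'a lip_free" is "(*\<^sub>R)"
  by (rule subspace_scale[OF subspace_closure_span])

instance
  by standard (transfer; simp add: algebra_simps)+

end

instantiation lip_free :: ("{metric_space, zero}") real_normed_vector
begin

lift_definition norm_lip_free :: "'a lip_free \<Rightarrow> real" is norm .

definition dist_lip_free :: "'a lip_free \<Rightarrow> 'a lip_free \<Rightarrow> real" where
  "dist_lip_free x y = norm (x - y)"

definition sgn_lip_free :: "'a lip_free \<Rightarrow> 'a lip_free" where
  "sgn_lip_free x = x /\<^sub>R norm x"

definition [code del]:
  "(uniformity :: ('a lip_free \<times> 'a lip_free) filter) =
    (INF e\<in>{0<..}. principal {(x, y). dist x y < e})"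

definition open_lip_free :: "'a lip_free set \<Rightarrow> bool" where [code del]:
  "open_lip_free S = (\<forall>x\<in>S. \<forall>\<^sub>F (x', y) in uniformity. x' = x \<longrightarrow> y \<in> S)"

instance
proof
  fix x y :: "'a lip_free" and c :: real
  show "norm x = 0 \<longleftrightarrow> x = 0"
    by transfer simp
  show "norm (x + y) \<le> norm x + norm y"
    by transfer (rule norm_triangle_ineq)
  show "norm (c *\<^sub>R x) = \<bar>c\<bar> * norm x"
    by transfer simp
qed (simp_all add: dist_lip_free_def sgn_lip_free_def uniformity_lip_free_def open_lip_free_def)

end

instance lip_free :: ("{metric_space, zero}") banach
proof
  fix X :: "nat \<Rightarrow> 'a lip_free"
  assume X: "Cauchy X"
  have d: "dist (lip_free_rep x) (lip_free_rep y) = dist x y" for x y :: "'a lip_free"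
    by (simp add: dist_norm norm_lip_free.rep_eq minus_lip_free.rep_eq)
  have "Cauchy (\<lambda>n. lip_free_rep (X n))"
    using X by (simp add: Cauchy_def d)
  then obtain v where v: "(\<lambda>n. lip_free_rep (X n)) \<longlonglongrightarrow> v"
    using Cauchy_convergent convergent_def by blast
  then have "v \<in> closure (span (range (lip0_delta :: 'a \<Rightarrow> _)))"
    by (rule closed_sequentially[OF closed_closure, rotated]) (rule lip_free_rep)
  then have "lip_free_rep (Lip_free v) = v"
    by (rule Lip_free_inverse)
  then have "(\<lambda>n. dist (X n) (Lip_free v)) \<longlonglongrightarrow> 0"
    using v[THEN tendsto_dist_iff[THEN iffD1]] by (simp flip: d)
  then have "X \<longlonglongrightarrow> Lip_free v"
    by (rule tendsto_dist_iff[THEN iffD2])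
  then show "convergent X"
    unfolding convergent_def by blast
qed

section \<open>The ball covering property\<close>

text \<open>
  The cover is a sequence of balls of positive radius. In particular the zero space, in which no
  ball of positive radius avoids the origin, does not have the property.
\<close>

definition ball_covering_property :: "'z::banach itself \<Rightarrow> bool" where
  "ball_covering_property _ \<longleftrightarrow>
    (\<exists>(z :: nat \<Rightarrow> 'z) (r :: nat \<Rightarrow> real).
      (\<forall>n. 0 < r n \<and> r n \<le> norm (z n)) \<and> sphere 0 1 \<subseteq> (\<Union>n. ball (z n) (r n)))"

section \<open>The Radon-Nikodym property\<close>

text \<open>
  The Bochner integral of \<open>HOL-Analysis.Bochner_Integration\<close> is restricted to second countable
  spaces, while the property concerns arbitrary Banach spaces. The definitions below follow
  Diestel and Uhl, \<^emph>\<open>Vector Measures\<close>, Chapters I to III.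
\<close>

definition strongly_measurable :: "'w measure \<Rightarrow> ('w \<Rightarrow> 'x::banach) \<Rightarrow> bool" where
  "strongly_measurable M f \<longleftrightarrow>
    (\<exists>s. (\<forall>n::nat. simple_function M (s n)) \<and> (AE w in M. (\<lambda>n. s n w) \<longlonglongrightarrow> f w))"

definition has_strong_bochner_integral ::
    "'w measure \<Rightarrow> ('w \<Rightarrow> 'x::banach) \<Rightarrow> 'x \<Rightarrow> bool" where
  "has_strong_bochner_integral M f I \<longleftrightarrow>
    strongly_measurable M f \<and>
    (\<exists>s. (\<forall>n::nat. Bochner_Integration.simple_bochner_integrable M (s n)) \<and>
      (\<lambda>n. \<integral>\<^sup>+ w. ennreal (norm (f w - s n w)) \<partial>M) \<longlonglongrightarrow> 0 \<and>
      (\<lambda>n. Bochner_Integration.simple_bochner_integral M (s n)) \<longlonglongrightarrow> I)"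

definition vector_measure :: "'w measure \<Rightarrow> ('w set \<Rightarrow> 'x::banach) \<Rightarrow> bool" where
  "vector_measure M G \<longleftrightarrow>
    (\<forall>A :: nat \<Rightarrow> 'w set. range A \<subseteq> sets M \<longrightarrow> disjoint_family A \<longrightarrow>
      (\<lambda>n. G (A n)) sums G (\<Union>n. A n))"

definition bounded_variation :: "'w measure \<Rightarrow> ('w set \<Rightarrow> 'x::banach) \<Rightarrow> bool" where
  "bounded_variation M G \<longleftrightarrow>
    (\<exists>C. \<forall>P. finite P \<longrightarrow> P \<subseteq> sets M \<longrightarrow> partition_on (space M) P \<longrightarrow> (\<Sum>E\<in>P. norm (G E)) \<le> C)"

definition vector_measure_continuous :: "'w measure \<Rightarrow> ('w set \<Rightarrow> 'x::banach) \<Rightarrow> bool" where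
  "vector_measure_continuous M G \<longleftrightarrow>
    (\<forall>e>0. \<exists>d>0. \<forall>E\<in>sets M. measure M E < d \<longrightarrow> norm (G E) < e)"

definition radon_nikodym_property_wrt :: "'w measure \<Rightarrow> 'x::banach itself \<Rightarrow> bool" where
  "radon_nikodym_property_wrt M _ \<longleftrightarrow>
    (\<forall>G :: 'w set \<Rightarrow> 'x.
      vector_measure M G \<longrightarrow> vector_measure_continuous M G \<longrightarrow> bounded_variation M G \<longrightarrow>
      (\<exists>g. \<forall>E\<in>sets M. has_strong_bochner_integral M (\<lambda>w. indicator E w *\<^sub>R g w) (G E)))"

text \<open>
  The property is required for all finite measure spaces. A definition cannot quantify over the
  type of the points, so here all finite measures on all sigma-algebras of sets of real numbers are
  taken. This loses nothing: a Banach space with the property for Lebesgue measure on the unit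
  interval has it for every finite measure space (Diestel and Uhl, Section V.3).
\<close>

definition radon_nikodym_property :: "'x::banach itself \<Rightarrow> bool" where
  "radon_nikodym_property X \<longleftrightarrow>
    (\<forall>M :: real measure. finite_measure M \<longrightarrow> radon_nikodym_property_wrt M X)"

end

theory Submission
  imports Defs
begin

text \<open>
  Lipschitz maps \<open>T\<close> from \<open>M\<close> to \<open>Y\<close> are operators on the Lipschitz-free space. Their norm is the supremum
  of \<open>\<phi> (T m)\<close> over molecules \<open>m\<close> (normalised differences of two point evaluations) and functionals \<open>\<phi>\<close>
  in the unit ball of the dual of \<open>Y\<close>. The elementary tensors \<open>f \<otimes> y\<close>, that is, the maps
  \<open>t \<mapsto> f t *\<^sub>R y\<close>, tie the space of Lipschitz maps to its two factors.

  Up to scaling, the ball covering property says that there is a countable set \<open>S\<close> such that for each nonzero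
  \<open>x\<close> the norm strictly decreases at some \<open>z \<in> S\<close> in the direction \<open>- x\<close>
  (\<open>ball_covering_property_iff\<close>). In this form the property passes to the two factors by applying molecules,
  or functionals of the dual ball, which almost attain the norm at the members of the family
  (\<open>ball_covering_property_transfer\<close>).

  For the converse one tries the tensors \<open>f \<otimes> y\<close>, where \<open>f\<close> and \<open>y\<close> run through countable families for the
  factors. There is descent at \<open>f \<otimes> y\<close> in direction \<open>T\<close> if \<open>\<phi> (T m)\<close> is bounded below for all \<open>m\<close> that nearly
  norm \<open>f\<close> and all \<open>\<phi>\<close> that nearly norm \<open>y\<close>. The difficulty is that \<open>y\<close> should be chosen for the
  vector \<open>T m\<close>, which varies with \<open>m\<close>. It disappears if \<open>f\<close> is strongly exposing, that is, if the slices of the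
  set of molecules by \<open>f\<close> shrink to a point: then \<open>T m\<close> converges, and \<open>y\<close> is chosen for the limit
  (\<open>elementary_tensor_descent\<close>). Exchanging the factors, it is as good to have strongly exposing \<open>y\<close>.
  Descent is an open condition, so it is enough that strongly exposing vectors are dense.

  Their density is what the Radon-Nikodym property provides (\<open>small_slice_dense_unit\<close> and Baire's theorem). If all
  slices by vectors near \<open>f\<close> are large, then each norming functional is a limit of averages of midpoints of
  distant pairs. Iterating this on the dyadic intervals yields an approximate martingale whose values on sibling
  intervals stay apart, and its limit is a vector measure that oscillates at arbitrarily fine scales
  (\<open>oscillating_measure\<close>). A measure with a Bochner density cannot do that
  (\<open>rnp_dyadic_oscillation\<close>).
\<close>

section \<open>Sublinear functionals and separation\<close>

definition sublinear :: "('a::real_vector \<Rightarrow> real) \<Rightarrow> bool" where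
  "sublinear p \<longleftrightarrow> (\<forall>x y. p (x + y) \<le> p x + p y) \<and> (\<forall>t x. 0 \<le> t \<longrightarrow> p (t *\<^sub>R x) = t * p x)"

lemma sublinear_add: "sublinear p \<Longrightarrow> p (x + y) \<le> p x + p y"
  and sublinear_scale: "sublinear p \<Longrightarrow> 0 \<le> t \<Longrightarrow> p (t *\<^sub>R x) = t * p x"
  by (auto simp: sublinear_def)

lemma sublinear_zero: "sublinear p \<Longrightarrow> p 0 = 0"
  using sublinear_scale[of p 0 0] by simp

lemma sublinear_uminus: "sublinear p \<Longrightarrow> - p (- x) \<le> p x"
  using sublinear_add[of p x "-x"] sublinear_zero[of p] by simp

lemma sublinear_norm: "sublinear norm"
  by (auto simp: sublinear_def norm_triangle_ineq)

text \<open>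
  Minimal sublinear functionals are linear, and this construction is what shows it: pushing \<open>q\<close> down
  along a convex set keeps it sublinear as long as \<open>q\<close> is at least \<open>\<eta>\<close> on that set. The same construction
  turns a lower bound for \<open>q\<close> on \<open>H\<close> into a separating functional.
\<close>

lemma sublinear_push_down:
  fixes q :: "'a::real_vector \<Rightarrow> real"
  assumes q: "sublinear q" and H: "convex H" "H \<noteq> {}" and \<eta>: "\<And>h. h \<in> H \<Longrightarrow> \<eta> \<le> q h"
  obtains p where "sublinear p" "\<And>x. p x \<le> q x" "\<And>h. h \<in> H \<Longrightarrow> p (- h) \<le> - \<eta>"
proof -
  define S where "S z = {q (z + t *\<^sub>R h) - t * \<eta> | t h. 0 \<le> t \<and> h \<in> H}" for z
  define p where "p z = Inf (S z)" for z
  have ne: "S z \<noteq> {}" for z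
    unfolding S_def using H(2) order_refl[of "0::real"] by blast
  have lower: "- q (- z) \<le> a" if "a \<in> S z" for a z
  proof -
    from that obtain t h where t: "a = q (z + t *\<^sub>R h) - t * \<eta>" "0 \<le> t" "h \<in> H"
      by (auto simp: S_def)
    have "t * \<eta> \<le> q (t *\<^sub>R h)"
      using t \<eta> by (simp add: sublinear_scale[OF q] mult_left_mono)
    also have "\<dots> \<le> q (z + t *\<^sub>R h) + q (- z)"
      using sublinear_add[OF q, of "z + t *\<^sub>R h" "- z"] by simp
    finally show ?thesis using t by simp
  qed
  then have bdd: "bdd_below (S z)" for z by (meson bdd_belowI)
  have le: "p z \<le> q (z + t *\<^sub>R h) - t * \<eta>" if "0 \<le> t" "h \<in> H" for z t h
    unfolding p_def by (rule cInf_lower[OF _ bdd]) (use that in \<open>auto simp: S_def\<close>)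
  show thesis
  proof
    show "p x \<le> q x" for x
      using H le[of 0 _ x] by force
    show "p (- h) \<le> - \<eta>" if "h \<in> H" for h
      using le[of 1 h "-h"] that by (simp add: sublinear_zero[OF q])
    have add: "p (x + y) \<le> p x + p y" for x y
    proof -
      have "p (x + y) \<le> a + b" if "a \<in> S x" "b \<in> S y" for a b
      proof -
        from that obtain t h s k where t: "a = q (x + t *\<^sub>R h) - t * \<eta>" "0 \<le> t" "h \<in> H"
          and s: "b = q (y + s *\<^sub>R k) - s * \<eta>" "0 \<le> s" "k \<in> H"
          by (auto simp: S_def)
        obtain l where l: "l \<in> H" "t *\<^sub>R h + s *\<^sub>R k = (t + s) *\<^sub>R l"
        proof (cases "t + s = 0")
          case True
          then show thesis using t s that by (metis add_nonneg_eq_0_iff add.right_neutral scaleR_zero_left)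
        next
          case False
          then have "(t / (t+s)) *\<^sub>R h + (s / (t+s)) *\<^sub>R k \<in> H"
            using t s by (intro convexD[OF H(1)]) (simp_all add: add_divide_distrib[symmetric])
          moreover have "t *\<^sub>R h + s *\<^sub>R k = (t + s) *\<^sub>R ((t / (t+s)) *\<^sub>R h + (s / (t+s)) *\<^sub>R k)"
            using False by (simp add: scaleR_add_right)
          ultimately show thesis by (rule that)
        qed
        have "p (x + y) \<le> q ((x + y) + (t + s) *\<^sub>R l) - (t + s) * \<eta>"
          using t s l by (intro le) auto
        also have "(x + y) + (t + s) *\<^sub>R l = (x + t *\<^sub>R h) + (y + s *\<^sub>R k)"
          using l(2) by (simp add: algebra_simps)
        also have "q \<dots> - (t + s) * \<eta> \<le> a + b"
          using sublinear_add[OF q, of "x + t *\<^sub>R h" "y + s *\<^sub>R k"] t s by (simp add: algebra_simps)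
        finally show ?thesis .
      qed
      then have "p (x + y) - a \<le> p y" if "a \<in> S x" for a
        unfolding p_def[of y] using that by (intro cInf_greatest[OF ne]) force
      then have "p (x + y) - p y \<le> p x"
        unfolding p_def[of x] by (intro cInf_greatest[OF ne]) force
      then show ?thesis by simp
    qed
    have scale_le: "p (c *\<^sub>R x) \<le> c * p x" if "0 < c" for c x
    proof -
      have "p (c *\<^sub>R x) / c \<le> a" if a: "a \<in> S x" for a
      proof -
        from a obtain t h where t: "a = q (x + t *\<^sub>R h) - t * \<eta>" "0 \<le> t" "h \<in> H"
          by (auto simp: S_def)
        have "p (c *\<^sub>R x) \<le> q (c *\<^sub>R x + (c * t) *\<^sub>R h) - (c * t) * \<eta>"
          using t \<open>0 < c\<close> by (intro le) auto
        also have "c *\<^sub>R x + (c * t) *\<^sub>R h = c *\<^sub>R (x + t *\<^sub>R h)"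
          by (simp add: scaleR_add_right)
        also have "q \<dots> - (c * t) * \<eta> = c * a"
          using \<open>0 < c\<close> sublinear_scale[OF q, of c "x + t *\<^sub>R h"] t(1)
          by (simp add: right_diff_distrib del: scaleR_add_right)
        finally show ?thesis using \<open>0 < c\<close> by (simp add: field_simps)
      qed
      then have "p (c *\<^sub>R x) / c \<le> p x"
        unfolding p_def[of x] by (intro cInf_greatest[OF ne])
      then show ?thesis using \<open>0 < c\<close> by (simp add: field_simps)
    qed
    have "p (c *\<^sub>R x) = c * p x" if "0 < c" for c x
    proof (rule antisym[OF scale_le[OF that]])
      show "c * p x \<le> p (c *\<^sub>R x)"
        using scale_le[of "inverse c" "c *\<^sub>R x"] that by (simp add: field_simps)
    qed
    moreover have "p 0 = 0"
    proof -
      have "p 0 \<le> 0" using H le[of 0 _ 0] by (force simp: sublinear_zero[OF q])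
      moreover have "0 \<le> p 0"
        unfolding p_def using lower[of _ 0] by (intro cInf_greatest[OF ne]) (simp add: sublinear_zero[OF q])
      ultimately show ?thesis by simp
    qed
    ultimately have "p (c *\<^sub>R x) = c * p x" if "0 \<le> c" for c x
      using that by (cases "c = 0") auto
    with add show "sublinear p" by (simp add: sublinear_def)
  qed
qed

lemma minimal_sublinear_exists:
  assumes p: "sublinear p"
  obtains q where "sublinear q" "q \<le> p" "\<And>r. sublinear r \<Longrightarrow> r \<le> q \<Longrightarrow> r = q"
proof -
  define A where "A = {q. sublinear q \<and> q \<le> p}"
  have "\<exists>m\<in>A. \<forall>a\<in>A. m \<ge> a \<longrightarrow> a = m"
  proof (rule predicate_Zorn)
    show "partial_order_on A (relation_of (\<ge>) A)"
      by (auto simp: partial_order_on_def preorder_on_def refl_on_def trans_def antisym_def relation_of_def)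
  next
    fix C assume C: "C \<in> Chains (relation_of (\<ge>) A)"
    then have chain: "a \<le> b \<or> b \<le> a" if "a \<in> C" "b \<in> C" for a b
      using that by (auto simp: Chains_def relation_of_def)
    have CA: "C \<subseteq> A" using C by (auto simp: Chains_def relation_of_def)
    show "\<exists>u\<in>A. \<forall>a\<in>C. a \<ge> u"
    proof (cases "C = {}")
      case True
      then show ?thesis using p by (auto simp: A_def)
    next
      case False
      define u where "u x = (INF a\<in>C. a x)" for x
      have "- p (- x) \<le> a x" if "a \<in> C" for a x
      proof -
        have "sublinear a" "a (- x) \<le> p (- x)" using CA that by (auto simp: A_def le_fun_def)
        then show ?thesis using sublinear_uminus[of a x] by linarith
      qed
      then have bdd: "bdd_below ((\<lambda>a. a x) ` C)" for x
        by (meson bdd_belowI2)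
      have u_le: "u x \<le> a x" if "a \<in> C" for a x
        unfolding u_def using that by (intro cINF_lower[OF bdd])
      have sub: "sublinear a" if "a \<in> C" for a using CA that by (auto simp: A_def)
      have "sublinear u"
        unfolding sublinear_def
      proof (intro conjI allI impI)
        fix x y
        have "u (x + y) \<le> a x + b y" if ab: "a \<in> C" "b \<in> C" for a b
        proof -
          obtain c where c: "c \<in> C" "c \<le> a" "c \<le> b"
          proof (cases "a \<le> b")
            case True
            then show thesis using ab by (intro that[of a]) auto
          next
            case False
            then show thesis using ab chain[OF ab] by (intro that[of b]) auto
          qed
          have "u (x + y) \<le> c x + c y"
            using u_le[OF c(1), of "x + y"] sublinear_add[OF sub[OF c(1)], of x y] by linarith
          also have "\<dots> \<le> a x + b y" by (intro add_mono le_funD[OF c(2)] le_funD[OF c(3)])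
          finally show ?thesis .
        qed
        then have "u (x + y) - a x \<le> b y" if "a \<in> C" "b \<in> C" for a b
          using that by (simp add: diff_le_eq add.commute)
        then have "u (x + y) - a x \<le> u y" if "a \<in> C" for a
          unfolding u_def[of y] using that by (intro cINF_greatest[OF False])
        then have "u (x + y) - u y \<le> a x" if "a \<in> C" for a
          using that by (simp add: diff_le_eq add.commute)
        then have "u (x + y) - u y \<le> u x"
          unfolding u_def[of x] by (intro cINF_greatest[OF False])
        then show "u (x + y) \<le> u x + u y" by simp
      next
        fix t :: real and x assume t: "0 \<le> t"
        have u0: "u 0 = 0"
        proof -
          have "(\<lambda>a. a 0) ` C = {0}" using False sub sublinear_zero by force
          then show ?thesis by (simp add: u_def)
        qed
        have le: "u (c *\<^sub>R x) \<le> c * u x" if "0 < c" for c x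
        proof -
          have "u (c *\<^sub>R x) / c \<le> u x"
            unfolding u_def[of x]
          proof (rule cINF_greatest[OF False])
            fix a assume a: "a \<in> C"
            show "u (c *\<^sub>R x) / c \<le> a x"
              using u_le[OF a, of "c *\<^sub>R x"] that by (simp add: sublinear_scale[OF sub[OF a]] field_simps)
          qed
          then show ?thesis using that by (simp add: field_simps)
        qed
        show "u (t *\<^sub>R x) = t * u x"
        proof (cases "t = 0")
          case False
          then have "0 < t" using t by simp
          then show ?thesis
            using le[of t x] le[of "inverse t" "t *\<^sub>R x"] by (simp add: field_simps)
        qed (simp add: u0)
      qed
      moreover have "u \<le> p"
      proof -
        obtain a where "a \<in> C" using False by blast
        then have "u \<le> a" "a \<le> p" using u_le CA by (auto simp: A_def le_fun_def)
        then show ?thesis by (rule order_trans)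
      qed
      ultimately show ?thesis using u_le by (auto simp: A_def le_fun_def)
    qed
  qed
  then obtain m where m: "m \<in> A" "\<And>a. a \<in> A \<Longrightarrow> a \<le> m \<Longrightarrow> a = m" by blast
  show thesis
  proof
    show "sublinear m" "m \<le> p" using m(1) by (auto simp: A_def)
    fix r assume "sublinear r" "r \<le> m"
    moreover have "r \<le> p" by (rule order_trans[OF \<open>r \<le> m\<close> \<open>m \<le> p\<close>])
    ultimately show "r = m" by (intro m(2)) (auto simp: A_def)
  qed
qed

text \<open>
  For a minimal \<open>q\<close>, pushing down along \<open>{y}\<close> with \<open>\<eta> = q y\<close> changes nothing. Hence \<open>q (- y) = - q y\<close>,
  which makes \<open>q\<close> additive and homogeneous.
\<close>

theorem hahn_banach_sublinear:
  fixes p :: "'a::real_vector \<Rightarrow> real"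
  assumes "sublinear p"
  obtains \<phi> where "linear \<phi>" "\<And>x. \<phi> x \<le> p x"
proof -
  obtain q where q: "sublinear q" "q \<le> p" and min: "\<And>r. sublinear r \<Longrightarrow> r \<le> q \<Longrightarrow> r = q"
    by (rule minimal_sublinear_exists[OF assms]) blast
  have neg: "q (- y) = - q y" for y
  proof -
    obtain r where r: "sublinear r" "\<And>x. r x \<le> q x" "\<And>h. h \<in> {y} \<Longrightarrow> r (- h) \<le> - q y"
      by (rule sublinear_push_down[OF q(1), of "{y}" "q y"]) auto
    then have "r = q" by (intro min) (auto simp: le_fun_def)
    then show ?thesis using r(3) sublinear_uminus[OF q(1), of y] by auto
  qed
  have "q (x + y) = q x + q y" for x y
    using sublinear_add[OF q(1), of x y] sublinear_add[OF q(1), of "x + y" "- y"] neg[of y] by simp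
  moreover have "q (t *\<^sub>R x) = t * q x" for t x
  proof (cases "0 \<le> t")
    case False
    then show ?thesis
      using sublinear_scale[OF q(1), of "- t" x] neg[of "t *\<^sub>R x"] by simp
  qed (rule sublinear_scale[OF q(1)])
  ultimately have "linear q" by (intro linearI) auto
  then show thesis using q(2) by (intro that[of q]) (auto simp: le_fun_def)
qed

theorem separating_functional:
  fixes q :: "'a::real_vector \<Rightarrow> real"
  assumes "sublinear q" "convex H" "H \<noteq> {}" "\<And>h. h \<in> H \<Longrightarrow> \<eta> \<le> q h"
  obtains \<phi> where "linear \<phi>" "\<And>x. \<phi> x \<le> q x" "\<And>h. h \<in> H \<Longrightarrow> \<eta> \<le> \<phi> h"
proof -
  obtain p where p: "sublinear p" "\<And>x. p x \<le> q x" "\<And>h. h \<in> H \<Longrightarrow> p (- h) \<le> - \<eta>"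
    using sublinear_push_down[OF assms] by metis
  obtain \<phi> where \<phi>: "linear \<phi>" "\<And>x. \<phi> x \<le> p x"
    using hahn_banach_sublinear[OF p(1)] by metis
  have "\<eta> \<le> \<phi> h" if "h \<in> H" for h
    using \<phi>(2)[of "- h"] p(3)[OF that] linear_neg[OF \<phi>(1), of h] by simp
  then show thesis using \<phi> p(2) by (intro that[of \<phi>]) (auto intro: order_trans)
qed

lemma norming_functional:
  fixes y :: "'y::real_normed_vector"
  obtains \<phi> :: "'y \<Rightarrow>\<^sub>L real" where "norm \<phi> \<le> 1" "\<phi> y = norm y"
proof -
  obtain \<phi> :: "'y \<Rightarrow> real" where \<phi>: "linear \<phi>" "\<And>x. \<phi> x \<le> norm x" "norm y \<le> \<phi> y"
    using separating_functional[OF sublinear_norm, of "{y}" "norm y"] by auto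
  have abs: "\<bar>\<phi> x\<bar> \<le> norm x" for x
    using \<phi>(2)[of x] \<phi>(2)[of "- x"] linear_neg[OF \<phi>(1), of x] by simp
  then have bl: "bounded_linear \<phi>"
    using \<phi>(1) by (intro bounded_linear_intro[of _ 1]) (auto simp: linear_add linear_scale)
  show thesis
  proof
    show "norm (Blinfun \<phi>) \<le> 1"
      by (rule norm_blinfun_bound) (use abs in \<open>auto simp: bounded_linear_Blinfun_apply[OF bl]\<close>)
    show "Blinfun \<phi> y = norm y"
      using \<phi>(2)[of y] \<phi>(3) by (simp add: bounded_linear_Blinfun_apply[OF bl])
  qed
qed

section \<open>Dyadic intervals\<close>

text \<open>
  The half-open interval of length \<open>2^{-k}\<close> that starts at \<open>j / 2^k\<close>. With the floor, refinement of
  intervals is integer division of indices.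
\<close>

definition dyadic :: "nat \<Rightarrow> nat \<Rightarrow> real set" where
  "dyadic k j = {t. \<lfloor>t * 2 ^ k\<rfloor> = int j}"

abbreviation unit_measure :: "real measure" where
  "unit_measure \<equiv> uniform_measure lborel {0..<1}"

lemma dyadic_eq: "dyadic k j = {real j / 2 ^ k ..< (real j + 1) / 2 ^ k}"
  by (auto simp: dyadic_def floor_eq_iff field_simps)

lemma dyadic_borel [measurable]: "dyadic k j \<in> sets borel"
  by (simp add: dyadic_eq)

lemma dyadic_disjoint: "i \<noteq> j \<Longrightarrow> dyadic k i \<inter> dyadic k j = {}"
  by (auto simp: dyadic_def)

lemma dyadic_subset_unit: "j < 2 ^ k \<Longrightarrow> dyadic k j \<subseteq> {0..<1}"
proof -
  assume "j < 2 ^ k"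
  then have "real j + 1 \<le> 2 ^ k"
    by (metis Suc_leI of_nat_Suc of_nat_le_iff of_nat_numeral of_nat_power add.commute)
  then show ?thesis by (auto simp: dyadic_eq field_simps)
qed

lemma dyadic_Union: "(\<Union>j<2 ^ k. dyadic k j) = {0..<1}"
proof
  show "(\<Union>j<2 ^ k. dyadic k j) \<subseteq> {0..<1}" using dyadic_subset_unit by blast
  show "{0..<1} \<subseteq> (\<Union>j<2 ^ k. dyadic k j)"
  proof
    fix t :: real assume t: "t \<in> {0..<1}"
    define j where "j = nat \<lfloor>t * 2 ^ k\<rfloor>"
    have "0 \<le> \<lfloor>t * 2 ^ k\<rfloor>" using t by simp
    then have "t \<in> dyadic k j" by (simp add: dyadic_def j_def)
    moreover have "\<lfloor>t * 2 ^ k\<rfloor> < 2 ^ k" using t by (simp add: floor_less_iff)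
    then have "j < 2 ^ k" by (simp add: j_def nat_less_iff)
    ultimately show "t \<in> (\<Union>j<2 ^ k. dyadic k j)" by blast
  qed
qed

lemma dyadic_refine: "dyadic (k + n) l \<subseteq> dyadic k (l div 2 ^ n)"
proof
  fix t assume "t \<in> dyadic (k + n) l"
  then have "\<lfloor>t * 2 ^ (k + n)\<rfloor> = int l" by (simp add: dyadic_def)
  moreover have "\<lfloor>t * 2 ^ k\<rfloor> = \<lfloor>t * 2 ^ (k + n)\<rfloor> div 2 ^ n"
  proof -
    have "t * 2 ^ k = (t * 2 ^ (k + n)) / real (2 ^ n)" by (simp add: power_add)
    then show ?thesis by (metis floor_divide_real_eq_div of_nat_numeral of_nat_power real_of_nat_eq_numeral_power_cancel_iff of_int_numeral of_int_power zero_le_numeral zero_le_power)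
  qed
  ultimately show "t \<in> dyadic k (l div 2 ^ n)" by (simp add: dyadic_def zdiv_int)
qed

interpretation unit: finite_measure unit_measure
  by (rule finite_measureI) simp

lemma sets_unit: "sets unit_measure = sets borel" and space_unit [simp]: "space unit_measure = UNIV"
  by auto

lemma measure_unit: "A \<in> sets borel \<Longrightarrow> measure unit_measure A = measure lborel ({0..<1} \<inter> A)"
  by (subst measure_uniform_measure) auto

lemma measure_dyadic: "j < 2 ^ k \<Longrightarrow> measure unit_measure (dyadic k j) = 1 / 2 ^ k"
proof -
  assume "j < 2 ^ k"
  then have "{0..<1} \<inter> dyadic k j = dyadic k j" using dyadic_subset_unit by blast
  then show ?thesis by (simp add: measure_unit dyadic_eq divide_right_mono field_simps)
qed

lemma sum_dyadic_measure:
  assumes "A \<in> sets borel"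
  shows "(\<Sum>j<2 ^ k. measure unit_measure (A \<inter> dyadic k j)) = measure unit_measure A"
proof -
  have "(\<Sum>j<2 ^ k. measure unit_measure (A \<inter> dyadic k j)) = measure unit_measure (\<Union>j<2 ^ k. A \<inter> dyadic k j)"
    using assms dyadic_disjoint[of _ _ k]
    by (intro unit.finite_measure_finite_Union[symmetric]) (auto simp: disjoint_family_on_def)
  also have "(\<Union>j<2 ^ k. A \<inter> dyadic k j) = A \<inter> {0..<1}"
    using dyadic_Union[of k] by blast
  also have "measure unit_measure \<dots> = measure unit_measure A"
    using assms by (simp add: measure_unit Int_ac)
  finally show ?thesis .
qed

lemma sum_pairs: "(\<Sum>j<2 * n. h j) = (\<Sum>i<n. h (2 * i) + h (2 * i + 1))" for h :: "nat \<Rightarrow> 'a::comm_monoid_add"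
  by (induction n) (auto simp: add.assoc)

lemma sum_dyadic_pairs: "(\<Sum>j<2 ^ Suc k. h j) = (\<Sum>i<2 ^ k. h (2 * i) + h (2 * i + 1))" for h :: "nat \<Rightarrow> 'a::comm_monoid_add"
  using sum_pairs[of h "2 ^ k"] by simp

text \<open>
  The rays \<open>{..<a}\<close> are stable under intersection and generate the Borel sets, so Dynkin's theorem
  applies.
\<close>

lemma borel_lessThan_induct [consumes 1, case_names basic empty compl union]:
  fixes A :: "real set"
  assumes A: "A \<in> sets borel"
    and basic: "\<And>a. P {..<a}" and empty: "P {}"
    and compl: "\<And>A. A \<in> sets borel \<Longrightarrow> P A \<Longrightarrow> P (UNIV - A)"
    and union: "\<And>A. disjoint_family A \<Longrightarrow> (\<And>n. A n \<in> sets borel) \<Longrightarrow> (\<And>n. P (A n)) \<Longrightarrow> P (\<Union>n::nat. A n)"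
  shows "P A"
proof -
  have A': "A \<in> sigma_sets UNIV (range lessThan)" using A by (simp add: borel_Iio)
  have borel: "B \<in> sets borel" if "B \<in> sigma_sets UNIV (range lessThan)" for B :: "real set"
    using that by (simp add: borel_Iio)
  have "Int_stable (range (lessThan :: real \<Rightarrow> _))"
  proof -
    have "{..<a} \<inter> {..<b} = {..<min a b}" for a b :: real by auto
    then have "{..<a} \<inter> {..<b} \<in> range lessThan" for a b :: real by (metis rangeI)
    then show ?thesis by (intro Int_stableI) (elim rangeE, simp)
  qed
  moreover have "range lessThan \<subseteq> Pow (UNIV :: real set)" by simp
  ultimately show ?thesis using A'
  proof (induction A rule: sigma_sets_induct_disjoint)
    case (union A)
    then have "A n \<in> sets borel" for n by (intro borel) auto
    with union show ?case by (intro assms(5))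
  qed (use basic empty compl borel in auto)
qed

text \<open>
  A Borel set fills the two halves of a dyadic interval almost equally, on average over the intervals of
  a high level. A ray fills all halves equally except in the one interval that contains its end point, and
  the property passes to complements and to countable disjoint unions.
\<close>

lemma dyadic_oscillation_borel:
  assumes "A \<in> sets borel"
  shows "(\<lambda>k. \<Sum>i<2 ^ k. \<bar>measure unit_measure (A \<inter> dyadic (Suc k) (2 * i))
            - measure unit_measure (A \<inter> dyadic (Suc k) (2 * i + 1))\<bar>) \<longlonglongrightarrow> 0"
    (is "?osc A \<longlonglongrightarrow> 0")
proof -
  let ?m = "measure unit_measure"
  show ?thesis using assms
  proof (induction A rule: borel_lessThan_induct)
    case (basic a)
    define A where A: "A = {..<a}"
    have "?osc A k \<le> 1 / 2 ^ Suc k" for k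
    proof -
      have "\<bar>?m (A \<inter> dyadic (Suc k) (2 * i)) - ?m (A \<inter> dyadic (Suc k) (2 * i + 1))\<bar>
          \<le> (if int i = \<lfloor>a * 2 ^ k\<rfloor> then 1 / 2 ^ Suc k else 0)" if i: "i < 2 ^ k" for i
      proof -
        have i2: "2 * i < 2 ^ Suc k" "2 * i + 1 < 2 ^ Suc k" using i by auto
        have sub: "dyadic (Suc k) (2 * i) \<subseteq> dyadic k i" "dyadic (Suc k) (2 * i + 1) \<subseteq> dyadic k i"
          using dyadic_refine[of k 1 "2 * i"] dyadic_refine[of k 1 "2 * i + 1"] by auto
        consider "int i = \<lfloor>a * 2 ^ k\<rfloor>" | "int i < \<lfloor>a * 2 ^ k\<rfloor>" | "int i > \<lfloor>a * 2 ^ k\<rfloor>" by linarith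
        then show ?thesis
        proof cases
          case 1
          have "?m (A \<inter> dyadic (Suc k) j) \<in> {0..1 / 2 ^ Suc k}" if "j < 2 ^ Suc k" for j
            using unit.finite_measure_mono[of "A \<inter> dyadic (Suc k) j" "dyadic (Suc k) j"]
              measure_dyadic[OF that] by simp
          moreover have "\<bar>x - y\<bar> \<le> c" if "x \<in> {0..c}" "y \<in> {0..c}" for x y c :: real
            using that by auto
          ultimately show ?thesis using 1 i2 by (simp only: if_True refl)
        next
          case 2
          have "dyadic k i \<subseteq> A"
          proof
            fix t assume "t \<in> dyadic k i"
            then have "\<lfloor>t * 2 ^ k\<rfloor> < \<lfloor>a * 2 ^ k\<rfloor>" using 2 by (simp add: dyadic_def)
            then have "t * 2 ^ k < a * 2 ^ k" by (meson floor_mono leD not_less)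
            then show "t \<in> A" by (simp add: A)
          qed
          then have "A \<inter> dyadic (Suc k) (2 * i) = dyadic (Suc k) (2 * i)"
            "A \<inter> dyadic (Suc k) (2 * i + 1) = dyadic (Suc k) (2 * i + 1)"
            using sub by blast+
          then show ?thesis using 2 i2 by (simp only: measure_dyadic) simp
        next
          case 3
          have "dyadic k i \<inter> A = {}"
          proof -
            have False if "t \<in> dyadic k i" "t \<in> A" for t
            proof -
              have "\<lfloor>t * 2 ^ k\<rfloor> \<le> \<lfloor>a * 2 ^ k\<rfloor>" using that by (intro floor_mono) (simp add: A)
              then show False using 3 that by (simp add: dyadic_def)
            qed
            then show ?thesis by blast
          qed
          then have "A \<inter> dyadic (Suc k) (2 * i) = {}" "A \<inter> dyadic (Suc k) (2 * i + 1) = {}"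
            using sub by blast+
          then show ?thesis using 3 by simp
        qed
      qed
      then have "?osc A k \<le> (\<Sum>i<2 ^ k. if int i = \<lfloor>a * 2 ^ k\<rfloor> then 1 / 2 ^ Suc k else 0)"
        by (intro sum_mono) auto
      also have "\<dots> \<le> (\<Sum>i<2 ^ k. if i = nat \<lfloor>a * 2 ^ k\<rfloor> then 1 / 2 ^ Suc k else 0)"
        by (intro sum_mono) auto
      also have "\<dots> \<le> 1 / 2 ^ Suc k" by (subst sum.delta) auto
      finally show ?thesis .
    qed
    moreover have "(\<lambda>k. 1 / 2 ^ Suc k :: real) \<longlonglongrightarrow> 0"
      using LIMSEQ_Suc[OF LIMSEQ_realpow_zero[of "1 / 2 :: real"]] by (simp add: power_one_over)
    ultimately show ?case
      unfolding A[symmetric]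
      by (intro tendsto_sandwich[OF _ _ tendsto_const, of 0 "?osc A"]) (auto intro!: sum_nonneg always_eventually)
  next
    case empty
    then show ?case by simp
  next
    case (compl A)
    then have A: "A \<in> sets borel" by blast
    have "?osc (UNIV - A) k = ?osc A k" for k
    proof (rule sum.cong[OF refl])
      fix i :: nat assume "i \<in> {..<2 ^ k}"
      then have i2: "2 * i < 2 ^ Suc k" "2 * i + 1 < 2 ^ Suc k" by auto
      have "?m ((UNIV - A) \<inter> dyadic (Suc k) j) = 1 / 2 ^ Suc k - ?m (A \<inter> dyadic (Suc k) j)"
        if "j < 2 ^ Suc k" for j
      proof -
        have "(UNIV - A) \<inter> dyadic (Suc k) j = dyadic (Suc k) j - A \<inter> dyadic (Suc k) j" by blast
        then show ?thesis
          using A by (simp only: measure_dyadic[OF that, symmetric]) (subst unit.finite_measure_Diff; auto)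
      qed
      from this[OF i2(1)] this[OF i2(2)]
      show "\<bar>?m ((UNIV - A) \<inter> dyadic (Suc k) (2 * i)) - ?m ((UNIV - A) \<inter> dyadic (Suc k) (2 * i + 1))\<bar>
        = \<bar>?m (A \<inter> dyadic (Suc k) (2 * i)) - ?m (A \<inter> dyadic (Suc k) (2 * i + 1))\<bar>"
        by simp
    qed
    with compl show ?case by simp
  next
    case (union A)
    then have Ab [measurable]: "A n \<in> sets borel" for n by blast
    show ?case
    proof (rule LIMSEQ_I)
      fix e :: real assume e: "0 < e"
      let ?R = "\<lambda>n. (\<Union>i. A i) - (\<Union>i<n. A i)"
      have "(\<lambda>n. ?m (\<Union>i<n. A i)) \<longlonglongrightarrow> ?m (\<Union>n. \<Union>i<n. A i)"
        by (rule unit.finite_Lim_measure_incseq) (auto simp: incseq_def intro: less_le_trans)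
      also have "(\<Union>n. \<Union>i<n. A i) = (\<Union>i. A i)" by blast
      finally have "(\<lambda>n. ?m (\<Union>i. A i) - ?m (\<Union>i<n. A i)) \<longlonglongrightarrow> ?m (\<Union>i. A i) - ?m (\<Union>i. A i)"
        by (intro tendsto_intros)
      moreover have "?m (\<Union>i. A i) - ?m (\<Union>i<n. A i) = ?m (?R n)" for n
        by (subst unit.finite_measure_Diff) auto
      ultimately have "(\<lambda>n. ?m (?R n)) \<longlonglongrightarrow> 0" by simp
      from order_tendstoD(2)[OF this, of "e / 2"] e have "\<forall>\<^sub>F n in sequentially. ?m (?R n) < e / 2" by simp
      then obtain n where n: "?m (?R n) < e / 2" unfolding eventually_sequentially by blast
      have split: "?m ((\<Union>i. A i) \<inter> D) = (\<Sum>l<n. ?m (A l \<inter> D)) + ?m (?R n \<inter> D)"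
        if D [measurable]: "D \<in> sets borel" for D
      proof -
        have "(\<Sum>l<n. ?m (A l \<inter> D)) = ?m (\<Union>l<n. A l \<inter> D)"
          using \<open>disjoint_family A\<close>
          by (intro unit.finite_measure_finite_Union[symmetric]) (auto simp: disjoint_family_on_def)
        moreover have "(\<Union>i. A i) \<inter> D = (\<Union>l<n. A l \<inter> D) \<union> (?R n \<inter> D)" by blast
        moreover have "?m ((\<Union>l<n. A l \<inter> D) \<union> (?R n \<inter> D)) = ?m (\<Union>l<n. A l \<inter> D) + ?m (?R n \<inter> D)"
          by (intro unit.finite_measure_Union) auto
        ultimately show ?thesis by simp
      qed
      have bound: "?osc (\<Union>i. A i) k \<le> (\<Sum>l<n. ?osc (A l) k) + ?m (?R n)" for k
      proof -
        have "?osc (\<Union>i. A i) k \<le> (\<Sum>i<2 ^ k. (\<Sum>l<n. \<bar>?m (A l \<inter> dyadic (Suc k) (2 * i)) - ?m (A l \<inter> dyadic (Suc k) (2 * i + 1))\<bar>)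
           + (?m (?R n \<inter> dyadic (Suc k) (2 * i)) + ?m (?R n \<inter> dyadic (Suc k) (2 * i + 1))))"
        proof (rule sum_mono)
          fix i
          have "\<bar>(\<Sum>l<n. ?m (A l \<inter> dyadic (Suc k) (2 * i))) - (\<Sum>l<n. ?m (A l \<inter> dyadic (Suc k) (2 * i + 1)))\<bar>
             \<le> (\<Sum>l<n. \<bar>?m (A l \<inter> dyadic (Suc k) (2 * i)) - ?m (A l \<inter> dyadic (Suc k) (2 * i + 1))\<bar>)"
            by (simp add: sum_abs flip: sum_subtractf)
          moreover have "0 \<le> ?m (?R n \<inter> dyadic (Suc k) (2 * i))" "0 \<le> ?m (?R n \<inter> dyadic (Suc k) (2 * i + 1))"
            by simp_all
          ultimately show "\<bar>?m ((\<Union>i. A i) \<inter> dyadic (Suc k) (2 * i)) - ?m ((\<Union>i. A i) \<inter> dyadic (Suc k) (2 * i + 1))\<bar>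
            \<le> (\<Sum>l<n. \<bar>?m (A l \<inter> dyadic (Suc k) (2 * i)) - ?m (A l \<inter> dyadic (Suc k) (2 * i + 1))\<bar>)
           + (?m (?R n \<inter> dyadic (Suc k) (2 * i)) + ?m (?R n \<inter> dyadic (Suc k) (2 * i + 1)))"
            unfolding split[OF dyadic_borel] by linarith
        qed
        also have "\<dots> = (\<Sum>l<n. ?osc (A l) k) + ?m (?R n)"
          by (subst sum.distrib, subst sum.swap, subst sum_dyadic_pairs[symmetric], subst sum_dyadic_measure) auto
        finally show ?thesis .
      qed
      have "(\<lambda>k. \<Sum>l<n. ?osc (A l) k) \<longlonglongrightarrow> (\<Sum>l<n. 0)"
        by (intro tendsto_sum union)
      then have "(\<lambda>k. \<Sum>l<n. ?osc (A l) k) \<longlonglongrightarrow> 0" by simp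
      from order_tendstoD(2)[OF this, of "e / 2"] e
      have "\<forall>\<^sub>F k in sequentially. (\<Sum>l<n. ?osc (A l) k) < e / 2" by simp
      then obtain K where K: "\<And>k. k \<ge> K \<Longrightarrow> (\<Sum>l<n. ?osc (A l) k) < e / 2"
        unfolding eventually_sequentially by blast
      have "norm (?osc (\<Union>i. A i) k - 0) < e" if "k \<ge> K" for k
      proof -
        have "0 \<le> ?osc (\<Union>i. A i) k" by (intro sum_nonneg) simp
        moreover have "?osc (\<Union>i. A i) k < e" using K[OF that] bound[of k] n by linarith
        ultimately show ?thesis by (simp only: diff_0_right real_norm_def abs_of_nonneg)
      qed
      then show "\<exists>K. \<forall>k\<ge>K. norm (?osc (\<Union>i. A i) k - 0) < e" by blast
    qed
  qed
qed

section \<open>Measures with values in a space with the Radon-Nikodym property\<close>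

abbreviation dyadic_oscillation :: "(real set \<Rightarrow> 'x::real_normed_vector) \<Rightarrow> nat \<Rightarrow> real" where
  "dyadic_oscillation G \<equiv> (\<lambda>k. \<Sum>i<2 ^ k. norm (G (dyadic (Suc k) (2 * i)) - G (dyadic (Suc k) (2 * i + 1))))"

abbreviation "simple_bochner_integrable \<equiv> Bochner_Integration.simple_bochner_integrable"
abbreviation "simple_bochner_integral \<equiv> Bochner_Integration.simple_bochner_integral"

text \<open>
  A strongly measurable function is arbitrary on a null set and so need not be measurable. Integrals of its
  norm are therefore computed with a measurable representative.
\<close>

lemma strongly_measurable_norm_diff:
  assumes f: "strongly_measurable M f" and s: "simple_function M s"
  obtains h where "h \<in> borel_measurable M" "AE w in M. ennreal (norm (f w - s w)) = h w"
proof -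
  obtain S where S: "\<And>n::nat. simple_function M (S n)" "AE w in M. (\<lambda>n. S n w) \<longlonglongrightarrow> f w"
    using f by (auto simp: strongly_measurable_def)
  have [measurable]: "(\<lambda>w. norm (S n w - s w)) \<in> borel_measurable M" for n
    by (intro borel_measurable_simple_function simple_function_compose2[OF S(1) s])
  show thesis
  proof
    show "(\<lambda>w. ennreal (lim (\<lambda>n. norm (S n w - s w)))) \<in> borel_measurable M"
      by measurable
    show "AE w in M. ennreal (norm (f w - s w)) = ennreal (lim (\<lambda>n. norm (S n w - s w)))"
      using S(2)
    proof eventually_elim
      case (elim w)
      then have "(\<lambda>n. norm (S n w - s w)) \<longlonglongrightarrow> norm (f w - s w)" by (intro tendsto_intros)
      then show ?case by (simp add: limI)
    qed
  qed
qed

lemma nn_integral_norm_triangle: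
  assumes f: "strongly_measurable M f" and g: "strongly_measurable M g"
    and s: "simple_function M s" and t: "simple_function M t"
    and le: "\<And>w. norm (s w - t w) \<le> norm (f w - s w) + norm (g w - t w)"
  shows "(\<integral>\<^sup>+ w. ennreal (norm (s w - t w)) \<partial>M)
      \<le> (\<integral>\<^sup>+ w. ennreal (norm (f w - s w)) \<partial>M) + (\<integral>\<^sup>+ w. ennreal (norm (g w - t w)) \<partial>M)"
proof -
  obtain h where h [measurable]: "h \<in> borel_measurable M" and h': "AE w in M. ennreal (norm (f w - s w)) = h w"
    using strongly_measurable_norm_diff[OF f s] .
  obtain k where k [measurable]: "k \<in> borel_measurable M" and k': "AE w in M. ennreal (norm (g w - t w)) = k w"
    using strongly_measurable_norm_diff[OF g t] .
  have "(\<integral>\<^sup>+ w. ennreal (norm (s w - t w)) \<partial>M) \<le> (\<integral>\<^sup>+ w. h w + k w \<partial>M)"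
  proof (rule nn_integral_mono_AE)
    show "AE w in M. ennreal (norm (s w - t w)) \<le> h w + k w"
      using h' k'
    proof eventually_elim
      case (elim w)
      have "ennreal (norm (s w - t w)) \<le> ennreal (norm (f w - s w) + norm (g w - t w))"
        by (rule ennreal_leI[OF le])
      also have "\<dots> = h w + k w" using elim by (simp add: ennreal_plus)
      finally show ?case .
    qed
  qed
  also have "\<dots> = (\<integral>\<^sup>+ w. h w \<partial>M) + (\<integral>\<^sup>+ w. k w \<partial>M)" by (rule nn_integral_add) measurable
  also have "\<dots> = (\<integral>\<^sup>+ w. ennreal (norm (f w - s w)) \<partial>M) + (\<integral>\<^sup>+ w. ennreal (norm (g w - t w)) \<partial>M)"
    using nn_integral_cong_AE[OF h'] nn_integral_cong_AE[OF k'] by simp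
  finally show ?thesis .
qed

lemma simple_bochner_integral_indicator:
  assumes s: "simple_bochner_integrable M s" and E: "E \<in> sets M"
  shows "simple_bochner_integrable M (\<lambda>w. indicator E w *\<^sub>R s w)"
    and "simple_bochner_integral M (\<lambda>w. indicator E w *\<^sub>R s w)
      = (\<Sum>v\<in>s ` space M. measure M (s -` {v} \<inter> space M \<inter> E) *\<^sub>R v)"
proof -
  have sf: "simple_function M s" using s by (simp add: simple_bochner_integrable.simps)
  have fin: "finite (s ` space M)" using sf by (auto simp: simple_function_def)
  have si: "simple_function M (\<lambda>w. (w \<in> E, s w))"
    using simple_function_compose2[OF simple_function_indicator[OF E] sf, of "\<lambda>a b. (a \<noteq> (0::real), b)"]
    by (simp add: indicator_eq_0_iff)
  have sf': "simple_function M (\<lambda>w. indicator E w *\<^sub>R s w)"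
    by (rule simple_function_compose2[OF simple_function_indicator[OF E] sf])
  show int: "simple_bochner_integrable M (\<lambda>w. indicator E w *\<^sub>R s w)"
  proof
    show "simple_function M (\<lambda>w. indicator E w *\<^sub>R s w)" by fact
    have "emeasure M {w \<in> space M. indicator E w *\<^sub>R s w \<noteq> 0} \<le> emeasure M {w \<in> space M. s w \<noteq> 0}"
    proof (rule emeasure_mono)
      have "{w \<in> space M. s w \<noteq> 0} = space M - (s -` {0} \<inter> space M)" by auto
      then show "{w \<in> space M. s w \<noteq> 0} \<in> sets M"
        using simple_functionD(2)[OF sf, of "{0}"] by auto
    qed auto
    also have "\<dots> < \<infinity>" using s by (simp add: simple_bochner_integrable.simps less_top)
    finally show "emeasure M {w \<in> space M. indicator E w *\<^sub>R s w \<noteq> 0} \<noteq> \<infinity>" by simp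
  qed
  have "simple_bochner_integral M (\<lambda>w. indicator E w *\<^sub>R s w)
      = (\<Sum>p\<in>(\<lambda>w. (w \<in> E, s w)) ` space M. measure M {w\<in>space M. (w \<in> E, s w) = p} *\<^sub>R (if fst p then snd p else 0))"
    by (rule simple_bochner_integral_partition[OF int si]) (auto simp: indicator_def)
  also have "\<dots> = (\<Sum>p\<in>{True, False} \<times> s ` space M. measure M {w\<in>space M. (w \<in> E, s w) = p} *\<^sub>R (if fst p then snd p else 0))"
  proof (rule sum.mono_neutral_left)
    show "\<forall>p\<in>{True, False} \<times> s ` space M - (\<lambda>w. (w \<in> E, s w)) ` space M.
       measure M {w\<in>space M. (w \<in> E, s w) = p} *\<^sub>R (if fst p then snd p else 0) = 0"
    proof
      fix p assume "p \<in> {True, False} \<times> s ` space M - (\<lambda>w. (w \<in> E, s w)) ` space M"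
      then have "{w\<in>space M. (w \<in> E, s w) = p} = {}" by auto
      then show "measure M {w\<in>space M. (w \<in> E, s w) = p} *\<^sub>R (if fst p then snd p else 0) = 0"
        by (simp only: measure_empty scaleR_zero_left)
    qed
  qed (use fin in auto)
  also have "\<dots> = (\<Sum>b\<in>{True, False}. \<Sum>v\<in>s ` space M. measure M {w\<in>space M. (w \<in> E, s w) = (b, v)} *\<^sub>R (if b then v else 0))"
    unfolding sum.cartesian_product by (rule sum.cong) auto
  also have "\<dots> = (\<Sum>v\<in>s ` space M. measure M {w\<in>space M. (w \<in> E, s w) = (True, v)} *\<^sub>R v)"
    by simp
  also have "\<dots> = (\<Sum>v\<in>s ` space M. measure M (s -` {v} \<inter> space M \<inter> E) *\<^sub>R v)"
    by (intro sum.cong refl arg_cong2[of _ _ _ _ "(*\<^sub>R)"] arg_cong[of _ _ "measure M"]) auto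
  finally show "simple_bochner_integral M (\<lambda>w. indicator E w *\<^sub>R s w)
      = (\<Sum>v\<in>s ` space M. measure M (s -` {v} \<inter> space M \<inter> E) *\<^sub>R v)" .
qed

text \<open>
  The density \<open>g\<close> is integrated over \<open>E\<close> through simple functions that depend on \<open>E\<close>. One simple \<open>s\<close>
  close to \<open>g\<close> serves for all \<open>E\<close> at once, with an error that is additive in \<open>E\<close>.
\<close>

lemma bochner_approximation_indicator:
  fixes g :: "'w \<Rightarrow> 'x::banach"
  assumes g: "strongly_measurable M g" and GE: "has_strong_bochner_integral M (\<lambda>w. indicator E w *\<^sub>R g w) G"
    and s: "simple_bochner_integrable M s" and E: "E \<in> sets M"
  shows "ennreal (norm (G - simple_bochner_integral M (\<lambda>w. indicator E w *\<^sub>R s w)))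
    \<le> (\<integral>\<^sup>+ w. ennreal (norm (g w - s w)) * indicator E w \<partial>M)"
proof -
  let ?sE = "\<lambda>w. indicator E w *\<^sub>R s w"
  obtain t where gE: "strongly_measurable M (\<lambda>w. indicator E w *\<^sub>R g w)"
    and t: "\<And>n. simple_bochner_integrable M (t n)"
      "(\<lambda>n. \<integral>\<^sup>+ w. ennreal (norm (indicator E w *\<^sub>R g w - t n w)) \<partial>M) \<longlonglongrightarrow> 0"
      "(\<lambda>n. simple_bochner_integral M (t n)) \<longlonglongrightarrow> G"
    using GE unfolding has_strong_bochner_integral_def by blast
  have sE: "simple_bochner_integrable M ?sE" by (rule simple_bochner_integral_indicator[OF s E])
  have bound: "ennreal (norm (simple_bochner_integral M (t n) - simple_bochner_integral M ?sE))
     \<le> (\<integral>\<^sup>+ w. ennreal (norm (indicator E w *\<^sub>R g w - t n w)) \<partial>M)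
       + (\<integral>\<^sup>+ w. ennreal (norm (g w - s w)) * indicator E w \<partial>M)" for n
  proof -
    let ?d = "\<lambda>w. t n w - ?sE w"
    have d: "simple_bochner_integrable M ?d"
      by (rule simple_bochner_integrable_compose2[OF _ t(1) sE]) simp
    have nd: "simple_bochner_integrable M (\<lambda>w. norm (?d w))"
      using simple_bochner_integrable_compose2[OF _ d d, of "\<lambda>x y. norm x"] by simp
    have "norm (simple_bochner_integral M (t n) - simple_bochner_integral M ?sE)
        \<le> simple_bochner_integral M (\<lambda>w. norm (?d w))"
      using simple_bochner_integral_norm_bound[OF d] simple_bochner_integral_diff[OF t(1) sE] by simp
    then have "ennreal (norm (simple_bochner_integral M (t n) - simple_bochner_integral M ?sE))
        \<le> ennreal (simple_bochner_integral M (\<lambda>w. norm (?d w)))"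
      by (rule ennreal_leI)
    also have "\<dots> = (\<integral>\<^sup>+ w. ennreal (norm (?d w)) \<partial>M)"
      by (rule simple_bochner_integral_eq_nn_integral[OF nd norm_ge_zero])
    also have "\<dots> \<le> (\<integral>\<^sup>+ w. ennreal (norm (indicator E w *\<^sub>R g w - t n w)) \<partial>M)
       + (\<integral>\<^sup>+ w. ennreal (norm (indicator E w *\<^sub>R g w - ?sE w)) \<partial>M)"
    proof (rule nn_integral_norm_triangle[OF gE gE])
      show "simple_function M (t n)" using t(1)[of n] by (simp add: simple_bochner_integrable.simps)
      show "simple_function M ?sE" using sE by (simp add: simple_bochner_integrable.simps)
      show "norm (?d w) \<le> norm (indicator E w *\<^sub>R g w - t n w) + norm (indicator E w *\<^sub>R g w - ?sE w)" for w
        using norm_triangle_ineq4[of "indicator E w *\<^sub>R g w - ?sE w" "indicator E w *\<^sub>R g w - t n w"] by simp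
    qed
    also have "(\<integral>\<^sup>+ w. ennreal (norm (indicator E w *\<^sub>R g w - ?sE w)) \<partial>M)
        = (\<integral>\<^sup>+ w. ennreal (norm (g w - s w)) * indicator E w \<partial>M)"
      by (intro nn_integral_cong) (auto simp: indicator_def)
    finally show ?thesis .
  qed
  have "(\<lambda>n. ennreal (norm (simple_bochner_integral M (t n) - simple_bochner_integral M ?sE)))
      \<longlonglongrightarrow> ennreal (norm (G - simple_bochner_integral M ?sE))"
    by (intro tendsto_intros t)
  moreover have "(\<lambda>n. (\<integral>\<^sup>+ w. ennreal (norm (indicator E w *\<^sub>R g w - t n w)) \<partial>M)
       + (\<integral>\<^sup>+ w. ennreal (norm (g w - s w)) * indicator E w \<partial>M))
     \<longlonglongrightarrow> 0 + (\<integral>\<^sup>+ w. ennreal (norm (g w - s w)) * indicator E w \<partial>M)"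
    by (intro tendsto_add t tendsto_const)
  ultimately have "ennreal (norm (G - simple_bochner_integral M ?sE))
     \<le> 0 + (\<integral>\<^sup>+ w. ennreal (norm (g w - s w)) * indicator E w \<partial>M)"
    by (rule LIMSEQ_le) (use bound in blast)
  then show ?thesis by simp
qed

lemma vector_measure_of_additive:
  fixes G :: "real set \<Rightarrow> 'x::banach"
  assumes add: "\<And>A B. A \<in> sets borel \<Longrightarrow> B \<in> sets borel \<Longrightarrow> A \<inter> B = {} \<Longrightarrow> G (A \<union> B) = G A + G B"
    and bd: "\<And>A. A \<in> sets borel \<Longrightarrow> norm (G A) \<le> C * measure unit_measure A"
  shows "vector_measure unit_measure G"
proof -
  let ?m = "measure unit_measure"
  have G0: "G {} = 0" using add[of "{}" "{}"] by simp
  have fin: "G (\<Union>i<n. A i) = (\<Sum>i<n. G (A i))"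
    if A: "\<And>i. A i \<in> sets borel" "disjoint_family A" for A :: "nat \<Rightarrow> real set" and n
  proof (induction n)
    case (Suc n)
    have "(\<Union>i<Suc n. A i) = (\<Union>i<n. A i) \<union> A n" by (auto simp: less_Suc_eq)
    moreover have "A i \<inter> A n = {}" if "i < n" for i
      using that by (intro disjoint_family_onD[OF A(2)]) auto
    then have "(\<Union>i<n. A i) \<inter> A n = {}" by blast
    ultimately show ?case using A Suc by (simp add: add)
  qed (simp add: G0)
  show ?thesis
    unfolding vector_measure_def
  proof (intro allI impI)
    fix A :: "nat \<Rightarrow> real set" assume "range A \<subseteq> sets unit_measure" and dis: "disjoint_family A"
    then have A [measurable]: "A n \<in> sets borel" for n by auto
    let ?U = "\<Union>n. A n"
    have "(\<lambda>n. ?m (\<Union>i<n. A i)) \<longlonglongrightarrow> ?m (\<Union>n. \<Union>i<n. A i)"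
      by (rule unit.finite_Lim_measure_incseq) (auto simp: incseq_def intro: less_le_trans)
    also have "(\<Union>n. \<Union>i<n. A i) = ?U" by blast
    finally have lim: "(\<lambda>n. C * (?m ?U - ?m (\<Union>i<n. A i))) \<longlonglongrightarrow> C * (?m ?U - ?m ?U)"
      by (intro tendsto_intros)
    have "norm (G ?U - (\<Sum>i<n. G (A i))) \<le> C * (?m ?U - ?m (\<Union>i<n. A i))" for n
    proof -
      have "G ?U = G ((\<Union>i<n. A i) \<union> (?U - (\<Union>i<n. A i)))" by (rule arg_cong[of _ _ G]) blast
      also have "\<dots> = G (\<Union>i<n. A i) + G (?U - (\<Union>i<n. A i))" by (rule add) auto
      finally have "G ?U - (\<Sum>i<n. G (A i)) = G (?U - (\<Union>i<n. A i))" by (simp add: fin[OF A dis])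
      also have "norm \<dots> \<le> C * ?m (?U - (\<Union>i<n. A i))" by (rule bd) simp
      also have "?m (?U - (\<Union>i<n. A i)) = ?m ?U - ?m (\<Union>i<n. A i)"
        by (rule unit.finite_measure_Diff) auto
      finally show ?thesis .
    qed
    then have "(\<lambda>n. G ?U - (\<Sum>i<n. G (A i))) \<longlonglongrightarrow> 0"
      using lim by (intro Lim_null_comparison[OF always_eventually lim[unfolded diff_self mult_zero_right]]) blast
    from tendsto_diff[OF tendsto_const[of "G ?U"] this]
    show "(\<lambda>n. G (A n)) sums G ?U"
      unfolding sums_def by simp
  qed
qed

text \<open>
  A bound by a multiple of the finite measure gives countable additivity, continuity and bounded variation
  together.
\<close>

lemma rnp_density:
  fixes G :: "real set \<Rightarrow> 'x::banach"
  assumes rnp: "radon_nikodym_property TYPE('x)"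
    and add: "\<And>A B. A \<in> sets borel \<Longrightarrow> B \<in> sets borel \<Longrightarrow> A \<inter> B = {} \<Longrightarrow> G (A \<union> B) = G A + G B"
    and bd: "\<And>A. A \<in> sets borel \<Longrightarrow> norm (G A) \<le> C * measure unit_measure A"
  obtains g where "\<And>E. E \<in> sets borel \<Longrightarrow> has_strong_bochner_integral unit_measure (\<lambda>w. indicator E w *\<^sub>R g w) (G E)"
proof -
  let ?m = "measure unit_measure"
  have total: "?m UNIV = 1" by (subst measure_uniform_measure) auto
  have C: "0 \<le> C" using order_trans[OF norm_ge_zero bd[of UNIV]] total by simp
  have "vector_measure unit_measure G"
    using add bd by (rule vector_measure_of_additive)
  moreover have "vector_measure_continuous unit_measure G"
    unfolding vector_measure_continuous_def
  proof (intro allI impI)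
    fix e :: real assume e: "0 < e"
    show "\<exists>d>0. \<forall>E\<in>sets unit_measure. ?m E < d \<longrightarrow> norm (G E) < e"
    proof (intro exI[of _ "e / (C + 1)"] conjI ballI impI)
      show "0 < e / (C + 1)" using e C by simp
      fix E assume E: "E \<in> sets unit_measure" "?m E < e / (C + 1)"
      have "norm (G E) \<le> C * ?m E" by (rule bd) (use E in auto)
      moreover have "0 \<le> ?m E" by (rule measure_nonneg)
      ultimately have "norm (G E) \<le> (C + 1) * ?m E"
        unfolding distrib_right by linarith
      also have "\<dots> < e" using E(2) C by (simp add: field_simps)
      finally show "norm (G E) < e" .
    qed
  qed
  moreover have "bounded_variation unit_measure G"
    unfolding bounded_variation_def
  proof (intro exI[of _ C] allI impI)
    fix P assume P: "finite P" "P \<subseteq> sets unit_measure" "partition_on (space unit_measure) P"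
    have "(\<Sum>E\<in>P. norm (G E)) \<le> (\<Sum>E\<in>P. C * ?m E)"
      using P(2) by (intro sum_mono bd) auto
    also have "\<dots> = C * (\<Sum>E\<in>P. ?m E)" by (simp add: sum_distrib_left)
    also have "(\<Sum>E\<in>P. ?m E) = ?m (\<Union>E\<in>P. E)"
      using P by (intro unit.finite_measure_finite_Union[symmetric])
        (auto simp: partition_on_def disjoint_def disjoint_family_on_def)
    also have "\<dots> = 1" using P(3) total by (simp add: partition_on_def)
    finally show "(\<Sum>E\<in>P. norm (G E)) \<le> C" by simp
  qed
  moreover have "radon_nikodym_property_wrt unit_measure TYPE('x)"
    using rnp[unfolded radon_nikodym_property_def, rule_format, OF unit.finite_measure_axioms] .
  ultimately have "\<exists>g. \<forall>E\<in>sets unit_measure. has_strong_bochner_integral unit_measure (\<lambda>w. indicator E w *\<^sub>R g w) (G E)"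
    unfolding radon_nikodym_property_wrt_def by simp
  then obtain g where "\<forall>E\<in>sets unit_measure. has_strong_bochner_integral unit_measure (\<lambda>w. indicator E w *\<^sub>R g w) (G E)" ..
  then show thesis by (intro that[of g]) simp
qed

text \<open>
  Let \<open>g\<close> be a density of \<open>G\<close> and \<open>s\<close> a simple function close to \<open>g\<close> in the mean. The errors
  \<open>G(J) - (integral of s over J)\<close>, summed over the intervals \<open>J\<close> of one level, stay below the mean distance
  of \<open>g\<close> and \<open>s\<close>. The integrals of \<open>s\<close> over the two halves of an interval differ little in total, because
  \<open>s\<close> is a finite combination of indicators of Borel sets. This is the only way in which the
  Radon-Nikodym property enters the proof.
\<close>

theorem rnp_dyadic_oscillation:
  fixes G :: "real set \<Rightarrow> 'x::banach"
  assumes rnp: "radon_nikodym_property TYPE('x)"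
    and add: "\<And>A B. A \<in> sets borel \<Longrightarrow> B \<in> sets borel \<Longrightarrow> A \<inter> B = {} \<Longrightarrow> G (A \<union> B) = G A + G B"
    and bd: "\<And>A. A \<in> sets borel \<Longrightarrow> norm (G A) \<le> C * measure unit_measure A"
  shows "dyadic_oscillation G \<longlonglongrightarrow> 0"
    (is "?osc \<longlonglongrightarrow> 0")
proof (rule LIMSEQ_I)
  fix e :: real assume e: "0 < e"
  let ?m = "measure unit_measure"
  obtain g where g: "\<And>E. E \<in> sets borel \<Longrightarrow> has_strong_bochner_integral unit_measure (\<lambda>w. indicator E w *\<^sub>R g w) (G E)"
    using rnp_density[OF assms] by blast
  have "has_strong_bochner_integral unit_measure g (G UNIV)"
    using g[of UNIV] by simp
  then obtain s' where gm: "strongly_measurable unit_measure g"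
    and s': "\<And>n. simple_bochner_integrable unit_measure (s' n)"
      "(\<lambda>n. \<integral>\<^sup>+ w. ennreal (norm (g w - s' n w)) \<partial>unit_measure) \<longlonglongrightarrow> 0"
    unfolding has_strong_bochner_integral_def by blast
  have "\<forall>\<^sub>F n in sequentially. (\<integral>\<^sup>+ w. ennreal (norm (g w - s' n w)) \<partial>unit_measure) < ennreal (e / 2)"
    using e by (intro order_tendstoD(2)[OF s'(2)]) simp
  then obtain n where "(\<integral>\<^sup>+ w. ennreal (norm (g w - s' n w)) \<partial>unit_measure) < ennreal (e / 2)"
    unfolding eventually_sequentially by blast
  then obtain s where s: "simple_bochner_integrable unit_measure s"
    and small: "(\<integral>\<^sup>+ w. ennreal (norm (g w - s w)) \<partial>unit_measure) < ennreal (e / 2)"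
    using s'(1) by blast
  have sf: "simple_function unit_measure s" using s by (simp add: simple_bochner_integrable.simps)
  obtain h where h [measurable]: "h \<in> borel_measurable unit_measure"
    and h': "AE w in unit_measure. ennreal (norm (g w - s w)) = h w"
    using strongly_measurable_norm_diff[OF gm sf] .
  let ?V = "range s"
  let ?A = "\<lambda>v. s -` {v}"
  have A [measurable]: "?A v \<in> sets borel" for v
    using simple_functionD(2)[OF sf, of "{v}"] by simp
  define a where "a E = (\<Sum>v\<in>?V. ?m (?A v \<inter> E) *\<^sub>R v)" for E
  have approx: "ennreal (norm (G E - a E)) \<le> (\<integral>\<^sup>+ w. h w * indicator E w \<partial>unit_measure)"
    if E: "E \<in> sets borel" for E
  proof -
    have "ennreal (norm (G E - a E)) \<le> (\<integral>\<^sup>+ w. ennreal (norm (g w - s w)) * indicator E w \<partial>unit_measure)"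
      using bochner_approximation_indicator[OF gm g[OF E] s] simple_bochner_integral_indicator(2)[OF s, of E] E
      by (simp add: a_def)
    also have "\<dots> = (\<integral>\<^sup>+ w. h w * indicator E w \<partial>unit_measure)"
      using h' by (intro nn_integral_cong_AE) (auto elim: eventually_mono)
    finally show ?thesis .
  qed
  have sum_small: "(\<Sum>j<2 ^ k. norm (G (dyadic k j) - a (dyadic k j))) < e / 2" for k
  proof -
    have "ennreal (\<Sum>j<2 ^ k. norm (G (dyadic k j) - a (dyadic k j)))
        = (\<Sum>j<2 ^ k. ennreal (norm (G (dyadic k j) - a (dyadic k j))))"
      by (simp add: sum_ennreal)
    also have "\<dots> \<le> (\<Sum>j<2 ^ k. \<integral>\<^sup>+ w. h w * indicator (dyadic k j) w \<partial>unit_measure)"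
      by (intro sum_mono approx) simp
    also have "\<dots> = (\<integral>\<^sup>+ w. (\<Sum>j<2 ^ k. h w * indicator (dyadic k j) w) \<partial>unit_measure)"
      by (rule nn_integral_sum[symmetric]) simp
    also have "\<dots> \<le> (\<integral>\<^sup>+ w. h w \<partial>unit_measure)"
    proof (rule nn_integral_mono)
      fix w
      have "(\<Sum>j<2 ^ k. h w * indicator (dyadic k j) w) = h w * indicator (\<Union>j<2 ^ k. dyadic k j) w"
        using dyadic_disjoint[of _ _ k]
        by (subst indicator_UN_disjoint) (auto simp: disjoint_family_on_def sum_distrib_left)
      also have "\<dots> \<le> h w" by (simp add: indicator_def)
      finally show "(\<Sum>j<2 ^ k. h w * indicator (dyadic k j) w) \<le> h w" .
    qed
    also have "\<dots> = (\<integral>\<^sup>+ w. ennreal (norm (g w - s w)) \<partial>unit_measure)"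
      using nn_integral_cong_AE[OF h'] by simp
    also note small
    finally show ?thesis by (simp add: ennreal_less_iff sum_nonneg)
  qed
  define osc where "osc v k = (\<Sum>i<2 ^ k. \<bar>?m (?A v \<inter> dyadic (Suc k) (2 * i)) - ?m (?A v \<inter> dyadic (Suc k) (2 * i + 1))\<bar>)" for v k
  have bound: "?osc k \<le> e / 2 + (\<Sum>v\<in>?V. osc v k * norm v)" for k
  proof -
    have "norm (G J - G J') \<le> (norm (G J - a J) + norm (G J' - a J')) + (\<Sum>v\<in>?V. \<bar>?m (?A v \<inter> J) - ?m (?A v \<inter> J')\<bar> * norm v)" for J J'
    proof -
      have "a J - a J' = (\<Sum>v\<in>?V. (?m (?A v \<inter> J) - ?m (?A v \<inter> J')) *\<^sub>R v)"
        by (simp add: a_def sum_subtractf scaleR_diff_left)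
      then have "norm (a J - a J') \<le> (\<Sum>v\<in>?V. \<bar>?m (?A v \<inter> J) - ?m (?A v \<inter> J')\<bar> * norm v)"
        by (simp add: sum_norm_le)
      moreover have "norm (G J - G J') \<le> norm (G J - a J) + norm (a J - a J') + norm (G J' - a J')"
        using norm_triangle_ineq[of "G J - a J + (a J - a J')" "a J' - G J'"]
          norm_triangle_ineq[of "G J - a J" "a J - a J'"] norm_minus_commute[of "a J'" "G J'"] by simp
      ultimately show ?thesis by simp
    qed
    then have "?osc k \<le> (\<Sum>i<2 ^ k. (norm (G (dyadic (Suc k) (2 * i)) - a (dyadic (Suc k) (2 * i)))
          + norm (G (dyadic (Suc k) (2 * i + 1)) - a (dyadic (Suc k) (2 * i + 1))))
        + (\<Sum>v\<in>?V. \<bar>?m (?A v \<inter> dyadic (Suc k) (2 * i)) - ?m (?A v \<inter> dyadic (Suc k) (2 * i + 1))\<bar> * norm v))"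
      by (intro sum_mono)
    also have "\<dots> = (\<Sum>j<2 ^ Suc k. norm (G (dyadic (Suc k) j) - a (dyadic (Suc k) j)))
       + (\<Sum>v\<in>?V. osc v k * norm v)"
    proof -
      have "(\<Sum>i<2 ^ k. \<Sum>v\<in>?V. \<bar>?m (?A v \<inter> dyadic (Suc k) (2 * i)) - ?m (?A v \<inter> dyadic (Suc k) (2 * i + 1))\<bar> * norm v)
          = (\<Sum>v\<in>?V. osc v k * norm v)"
        unfolding osc_def sum_distrib_right by (rule sum.swap)
      then show ?thesis by (simp only: sum.distrib sum_dyadic_pairs)
    qed
    also have "\<dots> \<le> e / 2 + (\<Sum>v\<in>?V. osc v k * norm v)"
      using sum_small[of "Suc k"] by simp
    finally show ?thesis .
  qed
  have "(\<lambda>k. \<Sum>v\<in>?V. osc v k * norm v) \<longlonglongrightarrow> (\<Sum>v\<in>?V. 0 * norm v)"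
    unfolding osc_def by (intro tendsto_sum tendsto_mult dyadic_oscillation_borel A tendsto_const)
  then have "(\<lambda>k. \<Sum>v\<in>?V. osc v k * norm v) \<longlonglongrightarrow> 0" by simp
  from order_tendstoD(2)[OF this, of "e / 2"] e
  have "\<forall>\<^sub>F k in sequentially. (\<Sum>v\<in>?V. osc v k * norm v) < e / 2" by simp
  then obtain K where K: "\<And>k. k \<ge> K \<Longrightarrow> (\<Sum>v\<in>?V. osc v k * norm v) < e / 2"
    unfolding eventually_sequentially by blast
  have "norm (?osc k - 0) < e" if "k \<ge> K" for k
  proof -
    have "0 \<le> ?osc k" by (intro sum_nonneg) simp
    moreover have "?osc k < e" using K[OF that] bound[of k] by linarith
    ultimately show ?thesis by (simp only: diff_0_right real_norm_def abs_of_nonneg)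
  qed
  then show "\<exists>K. \<forall>k\<ge>K. norm (?osc k - 0) < e" by blast
qed

section \<open>Dyadic means and separation\<close>

text \<open>
  Averages of \<open>2^n\<close> points with repetition allowed. They replace convex combinations so that the children
  of a point can be placed on dyadic intervals of equal length.
\<close>

definition dyadic_means :: "'a::real_vector set \<Rightarrow> nat \<Rightarrow> 'a set" where
  "dyadic_means A n = {(\<Sum>i<2 ^ n. a i) /\<^sub>R 2 ^ n | a :: nat \<Rightarrow> 'a. \<forall>i<2 ^ n. a i \<in> A}"

lemma dyadic_means_0: "a \<in> A \<Longrightarrow> a \<in> dyadic_means A 0"
  unfolding dyadic_means_def by (intro CollectI exI[of _ "\<lambda>_. a"]) simp

lemma dyadic_means_midpoint:
  assumes "u \<in> dyadic_means A n" "v \<in> dyadic_means A n"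
  shows "(u + v) /\<^sub>R 2 \<in> dyadic_means A (Suc n)"
proof -
  obtain a b :: "nat \<Rightarrow> 'a" where a: "\<forall>i<2 ^ n. a i \<in> A" "u = (\<Sum>i<2 ^ n. a i) /\<^sub>R 2 ^ n"
    and b: "\<forall>i<2 ^ n. b i \<in> A" "v = (\<Sum>i<2 ^ n. b i) /\<^sub>R 2 ^ n"
    using assms unfolding dyadic_means_def by blast
  define c where "c i = (if even i then a (i div 2) else b (i div 2))" for i
  have "(\<Sum>i<2 ^ Suc n. c i) = (\<Sum>i<2 ^ n. a i + b i)"
    unfolding sum_dyadic_pairs by (intro sum.cong) (auto simp: c_def)
  then have "(u + v) /\<^sub>R 2 = (\<Sum>i<2 ^ Suc n. c i) /\<^sub>R 2 ^ Suc n"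
    by (simp add: a b sum.distrib scaleR_add_right mult.commute)
  moreover have "\<forall>i<2 ^ Suc n. c i \<in> A" using a b by (auto simp: c_def)
  ultimately show ?thesis unfolding dyadic_means_def by blast
qed

lemma dyadic_means_mono: "n \<le> m \<Longrightarrow> dyadic_means A n \<subseteq> dyadic_means A m"
proof (induction m rule: dec_induct)
  case (step m)
  have "u \<in> dyadic_means A (Suc m)" if "u \<in> dyadic_means A m" for u
    using dyadic_means_midpoint[OF that that] by (simp flip: scaleR_2)
  then show ?case using step by blast
qed simp

lemma dyadic_means_combination:
  assumes "u \<in> dyadic_means A n" "v \<in> dyadic_means A n" "m \<le> 2 ^ k"
  shows "(real m / 2 ^ k) *\<^sub>R u + (1 - real m / 2 ^ k) *\<^sub>R v \<in> dyadic_means A (n + k)"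
  using assms(3)
proof (induction k arbitrary: m)
  case 0
  then have "m = 0 \<or> m = 1" by auto
  then show ?case using assms by auto
next
  case (Suc k)
  let ?c = "\<lambda>m. (real m / 2 ^ k) *\<^sub>R u + (1 - real m / 2 ^ k) *\<^sub>R v"
  define p q where "p = m div 2" and "q = m - m div 2"
  have m: "m = p + q" "p \<le> 2 ^ k" "q \<le> 2 ^ k" using Suc.prems by (auto simp: p_def q_def)
  have "(?c p + ?c q) /\<^sub>R 2 \<in> dyadic_means A (Suc (n + k))"
    by (intro dyadic_means_midpoint Suc.IH m)
  also have "?c p + ?c q = (real m / 2 ^ k) *\<^sub>R u + (2 - real m / 2 ^ k) *\<^sub>R v"
    by (simp add: m(1) scaleR_add_left scaleR_diff_left add_divide_distrib scaleR_2)
  also have "\<dots> /\<^sub>R 2 = (real m / 2 ^ Suc k) *\<^sub>R u + (1 - real m / 2 ^ Suc k) *\<^sub>R v"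
    by (simp add: scaleR_add_right diff_divide_distrib right_diff_distrib mult.commute)
  finally show ?case by simp
qed

text \<open>
  The points that are approximable in the sense of \<open>q\<close> form a convex set, since a weight \<open>s\<close> may be
  rounded to a dyadic number.
\<close>

lemma dyadic_means_approximate_hull:
  fixes q :: "'a::real_vector \<Rightarrow> real"
  assumes q: "sublinear q" and h: "h \<in> convex hull A" and \<delta>: "0 < \<delta>"
  obtains n k where "k \<in> dyadic_means A n" "q (h - k) < \<delta>"
proof -
  define S where "S = {x. \<forall>\<delta>>0. \<exists>n k. k \<in> dyadic_means A n \<and> q (x - k) < \<delta>}"
  have "convex S"
    unfolding convex_def
  proof (intro ballI allI impI)
    fix u v and s t :: real assume uv: "u \<in> S" "v \<in> S" and st: "0 \<le> s" "0 \<le> t" "s + t = 1"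
    show "s *\<^sub>R u + t *\<^sub>R v \<in> S"
      unfolding S_def
    proof (intro CollectI allI impI)
      fix \<delta> :: real assume \<delta>: "0 < \<delta>"
      obtain n1 k1 where k1: "k1 \<in> dyadic_means A n1" "q (u - k1) < \<delta> / 2"
        using uv(1) half_gt_zero[OF \<delta>] unfolding S_def by blast
      obtain n2 k2 where k2: "k2 \<in> dyadic_means A n2" "q (v - k2) < \<delta> / 2"
        using uv(2) half_gt_zero[OF \<delta>] unfolding S_def by blast
      define n where "n = max n1 n2"
      have kn: "k1 \<in> dyadic_means A n" "k2 \<in> dyadic_means A n"
        using k1(1) k2(1) dyadic_means_mono[of n1 n A] dyadic_means_mono[of n2 n A] by (auto simp: n_def)
      obtain l where l: "(1 / 2) ^ l * \<bar>q (k1 - k2)\<bar> < \<delta> / 2"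
      proof -
        have "(\<lambda>l. (1 / 2) ^ l * \<bar>q (k1 - k2)\<bar>) \<longlonglongrightarrow> 0 * \<bar>q (k1 - k2)\<bar>"
          by (intro tendsto_intros LIMSEQ_realpow_zero) auto
        then have "(\<lambda>l. (1 / 2) ^ l * \<bar>q (k1 - k2)\<bar>) \<longlonglongrightarrow> 0" by simp
        from order_tendstoD(2)[OF this, of "\<delta> / 2"] \<delta>
        have "\<forall>\<^sub>F l in sequentially. (1 / 2) ^ l * \<bar>q (k1 - k2)\<bar> < \<delta> / 2" by simp
        then obtain l where "(1 / 2) ^ l * \<bar>q (k1 - k2)\<bar> < \<delta> / 2"
          unfolding eventually_sequentially by blast
        then show thesis by (rule that)
      qed
      define m where "m = nat \<lfloor>s * 2 ^ l\<rfloor>"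
      define r where "r = real m / 2 ^ l"
      have m0: "real m = of_int \<lfloor>s * 2 ^ l\<rfloor>" using st by (simp add: m_def)
      have "s * 2 ^ l \<le> 1 * 2 ^ l" using st by (intro mult_right_mono) auto
      then have "real m \<le> 2 ^ l" using m0 of_int_floor_le[of "s * 2 ^ l"] by linarith
      then have m: "m \<le> 2 ^ l" by simp
      have "0 \<le> s * 2 ^ l - real m" "s * 2 ^ l - real m \<le> 1" using m0 by linarith+
      moreover have "s - r = (s * 2 ^ l - real m) / 2 ^ l" by (simp add: r_def diff_divide_distrib)
      ultimately have r: "0 \<le> s - r" "s - r \<le> (1 / 2) ^ l"
        by (simp_all add: power_one_over divide_right_mono)
      have "s *\<^sub>R u + t *\<^sub>R v - (r *\<^sub>R k1 + (1 - r) *\<^sub>R k2)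
         = (s *\<^sub>R (u - k1) + t *\<^sub>R (v - k2)) + (s - r) *\<^sub>R (k1 - k2)"
      proof -
        have t: "t = 1 - s" using st(3) by simp
        show ?thesis unfolding t by (simp add: algebra_simps)
      qed
      then have "q (s *\<^sub>R u + t *\<^sub>R v - (r *\<^sub>R k1 + (1 - r) *\<^sub>R k2))
         \<le> (s * q (u - k1) + t * q (v - k2)) + (s - r) * q (k1 - k2)"
        using sublinear_add[OF q, of "s *\<^sub>R (u - k1) + t *\<^sub>R (v - k2)" "(s - r) *\<^sub>R (k1 - k2)"]
          sublinear_add[OF q, of "s *\<^sub>R (u - k1)" "t *\<^sub>R (v - k2)"] st r
        by (simp add: sublinear_scale[OF q])
      also have "s * q (u - k1) + t * q (v - k2) \<le> s * (\<delta> / 2) + t * (\<delta> / 2)"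
        using k1 k2 st by (intro add_mono mult_left_mono) auto
      also have "\<dots> = \<delta> / 2" using st by (simp flip: distrib_right)
      also have "(s - r) * q (k1 - k2) \<le> (1 / 2) ^ l * \<bar>q (k1 - k2)\<bar>"
      proof -
        have "(s - r) * q (k1 - k2) \<le> (s - r) * \<bar>q (k1 - k2)\<bar>" using r(1) by (intro mult_left_mono) auto
        also have "\<dots> \<le> (1 / 2) ^ l * \<bar>q (k1 - k2)\<bar>" using r(2) by (intro mult_right_mono) auto
        finally show ?thesis .
      qed
      also note l
      finally have "q (s *\<^sub>R u + t *\<^sub>R v - (r *\<^sub>R k1 + (1 - r) *\<^sub>R k2)) < \<delta>" by simp
      moreover have "r *\<^sub>R k1 + (1 - r) *\<^sub>R k2 \<in> dyadic_means A (n + l)"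
        unfolding r_def by (rule dyadic_means_combination[OF kn m])
      ultimately show "\<exists>n k. k \<in> dyadic_means A n \<and> q (s *\<^sub>R u + t *\<^sub>R v - k) < \<delta>" by blast
    qed
  qed
  moreover have "A \<subseteq> S"
  proof
    fix a assume "a \<in> A"
    then show "a \<in> S" using dyadic_means_0[of a A] sublinear_zero[OF q]
      unfolding S_def by (intro CollectI allI impI exI[of _ 0] exI[of _ a]) simp
  qed
  ultimately have "h \<in> S" using h by (meson hull_minimal subsetD)
  then show thesis using that \<delta> unfolding S_def by blast
qed

text \<open>
  Mazur's theorem relative to a sublinear functional. If no dyadic mean of \<open>A\<close> is near \<open>x\<close>, then no point of the
  convex hull is, and the differences \<open>x - h\<close> form a convex set on which \<open>q\<close> is at least \<open>\<eta>\<close>.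
\<close>

lemma approximate_or_separate:
  fixes q :: "'a::real_vector \<Rightarrow> real"
  assumes q: "sublinear q" and A: "A \<noteq> {}"
  obtains (near) n k where "k \<in> dyadic_means A n" "q (x - k) < \<eta>"
  | (separate) \<phi> where "linear \<phi>" "\<And>y. \<phi> y \<le> q y" "\<And>a. a \<in> A \<Longrightarrow> \<phi> a + \<eta> \<le> \<phi> x"
proof (cases "\<exists>h\<in>convex hull A. q (x - h) < \<eta>")
  case True
  then obtain h where h: "h \<in> convex hull A" "q (x - h) < \<eta>" by blast
  then obtain n k where k: "k \<in> dyadic_means A n" "q (h - k) < \<eta> - q (x - h)"
    using dyadic_means_approximate_hull[OF q h(1), of "\<eta> - q (x - h)"] by (metis diff_gt_0_iff_gt)
  then have "q (x - k) < \<eta>" using sublinear_add[OF q, of "x - h" "h - k"] by simp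
  with k(1) show thesis by (rule near)
next
  case False
  let ?H = "(\<lambda>h. x + - h) ` (convex hull A)"
  have eq: "?H = (\<lambda>h. x + h) ` (uminus ` (convex hull A))" by (simp add: image_image)
  have "convex ?H"
    unfolding eq by (intro convex_translation convex_negations convex_convex_hull)
  moreover have "?H \<noteq> {}" using A by simp
  moreover have "\<eta> \<le> q h" if "h \<in> ?H" for h using False that by force
  ultimately obtain \<phi> where \<phi>: "linear \<phi>" "\<And>y. \<phi> y \<le> q y" "\<And>h. h \<in> ?H \<Longrightarrow> \<eta> \<le> \<phi> h"
    using separating_functional[OF q] by metis
  have "\<phi> a + \<eta> \<le> \<phi> x" if "a \<in> A" for a
    using \<phi>(3)[of "x + - a"] hull_inc[OF that, of convex] linear_diff[OF \<phi>(1), of x a] by auto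
  with \<phi>(1,2) show thesis by (rule separate)
qed

text \<open>
  By Tychonoff's theorem the sequence has a cluster point in a product of intervals. Along the filter \<open>F\<close>
  all coordinates converge simultaneously, so that limits along \<open>F\<close> are linear.
\<close>

lemma bounded_sequence_cluster_filter:
  fixes a :: "nat \<Rightarrow> 'i \<Rightarrow> real"
  assumes "\<And>n i. \<bar>a n i\<bar> \<le> B i"
  obtains F g where "F \<le> sequentially" "F \<noteq> bot" "\<And>i. ((\<lambda>n. a n i) \<longlongrightarrow> g i) F"
proof -
  let ?K = "PiE UNIV (\<lambda>i. {- B i..B i})"
  have "compactin (product_topology (\<lambda>i. euclidean) UNIV) ?K"
    by (simp add: compactin_PiE)
  then have "compact ?K" by (simp add: euclidean_product_topology)
  moreover have "filtermap a sequentially \<noteq> bot" by (simp add: filtermap_bot_iff)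
  moreover have "a n \<in> ?K" for n
    using assms[of n] by (auto simp: abs_le_iff minus_le_iff)
  then have "eventually (\<lambda>x. x \<in> ?K) (filtermap a sequentially)"
    by (simp add: eventually_filtermap)
  ultimately obtain g where g: "inf (nhds g) (filtermap a sequentially) \<noteq> bot"
    unfolding compact_filter by blast
  define F where "F = inf sequentially (filtercomap a (nhds g))"
  show thesis
  proof
    show "F \<le> sequentially" by (simp add: F_def)
    show "F \<noteq> bot"
    proof
      assume "F = bot"
      then have "eventually (\<lambda>_. False) F" by simp
      then obtain P Q where PQ: "eventually P sequentially" "eventually Q (filtercomap a (nhds g))"
        "\<And>n. P n \<Longrightarrow> Q n \<Longrightarrow> False"
        unfolding F_def eventually_inf by blast
      then obtain R where R: "eventually R (nhds g)" "\<And>n. R (a n) \<Longrightarrow> Q n"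
        unfolding eventually_filtercomap by blast
      have "eventually (\<lambda>x. \<not> R x) (filtermap a sequentially)"
        unfolding eventually_filtermap using PQ(1) by (rule eventually_mono) (use PQ(3) R(2) in blast)
      with R(1) have "eventually (\<lambda>_. False) (inf (nhds g) (filtermap a sequentially))"
        unfolding eventually_inf by blast
      then show False using g by (simp add: trivial_limit_def)
    qed
    have "filterlim a (nhds g) F"
      unfolding F_def by (rule filterlim_mono[OF filterlim_filtercomap]) auto
    then show "((\<lambda>n. a n i) \<longlongrightarrow> g i) F" for i
      by (rule continuous_on_tendsto_compose[OF continuous_on_product_coordinates[of i]]) auto
  qed
qed

section \<open>Step functions on dyadic intervals\<close>

text \<open>
  The integral over \<open>E\<close> of the function with value \<open>X j\<close> on the \<open>j\<close>-th dyadic interval of level \<open>k\<close>.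
\<close>

definition step_measure :: "nat \<Rightarrow> (nat \<Rightarrow> 'x::real_normed_vector) \<Rightarrow> real set \<Rightarrow> 'x" where
  "step_measure k X E = (\<Sum>j<2 ^ k. measure unit_measure (E \<inter> dyadic k j) *\<^sub>R X j)"

lemma sublinear_sum: "sublinear p \<Longrightarrow> p (\<Sum>i\<in>I. a i) \<le> (\<Sum>i\<in>I. p (a i))"
proof (induction I rule: infinite_finite_induct)
  case (insert i I)
  then show ?case using sublinear_add[of p "a i" "sum a I"] by simp
qed (auto simp: sublinear_zero)

lemma step_measure_additive:
  assumes "E \<in> sets borel" "E' \<in> sets borel" "E \<inter> E' = {}"
  shows "step_measure k X (E \<union> E') = step_measure k X E + step_measure k X E'"
proof -
  have "measure unit_measure ((E \<union> E') \<inter> dyadic k j)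
     = measure unit_measure (E \<inter> dyadic k j) + measure unit_measure (E' \<inter> dyadic k j)" for j
    unfolding Int_Un_distrib2 using assms by (intro unit.finite_measure_Union) auto
  then show ?thesis by (simp add: step_measure_def scaleR_add_left sum.distrib)
qed

lemma norm_step_measure_le:
  assumes "E \<in> sets borel" "\<And>j. j < 2 ^ k \<Longrightarrow> norm (X j) \<le> C"
  shows "norm (step_measure k X E) \<le> C * measure unit_measure E"
proof -
  have "norm (step_measure k X E) \<le> (\<Sum>j<2 ^ k. measure unit_measure (E \<inter> dyadic k j) * C)"
    unfolding step_measure_def
    by (rule sum_norm_le) (use assms in \<open>auto intro!: mult_left_mono simp del: measure_uniform_measure\<close>)
  also have "\<dots> = C * measure unit_measure E"
    using sum_dyadic_measure[OF assms(1), of k] by (simp add: mult.commute flip: sum_distrib_left)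
  finally show ?thesis .
qed

lemma measure_dyadic_Int:
  assumes "l < 2 ^ (k + n)"
  shows "measure unit_measure (dyadic k j \<inter> dyadic (k + n) l) = (if l div 2 ^ n = j then 1 / 2 ^ (k + n) else 0)"
proof (cases "l div 2 ^ n = j")
  case True
  then have "dyadic k j \<inter> dyadic (k + n) l = dyadic (k + n) l" using dyadic_refine[of k n l] by blast
  then show ?thesis using True measure_dyadic[OF assms] by simp
next
  case False
  then have "dyadic k j \<inter> dyadic (k + n) l = {}"
    using dyadic_refine[of k n l] dyadic_disjoint[OF False, of k] by blast
  then show ?thesis using False by simp
qed

lemma step_measure_refined:
  fixes X :: "nat \<Rightarrow> 'x::real_normed_vector"
  assumes j: "j < 2 ^ k"
  shows "step_measure (k + n) X (dyadic k j) = (\<Sum>r<2 ^ n. X (j * 2 ^ n + r)) /\<^sub>R 2 ^ (k + n)"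
proof -
  have "step_measure (k + n) X (dyadic k j)
      = (\<Sum>l<2 ^ (k + n). if l div 2 ^ n = j then X l /\<^sub>R 2 ^ (k + n) else 0)"
    unfolding step_measure_def
    by (intro sum.cong refl) (auto simp: measure_dyadic_Int divide_inverse simp del: measure_uniform_measure)
  also have "\<dots> = (\<Sum>l | l < 2 ^ (k + n) \<and> l div 2 ^ n = j. X l /\<^sub>R 2 ^ (k + n))"
    by (simp add: sum.If_cases) (intro sum.cong; auto)
  also have "\<dots> = (\<Sum>r<2 ^ n. X (j * 2 ^ n + r) /\<^sub>R 2 ^ (k + n))"
  proof (rule sum.reindex_bij_witness[of _ "\<lambda>r. j * 2 ^ n + r" "\<lambda>l. l mod 2 ^ n"])
    fix r :: nat assume r: "r \<in> {..<2 ^ n}"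
    then have "j * 2 ^ n + r < (j + 1) * 2 ^ n" by simp
    also have "\<dots> \<le> 2 ^ k * 2 ^ n" using j by (intro mult_right_mono) auto
    finally show "j * 2 ^ n + r \<in> {l. l < 2 ^ (k + n) \<and> l div 2 ^ n = j}" using r by (simp add: power_add)
  qed (auto simp: div_mult_mod_eq)
  finally show ?thesis by (simp add: scaleR_sum_right)
qed

lemma step_measure_cell: "j < 2 ^ k \<Longrightarrow> step_measure k X (dyadic k j) = X j /\<^sub>R 2 ^ k"
  using step_measure_refined[of j k 0 X] by simp

definition aligned :: "nat \<Rightarrow> real set \<Rightarrow> bool" where
  "aligned k E \<longleftrightarrow> (\<forall>j<2 ^ k. dyadic k j \<subseteq> E \<or> dyadic k j \<inter> E = {})"

lemma aligned_dyadic: "k \<le> n \<Longrightarrow> aligned n (dyadic k j)"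
  unfolding aligned_def
proof (intro allI impI)
  fix l assume "k \<le> n"
  then have "dyadic n l \<subseteq> dyadic k (l div 2 ^ (n - k))" using dyadic_refine[of k "n - k" l] by simp
  then show "dyadic n l \<subseteq> dyadic k j \<or> dyadic n l \<inter> dyadic k j = {}"
    using dyadic_disjoint[of "l div 2 ^ (n - k)" j k] by blast
qed

lemma aligned_mono: "aligned k E \<Longrightarrow> k \<le> n \<Longrightarrow> aligned n E"
  unfolding aligned_def
proof (intro allI impI)
  fix l :: nat assume E: "\<forall>j<2 ^ k. dyadic k j \<subseteq> E \<or> dyadic k j \<inter> E = {}" and "k \<le> n" "l < 2 ^ n"
  then have "dyadic n l \<subseteq> dyadic k (l div 2 ^ (n - k))" using dyadic_refine[of k "n - k" l] by simp
  moreover have "l div 2 ^ (n - k) < 2 ^ k"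
    using \<open>l < 2 ^ n\<close> \<open>k \<le> n\<close> by (simp add: less_mult_imp_div_less flip: power_add)
  ultimately show "dyadic n l \<subseteq> E \<or> dyadic n l \<inter> E = {}" using E by blast
qed

lemma step_measure_split:
  assumes E: "E \<in> sets borel"
  shows "step_measure k X E = (\<Sum>i<2 ^ n. step_measure k X (E \<inter> dyadic n i))"
proof -
  have "measure unit_measure (E \<inter> dyadic k j) = (\<Sum>i<2 ^ n. measure unit_measure (E \<inter> dyadic n i \<inter> dyadic k j))" for j
    using sum_dyadic_measure[of "E \<inter> dyadic k j" n] E by (simp add: Int_ac del: measure_uniform_measure)
  then show ?thesis
    unfolding step_measure_def by (simp add: scaleR_sum_left del: measure_uniform_measure) (rule sum.swap)
qed

text \<open>
  Passing to a finer step function changes the integral over each interval of level \<open>k\<close> by a small multiple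
  of its length, and these changes add up over an aligned set.
\<close>

lemma aligned_difference_le:
  fixes X X' :: "nat \<Rightarrow> 'x::real_normed_vector"
  assumes p: "sublinear p" and E: "E \<in> sets borel" "aligned k E" and \<eta>: "0 \<le> \<eta>"
    and cell: "\<And>j. j < 2 ^ k \<Longrightarrow> p (step_measure k X (dyadic k j) - step_measure k' X' (dyadic k j)) \<le> \<eta> / 2 ^ k"
  shows "p (step_measure k X E - step_measure k' X' E) \<le> \<eta> * measure unit_measure E"
proof -
  have "step_measure k X E - step_measure k' X' E
     = (\<Sum>j<2 ^ k. step_measure k X (E \<inter> dyadic k j) - step_measure k' X' (E \<inter> dyadic k j))"
    using step_measure_split[OF E(1), of k X k] step_measure_split[OF E(1), of k' X' k] by (simp add: sum_subtractf)
  also have "p \<dots> \<le> (\<Sum>j<2 ^ k. p (step_measure k X (E \<inter> dyadic k j) - step_measure k' X' (E \<inter> dyadic k j)))"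
    by (rule sublinear_sum[OF p])
  also have "\<dots> \<le> (\<Sum>j<2 ^ k. \<eta> * measure unit_measure (E \<inter> dyadic k j))"
  proof (rule sum_mono)
    fix j :: nat assume "j \<in> {..<2 ^ k}"
    then have j: "j < 2 ^ k" by simp
    show "p (step_measure k X (E \<inter> dyadic k j) - step_measure k' X' (E \<inter> dyadic k j)) \<le> \<eta> * measure unit_measure (E \<inter> dyadic k j)"
    proof (cases "dyadic k j \<subseteq> E")
      case True
      then have "E \<inter> dyadic k j = dyadic k j" by blast
      then show ?thesis using cell[OF j] measure_dyadic[OF j] by simp
    next
      case False
      then have "E \<inter> dyadic k j = {}" using E(2) j unfolding aligned_def by blast
      then show ?thesis by (simp add: step_measure_def sublinear_zero[OF p])
    qed
  qed
  also have "\<dots> = \<eta> * measure unit_measure E"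
    using sum_dyadic_measure[OF E(1), of k] by (simp flip: sum_distrib_left)
  finally show ?thesis .
qed

text \<open>
  Midpoints of pairs in \<open>A\<close> that are far apart. The requirement on the separating \<open>w\<close> is weighted by the value
  of \<open>f\<close> at the midpoint. A pair \<open>(v, v)\<close> with \<open>f(v) = 0\<close> is thereby admitted with \<open>w = 0\<close>, and the total
  separation of a family of pairs is bounded below by \<open>\<epsilon>\<close> times the mean of \<open>f\<close>.
\<close>

definition split_points :: "real \<Rightarrow> ('w::real_normed_vector) \<Rightarrow> ('w \<Rightarrow>\<^sub>L real) set \<Rightarrow> ('w \<Rightarrow>\<^sub>L real) set" where
  "split_points \<epsilon> f A = {(y + z) /\<^sub>R 2 | y z. y \<in> A \<and> z \<in> A \<and>
      (\<exists>w. norm w \<le> 1 \<and> \<epsilon> * ((y + z) /\<^sub>R 2) f \<le> (y - z) w)}"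

text \<open>
  One step of the construction. Each value \<open>X j\<close> is approximated by a dyadic mean of midpoints, with the same
  number of midpoints for all \<open>j\<close>, and each midpoint is replaced by its two points on adjacent intervals.
  The vectors that witness the separation of these pairs join the finite set \<open>F'\<close>, on which all later
  approximations have to be good.
\<close>

lemma refine_step_function:
  fixes A :: "('w::real_normed_vector \<Rightarrow>\<^sub>L real) set" and strong :: bool
  assumes split: "\<And>x. x \<in> A \<Longrightarrow> \<exists>n. \<exists>h\<in>dyadic_means (split_points \<epsilon> f A) n.
      (\<forall>w\<in>F. \<bar>(x - h) w\<bar> \<le> \<eta>) \<and> (strong \<longrightarrow> norm (x - h) \<le> \<eta>)"
    and F: "finite F" and X: "\<And>j. j < 2 ^ k \<Longrightarrow> X j \<in> A"
  obtains k' X' F' where "k < k'" "finite F'" "F \<subseteq> F'" "\<And>j. j < 2 ^ k' \<Longrightarrow> X' j \<in> A"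
    "\<And>i. i < 2 ^ (k' - 1) \<Longrightarrow> \<exists>w\<in>F'. norm w \<le> 1 \<and>
        \<epsilon> * ((X' (2 * i) + X' (2 * i + 1)) /\<^sub>R 2) f \<le> (X' (2 * i) - X' (2 * i + 1)) w"
    "\<And>j w. j < 2 ^ k \<Longrightarrow> w \<in> F \<Longrightarrow>
        \<bar>(step_measure k X (dyadic k j) - step_measure k' X' (dyadic k j)) w\<bar> \<le> \<eta> / 2 ^ k"
    "\<And>j. j < 2 ^ k \<Longrightarrow> strong \<Longrightarrow>
        norm (step_measure k X (dyadic k j) - step_measure k' X' (dyadic k j)) \<le> \<eta> / 2 ^ k"
proof -
  let ?P = "split_points \<epsilon> f A"
  have "\<forall>j\<in>{..<2 ^ k}. \<exists>n h. h \<in> dyadic_means ?P n \<and>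
      (\<forall>w\<in>F. \<bar>(X j - h) w\<bar> \<le> \<eta>) \<and> (strong \<longrightarrow> norm (X j - h) \<le> \<eta>)"
    using split[OF X] by blast
  then obtain n h where h: "\<And>j. j < 2 ^ k \<Longrightarrow> h j \<in> dyadic_means ?P (n j)"
    and hF: "\<And>j w. j < 2 ^ k \<Longrightarrow> w \<in> F \<Longrightarrow> \<bar>(X j - h j) w\<bar> \<le> \<eta>"
    and hs: "\<And>j. j < 2 ^ k \<Longrightarrow> strong \<Longrightarrow> norm (X j - h j) \<le> \<eta>"
    by (metis (no_types, lifting) lessThan_iff)
  define N where "N = Max (n ` {..<2 ^ k})"
  have "h j \<in> dyadic_means ?P N" if "j < 2 ^ k" for j
  proof -
    have "n j \<le> N" unfolding N_def using that by (intro Max_ge) auto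
    then show ?thesis using h[OF that] dyadic_means_mono by blast
  qed
  then have "\<forall>j\<in>{..<2 ^ k}. \<exists>a :: nat \<Rightarrow> _. (\<forall>i<2 ^ N. a i \<in> ?P) \<and> h j = (\<Sum>i<2 ^ N. a i) /\<^sub>R 2 ^ N"
    unfolding dyadic_means_def by blast
  then obtain a :: "nat \<Rightarrow> nat \<Rightarrow> _" where a: "\<And>j i. j < 2 ^ k \<Longrightarrow> i < 2 ^ N \<Longrightarrow> a j i \<in> ?P"
    and ha: "\<And>j. j < 2 ^ k \<Longrightarrow> h j = (\<Sum>i<2 ^ N. a j i) /\<^sub>R 2 ^ N"
    by (metis (no_types, lifting) lessThan_iff)
  define b where "b l = a (l div 2 ^ N) (l mod 2 ^ N)" for l
  have "b l \<in> ?P" if "l < 2 ^ (k + N)" for l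
    unfolding b_def using that by (intro a) (simp_all add: less_mult_imp_div_less power_add)
  then have "\<forall>l\<in>{..<2 ^ (k + N)}. \<exists>y z w. b l = (y + z) /\<^sub>R 2 \<and> y \<in> A \<and> z \<in> A \<and> norm w \<le> 1 \<and>
     \<epsilon> * ((y + z) /\<^sub>R 2) f \<le> (y - z) w"
    unfolding split_points_def by blast
  then obtain y z w where yz: "\<And>l. l < 2 ^ (k + N) \<Longrightarrow> b l = (y l + z l) /\<^sub>R 2 \<and> y l \<in> A \<and> z l \<in> A \<and>
     norm (w l) \<le> 1 \<and> \<epsilon> * ((y l + z l) /\<^sub>R 2) f \<le> (y l - z l) (w l)"
    by (metis (no_types, lifting) lessThan_iff)
  \<comment> \<open>The two points of the \<open>l\<close>-th midpoint become siblings.\<close>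
  define X' where "X' l = (if even l then y (l div 2) else z (l div 2))" for l
  have X'2: "X' (2 * i) = y i" "X' (2 * i + 1) = z i" for i by (simp_all add: X'_def)
  have diff: "step_measure k X (dyadic k j) - step_measure (k + Suc N) X' (dyadic k j) = (X j - h j) /\<^sub>R 2 ^ k"
    if j: "j < 2 ^ k" for j
  proof -
    have jl: "j * 2 ^ N + i < 2 ^ (k + N)" if "i < 2 ^ N" for i
    proof -
      have "j * 2 ^ N + i < (j + 1) * 2 ^ N" using that by simp
      also have "\<dots> \<le> 2 ^ k * 2 ^ N" using j by (intro mult_right_mono) auto
      finally show ?thesis by (simp add: power_add)
    qed
    have "(\<Sum>r<2 ^ Suc N. X' (j * 2 ^ Suc N + r)) = (\<Sum>i<2 ^ N. 2 *\<^sub>R a j i)"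
      unfolding sum_dyadic_pairs
    proof (rule sum.cong[OF refl])
      fix i :: nat assume "i \<in> {..<2 ^ N}"
      then have i: "i < 2 ^ N" by simp
      have "j * 2 ^ Suc N + 2 * i = 2 * (j * 2 ^ N + i)" "j * 2 ^ Suc N + (2 * i + 1) = 2 * (j * 2 ^ N + i) + 1" by simp_all
      then have "X' (j * 2 ^ Suc N + 2 * i) + X' (j * 2 ^ Suc N + (2 * i + 1)) = y (j * 2 ^ N + i) + z (j * 2 ^ N + i)"
        by (simp only: X'2)
      also have "\<dots> = 2 *\<^sub>R b (j * 2 ^ N + i)" using yz[OF jl[OF i]] by simp
      also have "b (j * 2 ^ N + i) = a j i" using i by (simp add: b_def)
      finally show "X' (j * 2 ^ Suc N + 2 * i) + X' (j * 2 ^ Suc N + (2 * i + 1)) = 2 *\<^sub>R a j i" .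
    qed
    also have "\<dots> = 2 *\<^sub>R (2 ^ N *\<^sub>R h j)" by (simp add: ha[OF j] flip: scaleR_sum_right)
    finally have "step_measure (k + Suc N) X' (dyadic k j) = h j /\<^sub>R 2 ^ k"
      by (simp only: step_measure_refined[OF j]) (simp add: power_add field_simps)
    then show ?thesis by (simp add: step_measure_cell[OF j] scaleR_diff_right)
  qed
  show thesis
  proof (rule that[of "k + Suc N" "F \<union> w ` {..<2 ^ (k + N)}" X'])
    show "X' j \<in> A" if "j < 2 ^ (k + Suc N)" for j
    proof -
      have "j div 2 < 2 ^ (k + N)" using that by auto
      from yz[OF this] show ?thesis by (simp add: X'_def)
    qed
    show "\<exists>w'\<in>F \<union> w ` {..<2 ^ (k + N)}. norm w' \<le> 1 \<and>
        \<epsilon> * ((X' (2 * i) + X' (2 * i + 1)) /\<^sub>R 2) f \<le> (X' (2 * i) - X' (2 * i + 1)) w'"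
      if "i < 2 ^ (k + Suc N - 1)" for i
    proof -
      have i: "i < 2 ^ (k + N)" using that by simp
      show ?thesis unfolding X'2 using yz[OF i] i by (intro bexI[of _ "w i"]) auto
    qed
    show "\<bar>(step_measure k X (dyadic k j) - step_measure (k + Suc N) X' (dyadic k j)) v\<bar> \<le> \<eta> / 2 ^ k"
      if "j < 2 ^ k" "v \<in> F" for j v
      unfolding diff[OF that(1)] using hF[OF that]
      by (simp add: scaleR_blinfun.rep_eq abs_mult divide_inverse mult.commute mult_right_mono)
    show "norm (step_measure k X (dyadic k j) - step_measure (k + Suc N) X' (dyadic k j)) \<le> \<eta> / 2 ^ k"
      if "j < 2 ^ k" strong for j
      unfolding diff[OF that(1)] using hs[OF that]
      by (simp add: divide_inverse mult.commute mult_right_mono)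
  qed (use F in auto)
qed

section \<open>An oscillating vector measure\<close>

lemma sublinear_evaluation: "sublinear (\<lambda>v :: 'w::real_normed_vector \<Rightarrow>\<^sub>L real. \<bar>v w\<bar>)"
  by (auto simp: sublinear_def plus_blinfun.rep_eq scaleR_blinfun.rep_eq abs_mult)

lemma weak_limit_of_additive:
  fixes S :: "nat \<Rightarrow> real set \<Rightarrow> ('w::real_normed_vector \<Rightarrow>\<^sub>L real)"
  assumes add: "\<And>n E E'. E \<in> sets borel \<Longrightarrow> E' \<in> sets borel \<Longrightarrow> E \<inter> E' = {} \<Longrightarrow> S n (E \<union> E') = S n E + S n E'"
    and bd: "\<And>n E. E \<in> sets borel \<Longrightarrow> norm (S n E) \<le> C * measure unit_measure E"
  obtains F G where "F \<le> sequentially" "F \<noteq> bot"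
    "\<And>E w. E \<in> sets borel \<Longrightarrow> ((\<lambda>n. S n E w) \<longlongrightarrow> blinfun_apply (G E) w) F"
    "\<And>E E'. E \<in> sets borel \<Longrightarrow> E' \<in> sets borel \<Longrightarrow> E \<inter> E' = {} \<Longrightarrow> G (E \<union> E') = G E + G E'"
    "\<And>E. E \<in> sets borel \<Longrightarrow> norm (G E) \<le> C * measure unit_measure E"
proof -
  let ?m = "measure unit_measure"
  \<comment> \<open>Coordinates are pairs of a set and a vector. The value 0 at sets that are not Borel keeps every coordinate bounded.\<close>
  define a where "a n i = (if fst i \<in> sets borel then blinfun_apply (S n (fst i)) (snd i) else 0)" for n and i :: "real set \<times> 'w"
  have le: "\<bar>S n E w\<bar> \<le> C * ?m E * norm w" if "E \<in> sets borel" for n E w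
  proof -
    have "\<bar>S n E w\<bar> \<le> norm (S n E) * norm w" using norm_blinfun[of "S n E" w] by simp
    also have "\<dots> \<le> C * ?m E * norm w" by (intro mult_right_mono bd that) simp
    finally show ?thesis .
  qed
  define B where "B i = (if fst i \<in> sets borel then C * ?m (fst i) * norm (snd i) else 0)" for i :: "real set \<times> 'w"
  have aB: "\<bar>a n i\<bar> \<le> B i" for n i
    using le[of "fst i" n "snd i"] by (simp add: a_def B_def del: measure_uniform_measure)
  obtain F g where F: "F \<le> sequentially" "F \<noteq> bot" "\<And>i. ((\<lambda>n. a n i) \<longlongrightarrow> g i) F"
    using bounded_sequence_cluster_filter[of a B, OF aB] by blast
  have lim: "((\<lambda>n. S n E w) \<longlongrightarrow> g (E, w)) F" if "E \<in> sets borel" for E w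
    using F(3)[of "(E, w)"] that by (simp add: a_def)
  define G where "G E = Blinfun (\<lambda>w. g (E, w))" for E
  have gle: "\<bar>g (E, w)\<bar> \<le> C * ?m E * norm w" if "E \<in> sets borel" for E w
    by (rule tendsto_upperbound[OF tendsto_rabs[OF lim[OF that]] always_eventually F(2)]) (use le[OF that] in blast)
  have bl: "bounded_linear (\<lambda>w. g (E, w))" if E: "E \<in> sets borel" for E
  proof (rule bounded_linear_intro)
    fix v w :: 'w and r :: real
    have "((\<lambda>n. S n E v + S n E w) \<longlongrightarrow> g (E, v + w)) F"
      using lim[OF E, of "v + w"] by (simp add: blinfun.add_right)
    then show "g (E, v + w) = g (E, v) + g (E, w)"
      by (rule tendsto_unique[OF F(2)]) (intro tendsto_add lim E)
    have "((\<lambda>n. r * S n E w) \<longlongrightarrow> g (E, r *\<^sub>R w)) F"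
      using lim[OF E, of "r *\<^sub>R w"] by (simp add: blinfun.scaleR_right)
    then have "g (E, r *\<^sub>R w) = r * g (E, w)"
      by (rule tendsto_unique[OF F(2)]) (intro tendsto_mult tendsto_const lim E)
    then show "g (E, r *\<^sub>R w) = r *\<^sub>R g (E, w)" by simp
    show "norm (g (E, w)) \<le> norm w * (C * ?m E)" using gle[OF E, of w] by (simp only: real_norm_def mult.commute)
  qed
  have G: "blinfun_apply (G E) w = g (E, w)" if "E \<in> sets borel" for E w
    by (simp add: G_def bounded_linear_Blinfun_apply[OF bl[OF that]])
  show thesis
  proof (rule that[OF F(1,2)])
    show "((\<lambda>n. S n E w) \<longlongrightarrow> blinfun_apply (G E) w) F" if "E \<in> sets borel" for E w
      using lim[OF that] by (simp add: G[OF that])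
    show "G (E \<union> E') = G E + G E'" if E: "E \<in> sets borel" "E' \<in> sets borel" "E \<inter> E' = {}" for E E'
    proof (rule blinfun_eqI)
      fix w
      have "((\<lambda>n. S n E w + S n E' w) \<longlongrightarrow> g (E \<union> E', w)) F"
        using lim[of "E \<union> E'" w] E by (simp add: add[OF E] plus_blinfun.rep_eq)
      then have "g (E \<union> E', w) = g (E, w) + g (E', w)"
        by (rule tendsto_unique[OF F(2)]) (intro tendsto_add lim E)
      then show "blinfun_apply (G (E \<union> E')) w = blinfun_apply (G E + G E') w"
        using E by (simp add: G plus_blinfun.rep_eq)
    qed
    show "norm (G E) \<le> C * ?m E" if E: "E \<in> sets borel" for E
    proof (rule norm_blinfun_bound)
      show "0 \<le> C * ?m E" using order_trans[OF norm_ge_zero bd[OF E]] .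
      show "norm (blinfun_apply (G E) w) \<le> C * ?m E * norm w" for w
        using gle[OF E, of w] by (simp only: G[OF E] real_norm_def)
    qed
  qed
qed

text \<open>
  The values on dyadic intervals decide, since rays are approximated in measure by finite unions of such
  intervals and \<open>V\<close> is closed.
\<close>

lemma additive_in_closed_subspace:
  fixes G :: "real set \<Rightarrow> 'x::banach"
  assumes add: "\<And>E E'. E \<in> sets borel \<Longrightarrow> E' \<in> sets borel \<Longrightarrow> E \<inter> E' = {} \<Longrightarrow> G (E \<union> E') = G E + G E'"
    and bd: "\<And>E. E \<in> sets borel \<Longrightarrow> norm (G E) \<le> C * measure unit_measure E"
    and V: "subspace V" "closed V"
    and k: "\<And>m. m \<le> k m"
    and cells: "\<And>m j. j < 2 ^ k m \<Longrightarrow> G (dyadic (k m) j) \<in> V"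
    and E: "E \<in> sets borel"
  shows "G E \<in> V"
proof -
  let ?m = "measure unit_measure"
  have C: "0 \<le> C" using order_trans[OF norm_ge_zero bd[of UNIV]] by simp
  have G0: "G {} = 0" using add[of "{}" "{}"] by simp
  have fin: "G (\<Union>j\<in>J. dyadic n j) = (\<Sum>j\<in>J. G (dyadic n j))" if "finite J" for J n
    using that
  proof induction
    case (insert j J)
    have "dyadic n j \<inter> dyadic n i = {}" if "i \<in> J" for i
      using that insert(2) by (intro dyadic_disjoint) auto
    then have "dyadic n j \<inter> (\<Union>j\<in>J. dyadic n j) = {}" by blast
    then show ?case using insert by (simp add: add sets.finite_UN)
  qed (simp add: G0)
  have outside: "G D = 0" if "D \<in> sets borel" "D \<inter> {0..<1} = {}" for D
  proof -
    have "?m D = 0" using that by (simp add: measure_unit Int_commute del: measure_uniform_measure)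
    then show ?thesis using bd[OF that(1)] by simp
  qed
  have GUNIV: "G UNIV \<in> V"
  proof -
    have "G UNIV = G (\<Union>j<2 ^ k 0. dyadic (k 0) j) + G (- {0..<1})"
      unfolding dyadic_Union by (subst add[symmetric]) (auto intro!: arg_cong[of _ _ G])
    also have "G (- {0..<1}) = 0" by (rule outside) auto
    also have "G (\<Union>j<2 ^ k 0. dyadic (k 0) j) + 0 \<in> V"
      by (auto simp: fin intro!: subspace_sum[OF V(1)] cells)
    finally show ?thesis .
  qed
  show ?thesis using E
  proof (induction E rule: borel_lessThan_induct)
    case (basic a)
    define E where a: "E = {..<a}"
    define J where "J m = {j. j < 2 ^ k m \<and> int j < \<lfloor>a * 2 ^ k m\<rfloor>}" for m
    define D where "D m = (\<Union>j\<in>J m. dyadic (k m) j)" for m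
    have DV: "G (D m) \<in> V" for m
      unfolding D_def by (subst fin) (auto simp: J_def intro!: subspace_sum[OF V(1)] cells)
    have Db: "D m \<in> sets borel" for m unfolding D_def by (intro sets.finite_UN) (auto simp: J_def)
    have DE: "D m \<subseteq> E" for m
    proof
      fix t assume "t \<in> D m"
      then have "\<lfloor>t * 2 ^ k m\<rfloor> < \<lfloor>a * 2 ^ k m\<rfloor>" by (auto simp: D_def J_def dyadic_def)
      then have "t * 2 ^ k m < a * 2 ^ k m" by (meson floor_mono leD not_less)
      then show "t \<in> E" by (simp add: a)
    qed
    have rest: "{0..<1} \<inter> (E - D m) \<subseteq> dyadic (k m) (nat \<lfloor>a * 2 ^ k m\<rfloor>)" for m
    proof
      fix t assume t: "t \<in> {0..<1} \<inter> (E - D m)"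
      then obtain j where j: "j < 2 ^ k m" "t \<in> dyadic (k m) j" using dyadic_Union[of "k m"] by blast
      then have "j \<notin> J m" using t by (auto simp: D_def)
      then have "\<lfloor>a * 2 ^ k m\<rfloor> \<le> int j" using j by (simp add: J_def)
      moreover have "\<lfloor>t * 2 ^ k m\<rfloor> \<le> \<lfloor>a * 2 ^ k m\<rfloor>" using t by (intro floor_mono) (simp add: a)
      then have "int j \<le> \<lfloor>a * 2 ^ k m\<rfloor>" using j(2) by (simp add: dyadic_def)
      ultimately show "t \<in> dyadic (k m) (nat \<lfloor>a * 2 ^ k m\<rfloor>)" using j(2) by simp
    qed
    have near: "norm (G (D m) - G E) \<le> C * (1 / 2 ^ m)" for m
    proof -
      have Eb: "E \<in> sets borel" by (simp add: a)
      have "G E = G (D m) + G (E - D m)"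
        by (subst add[symmetric]) (use DE Db Eb in \<open>auto intro!: arg_cong[of _ _ G]\<close>)
      then have "norm (G (D m) - G E) = norm (G (E - D m))" by (simp add: norm_minus_commute)
      also have "\<dots> \<le> C * ?m (E - D m)" using Db Eb by (intro bd) auto
      also have "?m (E - D m) = measure lborel ({0..<1} \<inter> (E - D m))"
        using Db Eb by (intro measure_unit) auto
      also have "\<dots> \<le> measure lborel (dyadic (k m) (nat \<lfloor>a * 2 ^ k m\<rfloor>))"
        using Db Eb by (intro measure_mono_fmeasurable rest) (auto simp: dyadic_eq fmeasurable_def divide_right_mono)
      also have "\<dots> = 1 / 2 ^ k m" by (simp add: dyadic_eq divide_right_mono diff_divide_distrib[symmetric])
      also have "\<dots> \<le> 1 / 2 ^ m" using k[of m] by (simp add: frac_le)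
      finally show ?thesis using C by (simp add: mult_left_mono)
    qed
    have "(\<lambda>m. C * (1 / 2) ^ m) \<longlonglongrightarrow> C * 0"
      by (intro tendsto_mult tendsto_const LIMSEQ_realpow_zero) auto
    then have "(\<lambda>m. C * (1 / 2 ^ m)) \<longlonglongrightarrow> 0" by (simp add: power_one_over)
    then have "(\<lambda>m. G (D m) - G E) \<longlonglongrightarrow> 0"
      by (rule Lim_null_comparison[OF always_eventually[OF allI[OF near]]])
    then have "(\<lambda>m. G (D m)) \<longlonglongrightarrow> G E" by (rule LIM_zero_cancel)
    then show ?case unfolding a[symmetric] by (rule closed_sequentially[OF V(2) DV])
  next
    case empty
    then show ?case by (simp add: G0 subspace_0[OF V(1)])
  next
    case (compl E)
    then have "E \<in> sets borel" by blast
    then have "G UNIV = G E + G (UNIV - E)"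
      by (subst add[symmetric]) (auto intro!: arg_cong[of _ _ G])
    then have "G (UNIV - E) = G UNIV - G E" by simp
    then show ?case using compl GUNIV by (simp add: subspace_diff[OF V(1)])
  next
    case (union A)
    have "range A \<subseteq> sets unit_measure"
      using union(2) by auto
    moreover have "vector_measure unit_measure G"
      using add bd by (rule vector_measure_of_additive)
    ultimately have "(\<lambda>n. G (A n)) sums G (\<Union>n. A n)"
      using union(1) unfolding vector_measure_def by blast
    then have "(\<lambda>n. \<Sum>i<n. G (A i)) \<longlonglongrightarrow> G (\<Union>n. A n)" by (simp add: sums_def)
    moreover have "(\<Sum>i<n. G (A i)) \<in> V" for n using union(3) by (intro subspace_sum[OF V(1)])
    ultimately show ?case by (intro closed_sequentially[OF V(2), of "\<lambda>n. \<Sum>i<n. G (A i)" "G (\<Union>n. A n)"])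
  qed
qed

text \<open>
  If every point of \<open>A\<close> is a limit of means of split midpoints, then iterated refinement gives step functions
  that are almost a martingale, and the limit \<open>G\<close> of their integrals oscillates on dyadic intervals of
  arbitrarily high level. The approximation is weak-star in general, so \<open>G\<close> is obtained as a cluster point;
  what survives in the limit is the separation of siblings, because it is witnessed by vectors at which the
  later changes are controlled. When the approximation is in norm (\<open>strong\<close>), the integrals over a dyadic
  interval converge in norm and the values of \<open>G\<close> stay in the closed span of \<open>A\<close>.
\<close>

theorem oscillating_measure:
  fixes A :: "('w::real_normed_vector \<Rightarrow>\<^sub>L real) set" and strong :: bool
  assumes bd: "\<And>x. x \<in> A \<Longrightarrow> norm x \<le> C" and x0: "x0 \<in> A" "0 < blinfun_apply x0 f" and \<epsilon>: "0 < \<epsilon>"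
    and split: "\<And>x F \<eta>. x \<in> A \<Longrightarrow> finite F \<Longrightarrow> 0 < \<eta> \<Longrightarrow>
      \<exists>n. \<exists>h\<in>dyadic_means (split_points \<epsilon> f A) n.
        (\<forall>w\<in>F. \<bar>(x - h) w\<bar> \<le> \<eta>) \<and> (strong \<longrightarrow> norm (x - h) \<le> \<eta>)"
  obtains G :: "real set \<Rightarrow> ('w \<Rightarrow>\<^sub>L real)" where
    "\<And>E E'. E \<in> sets borel \<Longrightarrow> E' \<in> sets borel \<Longrightarrow> E \<inter> E' = {} \<Longrightarrow> G (E \<union> E') = G E + G E'"
    "\<And>E. E \<in> sets borel \<Longrightarrow> norm (G E) \<le> C * measure unit_measure E"
    "\<And>E. strong \<Longrightarrow> E \<in> sets borel \<Longrightarrow> G E \<in> closure (span A)"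
    "\<not> dyadic_oscillation G \<longlonglongrightarrow> 0"
proof -
  let ?m = "measure unit_measure"
  have total: "?m UNIV = 1" by (subst measure_uniform_measure) auto
  define \<beta> where "\<beta> = blinfun_apply x0 f"
  \<comment> \<open>The \<open>n\<close>-th refinement errs by at most \<open>\<tau> / 2^{n+1}\<close>, so the total drift is at most \<open>\<tau>\<close>. The choice solves \<open>\<epsilon> (\<beta> - \<tau>) / 2 - \<tau> = \<epsilon> \<beta> / 4\<close>, which is the oscillation that remains.\<close>
  define \<tau> where "\<tau> = \<epsilon> * \<beta> / (4 + 2 * \<epsilon>)"
  have \<beta>: "0 < \<beta>" using x0 by (simp add: \<beta>_def)
  have \<tau>: "0 < \<tau>" using \<beta> \<epsilon> by (simp add: \<tau>_def add_pos_pos)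
  define P where "P n s = (case s of (k, X, F) \<Rightarrow> finite F \<and> f \<in> F \<and> (\<forall>j<2 ^ k. X j \<in> A) \<and>
      (n = 0 \<longrightarrow> k = 0 \<and> X 0 = x0))" for n :: nat and s :: "nat \<times> (nat \<Rightarrow> 'w \<Rightarrow>\<^sub>L real) \<times> 'w set"
  define Q where "Q n s s' = (case s of (k, X, F) \<Rightarrow> case s' of (k', X', F') \<Rightarrow> k < k' \<and> F \<subseteq> F' \<and>
      (\<forall>i<2 ^ (k' - 1). \<exists>w\<in>F'. norm w \<le> 1 \<and>
        \<epsilon> * blinfun_apply ((X' (2 * i) + X' (2 * i + 1)) /\<^sub>R 2) f \<le> blinfun_apply (X' (2 * i) - X' (2 * i + 1)) w) \<and>
      (\<forall>j<2 ^ k. \<forall>w\<in>F. \<bar>blinfun_apply (step_measure k X (dyadic k j) - step_measure k' X' (dyadic k j)) w\<bar> \<le> \<tau> / 2 ^ Suc n / 2 ^ k) \<and>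
      (\<forall>j<2 ^ k. strong \<longrightarrow> norm (step_measure k X (dyadic k j) - step_measure k' X' (dyadic k j)) \<le> \<tau> / 2 ^ Suc n / 2 ^ k))"
    for n :: nat and s s' :: "nat \<times> (nat \<Rightarrow> 'w \<Rightarrow>\<^sub>L real) \<times> 'w set"
  have "\<exists>s. \<forall>n. P n (s n) \<and> Q n (s n) (s (Suc n))"
  proof (rule dependent_nat_choice)
    show "\<exists>s. P 0 s"
      by (rule exI[of _ "(0, \<lambda>_. x0, {f})"]) (simp add: P_def x0)
  next
    fix s n assume "P n s"
    then obtain k X F where s: "s = (k, X, F)" and F: "finite F" "f \<in> F" and X: "\<And>j. j < 2 ^ k \<Longrightarrow> X j \<in> A"
      unfolding P_def by (cases s) auto
    have "0 < \<tau> / 2 ^ Suc n" using \<tau> by simp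
    from split[OF _ F(1) this] have "\<And>x. x \<in> A \<Longrightarrow> \<exists>na. \<exists>h\<in>dyadic_means (split_points \<epsilon> f A) na.
        (\<forall>w\<in>F. \<bar>(x - h) w\<bar> \<le> \<tau> / 2 ^ Suc n) \<and> (strong \<longrightarrow> norm (x - h) \<le> \<tau> / 2 ^ Suc n)" .
    from refine_step_function[of A \<epsilon> f F "\<tau> / 2 ^ Suc n" strong k X, OF this F(1) X]
    obtain k' X' F' where *: "k < k'" "finite F'" "F \<subseteq> F'" "\<And>j. j < 2 ^ k' \<Longrightarrow> X' j \<in> A"
    "\<And>i. i < 2 ^ (k' - 1) \<Longrightarrow> \<exists>w\<in>F'. norm w \<le> 1 \<and>
        \<epsilon> * blinfun_apply ((X' (2 * i) + X' (2 * i + 1)) /\<^sub>R 2) f \<le> blinfun_apply (X' (2 * i) - X' (2 * i + 1)) w"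
    "\<And>j w. j < 2 ^ k \<Longrightarrow> w \<in> F \<Longrightarrow>
        \<bar>blinfun_apply (step_measure k X (dyadic k j) - step_measure k' X' (dyadic k j)) w\<bar> \<le> \<tau> / 2 ^ Suc n / 2 ^ k"
    "\<And>j. j < 2 ^ k \<Longrightarrow> strong \<Longrightarrow>
        norm (step_measure k X (dyadic k j) - step_measure k' X' (dyadic k j)) \<le> \<tau> / 2 ^ Suc n / 2 ^ k"
      by metis
    have "P (Suc n) (k', X', F')" unfolding P_def using *(2,3,4) F by auto
    moreover have "Q n s (k', X', F')" unfolding Q_def s prod.case using * by blast
    ultimately show "\<exists>y. P (Suc n) y \<and> Q n s y" by blast
  qed
  then obtain s where s: "\<And>n. P n (s n)" "\<And>n. Q n (s n) (s (Suc n))" by blast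
  define K X F where "K n = fst (s n)" and "X n = fst (snd (s n))" and "F n = snd (snd (s n))" for n
  have sn: "s n = (K n, X n, F n)" for n by (simp add: K_def X_def F_def)
  have fF: "f \<in> F n" and XA: "\<And>j. j < 2 ^ K n \<Longrightarrow> X n j \<in> A" and K0: "K 0 = 0" and X0: "X 0 0 = x0" for n
    using s(1)[of n] s(1)[of 0] unfolding sn P_def by auto
  have KS: "K n < K (Suc n)" and FS: "F n \<subseteq> F (Suc n)" for n
    using s(2)[of n] unfolding sn Q_def by auto
  have Kmono: "m \<le> n \<Longrightarrow> K m \<le> K n" for m n using KS lift_Suc_mono_le[of K m n] less_imp_le by blast
  have Kge: "n \<le> K n" for n
    using KS by (induction n) (auto intro: le_less_trans Suc_leI)
  have Fmono: "m \<le> n \<Longrightarrow> F m \<subseteq> F n" for m n using FS lift_Suc_mono_le[of F m n] by blast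
  have witness: "\<exists>w\<in>F (Suc n). norm w \<le> 1 \<and>
        \<epsilon> * ((X (Suc n) (2 * i) + X (Suc n) (2 * i + 1)) /\<^sub>R 2) f \<le> (X (Suc n) (2 * i) - X (Suc n) (2 * i + 1)) w"
    if "i < 2 ^ (K (Suc n) - 1)" for n i
    using s(2)[of n] that unfolding sn Q_def prod.case by blast
  define S where "S n = step_measure (K n) (X n)" for n
  have weak: "\<bar>(S n (dyadic (K n) j) - S (Suc n) (dyadic (K n) j)) w\<bar> \<le> \<tau> / 2 ^ Suc n / 2 ^ K n"
    if "j < 2 ^ K n" "w \<in> F n" for n j w
    using s(2)[of n] that unfolding sn Q_def prod.case S_def by blast
  have norm: "norm (S n (dyadic (K n) j) - S (Suc n) (dyadic (K n) j)) \<le> \<tau> / 2 ^ Suc n / 2 ^ K n"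
    if "j < 2 ^ K n" strong for n j
    using s(2)[of n] that unfolding sn Q_def prod.case S_def by blast
  have drift: "p (S m E - S n E) \<le> (\<tau> / 2 ^ m - \<tau> / 2 ^ n) * ?m E"
    if p: "sublinear p" and E: "E \<in> sets borel" "aligned (K m) E" and mn: "m \<le> n"
      and cell: "\<And>l j. m \<le> l \<Longrightarrow> j < 2 ^ K l \<Longrightarrow>
        p (S l (dyadic (K l) j) - S (Suc l) (dyadic (K l) j)) \<le> \<tau> / 2 ^ Suc l / 2 ^ K l"
    for p m n E
    using mn
  proof (induction n rule: dec_induct)
    case base
    then show ?case by (simp add: sublinear_zero[OF p])
  next
    case (step n)
    have "p (S n E - S (Suc n) E) \<le> \<tau> / 2 ^ Suc n * ?m E"
      unfolding S_def
      by (rule aligned_difference_le[OF p E(1) aligned_mono[OF E(2) Kmono]])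
        (use step \<tau> cell[of n] in \<open>auto simp: S_def\<close>)
    moreover have "p (S m E - S (Suc n) E) \<le> p (S m E - S n E) + p (S n E - S (Suc n) E)"
      using sublinear_add[OF p, of "S m E - S n E" "S n E - S (Suc n) E"] by simp
    ultimately have "p (S m E - S (Suc n) E) \<le> (\<tau> / 2 ^ m - \<tau> / 2 ^ n) * ?m E + \<tau> / 2 ^ Suc n * ?m E"
      using step.IH by linarith
    also have "\<dots> = (\<tau> / 2 ^ m - \<tau> / 2 ^ Suc n) * ?m E" by (simp add: field_simps del: measure_uniform_measure)
    finally show ?case .
  qed
  have drift': "p (S m E - S n E) \<le> \<tau> / 2 ^ m * ?m E"
    if "sublinear p" "E \<in> sets borel" "aligned (K m) E" "m \<le> n"
      "\<And>l j. m \<le> l \<Longrightarrow> j < 2 ^ K l \<Longrightarrow>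
        p (S l (dyadic (K l) j) - S (Suc l) (dyadic (K l) j)) \<le> \<tau> / 2 ^ Suc l / 2 ^ K l"
    for p m n E
    by (rule order_trans[OF drift[OF that] mult_right_mono]) (use \<tau> in auto)
  have drift_weak: "\<bar>(S m E - S n E) w\<bar> \<le> \<tau> / 2 ^ m * ?m E"
    if "E \<in> sets borel" "aligned (K m) E" "m \<le> n" "w \<in> F m" for m n E w
    using Fmono that(4) by (intro drift'[OF sublinear_evaluation that(1-3)] weak) auto
  obtain \<F> G where \<F>: "\<F> \<le> sequentially" "\<F> \<noteq> bot"
    and lim: "\<And>E w. E \<in> sets borel \<Longrightarrow> ((\<lambda>n. S n E w) \<longlongrightarrow> blinfun_apply (G E) w) \<F>"
    and Gadd: "\<And>E E'. E \<in> sets borel \<Longrightarrow> E' \<in> sets borel \<Longrightarrow> E \<inter> E' = {} \<Longrightarrow> G (E \<union> E') = G E + G E'"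
    and Gbd: "\<And>E. E \<in> sets borel \<Longrightarrow> norm (G E) \<le> C * ?m E"
  proof (rule weak_limit_of_additive[of S C])
    show "S n (E \<union> E') = S n E + S n E'" if "E \<in> sets borel" "E' \<in> sets borel" "E \<inter> E' = {}" for n E E'
      unfolding S_def using that by (rule step_measure_additive)
    show "norm (S n E) \<le> C * ?m E" if "E \<in> sets borel" for n E
      unfolding S_def by (rule norm_step_measure_le[OF that]) (use bd XA in blast)
  qed blast
  have limit_weak: "\<bar>(S m E - G E) w\<bar> \<le> \<tau> / 2 ^ m * ?m E"
    if E: "E \<in> sets borel" "aligned (K m) E" and w: "w \<in> F m" for m E w
  proof (rule tendsto_upperbound[OF _ _ \<F>(2)])
    show "((\<lambda>n. \<bar>(S m E - S n E) w\<bar>) \<longlongrightarrow> \<bar>(S m E - G E) w\<bar>) \<F>"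
      unfolding minus_blinfun.rep_eq by (intro tendsto_intros lim E)
    have "\<forall>\<^sub>F n in sequentially. \<bar>(S m E - S n E) w\<bar> \<le> \<tau> / 2 ^ m * ?m E"
      using eventually_ge_at_top[of m] by (rule eventually_mono) (rule drift_weak[OF E _ w])
    then show "\<forall>\<^sub>F n in \<F>. \<bar>(S m E - S n E) w\<bar> \<le> \<tau> / 2 ^ m * ?m E"
      using \<F>(1) by (rule filter_leD[rotated])
  qed
  have osc: "\<epsilon> * \<beta> / 4 \<le> (\<Sum>i<2 ^ k. norm (G (dyadic (Suc k) (2 * i)) - G (dyadic (Suc k) (2 * i + 1))))"
    if k: "Suc k = K (Suc n)" for k n
  proof -
    let ?N = "Suc n"
    have pair: "(\<epsilon> * ((X ?N (2 * i) + X ?N (2 * i + 1)) f / 2) - 2 * \<tau>) / 2 ^ Suc k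
        \<le> norm (G (dyadic (Suc k) (2 * i)) - G (dyadic (Suc k) (2 * i + 1)))" if i: "i < 2 ^ k" for i
    proof -
      let ?L = "dyadic (Suc k) (2 * i)" and ?R = "dyadic (Suc k) (2 * i + 1)"
      have i2: "2 * i < 2 ^ Suc k" "2 * i + 1 < 2 ^ Suc k" using i by auto
      have "i < 2 ^ (K ?N - 1)" using i by (simp flip: k)
      from witness[OF this] obtain w where w: "w \<in> F ?N" "norm w \<le> 1"
        "\<epsilon> * ((X ?N (2 * i) + X ?N (2 * i + 1)) /\<^sub>R 2) f \<le> (X ?N (2 * i) - X ?N (2 * i + 1)) w" by blast
      have cellS: "S ?N (dyadic (Suc k) j) = X ?N j /\<^sub>R 2 ^ Suc k" if "j < 2 ^ Suc k" for j
        unfolding S_def k[symmetric] by (rule step_measure_cell[OF that])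
      have close: "\<bar>(S ?N (dyadic (Suc k) j) - G (dyadic (Suc k) j)) w\<bar> \<le> \<tau> / 2 ^ Suc k" if "j < 2 ^ Suc k" for j
      proof -
        have "aligned (K ?N) (dyadic (Suc k) j)" by (rule aligned_dyadic) (simp add: k)
        from limit_weak[OF dyadic_borel this w(1)]
        have "\<bar>(S ?N (dyadic (Suc k) j) - G (dyadic (Suc k) j)) w\<bar> \<le> \<tau> / 2 ^ ?N * (1 / 2 ^ Suc k)"
          by (simp only: measure_dyadic[OF that])
        also have "\<dots> \<le> \<tau> / 1 * (1 / 2 ^ Suc k)"
          using \<tau> one_le_power[of "2 :: real" ?N] by (intro mult_right_mono divide_left_mono) auto
        finally show ?thesis by simp
      qed
      have "(\<epsilon> * ((X ?N (2 * i) + X ?N (2 * i + 1)) f / 2) - 2 * \<tau>) / 2 ^ Suc k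
         \<le> ((X ?N (2 * i) - X ?N (2 * i + 1)) w - 2 * \<tau>) / 2 ^ Suc k"
        using w(3) by (intro divide_right_mono diff_right_mono) (auto simp: scaleR_blinfun.rep_eq)
      also have "\<dots> = X ?N (2 * i) w / 2 ^ Suc k - X ?N (2 * i + 1) w / 2 ^ Suc k - \<tau> / 2 ^ Suc k - \<tau> / 2 ^ Suc k"
        by (simp only: minus_blinfun.rep_eq diff_divide_distrib mult_2 add_divide_distrib diff_diff_eq)
      also have "\<dots> = S ?N ?L w - S ?N ?R w - \<tau> / 2 ^ Suc k - \<tau> / 2 ^ Suc k"
        unfolding cellS[OF i2(1)] cellS[OF i2(2)] by (simp only: scaleR_blinfun.rep_eq divide_inverse mult.commute real_scaleR_def)
      also have "\<dots> \<le> (G ?L - G ?R) w"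
        using close[OF i2(1)] close[OF i2(2)] unfolding minus_blinfun.rep_eq by linarith
      also have "\<dots> \<le> norm (G ?L - G ?R) * norm w" using norm_blinfun[of "G ?L - G ?R" w] by simp
      also have "\<dots> \<le> norm (G ?L - G ?R)" using w(2) by (simp add: mult_left_le)
      finally show ?thesis .
    qed
    have SU: "S ?N UNIV f = (\<Sum>i<2 ^ k. (X ?N (2 * i) + X ?N (2 * i + 1)) f) / 2 ^ Suc k"
    proof -
      have "S ?N UNIV = (\<Sum>j<2 ^ Suc k. (1 / 2 ^ Suc k) *\<^sub>R X ?N j)"
        unfolding S_def k[symmetric] step_measure_def
        by (intro sum.cong refl) (simp only: Int_UNIV_left measure_dyadic lessThan_iff)
      also have "\<dots> = (\<Sum>i<2 ^ k. (1 / 2 ^ Suc k) *\<^sub>R (X ?N (2 * i) + X ?N (2 * i + 1)))"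
        unfolding sum_dyadic_pairs by (simp only: scaleR_add_right)
      finally show ?thesis
        by (simp add: blinfun.sum_left scaleR_blinfun.rep_eq sum_divide_distrib)
    qed
    have "\<bar>(S 0 UNIV - S ?N UNIV) f\<bar> \<le> \<tau> / 2 ^ 0 * ?m UNIV"
      by (rule drift_weak) (auto simp: aligned_def fF)
    moreover have "S 0 UNIV = x0"
      using total dyadic_Union[of 0] by (simp add: S_def step_measure_def K0 X0 measure_dyadic del: measure_uniform_measure)
    ultimately have drop: "\<beta> - \<tau> \<le> S ?N UNIV f"
      unfolding total \<beta>_def by (simp add: minus_blinfun.rep_eq)
    have "\<epsilon> * \<beta> / 4 = \<epsilon> * (\<beta> - \<tau>) / 2 - \<tau>"
    proof -
      have "\<tau> * (4 + 2 * \<epsilon>) = \<epsilon> * \<beta>" using \<epsilon> by (simp add: \<tau>_def)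
      then show ?thesis by (simp add: field_simps)
    qed
    also have "\<dots> \<le> \<epsilon> * S ?N UNIV f / 2 - \<tau>"
      using drop \<epsilon> by (intro diff_right_mono divide_right_mono mult_left_mono) auto
    also have "\<dots> = (\<Sum>i<2 ^ k. (\<epsilon> * ((X ?N (2 * i) + X ?N (2 * i + 1)) f / 2) - 2 * \<tau>) / 2 ^ Suc k)"
    proof -
      let ?b = "\<lambda>i. (X ?N (2 * i) + X ?N (2 * i + 1)) f"
      have "(\<Sum>i<2 ^ k. (\<epsilon> * (?b i / 2) - 2 * \<tau>) / 2 ^ Suc k) = (\<Sum>i<2 ^ k. \<epsilon> / 2 / 2 ^ Suc k * ?b i - \<tau> / 2 ^ k)"
        by (intro sum.cong refl) (simp add: field_simps)
      also have "\<dots> = \<epsilon> / 2 / 2 ^ Suc k * (\<Sum>i<2 ^ k. ?b i) - \<tau>"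
        by (simp add: sum_subtractf sum_distrib_left)
      also have "\<dots> = \<epsilon> * S ?N UNIV f / 2 - \<tau>" unfolding SU by simp
      finally show ?thesis by simp
    qed
    also have "\<dots> \<le> (\<Sum>i<2 ^ k. norm (G (dyadic (Suc k) (2 * i)) - G (dyadic (Suc k) (2 * i + 1))))"
      by (intro sum_mono pair) simp
    finally show ?thesis .
  qed
  show thesis
  proof (rule that[of G])
    show "\<not> dyadic_oscillation G \<longlonglongrightarrow> 0"
      (is "\<not> ?o \<longlonglongrightarrow> 0")
    proof
      assume "?o \<longlonglongrightarrow> 0"
      moreover have "0 < \<epsilon> * \<beta> / 4" using \<epsilon> \<beta> by simp
      ultimately have "\<forall>\<^sub>F k in sequentially. ?o k < \<epsilon> * \<beta> / 4" by (rule order_tendstoD(2))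
      then obtain k0 where k0: "\<And>k. k \<ge> k0 \<Longrightarrow> ?o k < \<epsilon> * \<beta> / 4" unfolding eventually_sequentially by blast
      obtain k where k: "Suc k = K (Suc k0)" using KS[of k0] by (cases "K (Suc k0)") auto
      then have "k0 \<le> k" using Kge[of "Suc k0"] by simp
      then show False using k0[of k] osc[OF k] by simp
    qed
    show "G E \<in> closure (span A)" if strong and E: "E \<in> sets borel" for E
    proof (rule additive_in_closed_subspace[OF Gadd Gbd subspace_closure_span closed_closure Kge _ E])
      fix m j :: nat assume "j < 2 ^ K m"
      let ?E = "dyadic (K m) j"
      have SV: "S n ?E \<in> span A" for n
        unfolding S_def step_measure_def
        by (intro span_sum span_scale span_base XA) simp
      have close: "norm (S n ?E - S l ?E) \<le> \<tau> / 2 ^ n" if "m \<le> n" "n \<le> l" for n l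
      proof -
        have "norm (S n ?E - S l ?E) \<le> \<tau> / 2 ^ n * ?m ?E"
          by (rule drift'[OF sublinear_norm dyadic_borel aligned_dyadic[OF Kmono[OF that(1)]] that(2) norm[OF _ \<open>strong\<close>]])
        also have "\<dots> \<le> \<tau> / 2 ^ n * 1"
          using \<tau> measure_dyadic[OF \<open>j < 2 ^ K m\<close>] by (intro mult_left_mono) auto
        finally show ?thesis by simp
      qed
      have "Cauchy (\<lambda>n. S n ?E)"
      proof (rule CauchyI')
        fix e :: real assume e: "0 < e"
        have "(\<lambda>n. \<tau> * (1 / 2) ^ n) \<longlonglongrightarrow> \<tau> * 0"
          by (intro tendsto_intros LIMSEQ_realpow_zero) auto
        then have "(\<lambda>n. \<tau> / 2 ^ n) \<longlonglongrightarrow> 0" by (simp add: power_one_over)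
        from order_tendstoD(2)[OF this e] obtain N where N: "\<And>n. n \<ge> N \<Longrightarrow> \<tau> / 2 ^ n < e"
          unfolding eventually_sequentially by blast
        have "dist (S n ?E) (S l ?E) < e" if "max N m \<le> n" "n < l" for n l
          using le_less_trans[OF close N] that by (simp add: dist_norm)
        then show "\<exists>M. \<forall>n\<ge>M. \<forall>l>n. dist (S n ?E) (S l ?E) < e" by blast
      qed
      then obtain L where L: "(\<lambda>n. S n ?E) \<longlonglongrightarrow> L" using Cauchy_convergent convergent_def by blast
      have "blinfun_apply (G ?E) w = blinfun_apply L w" for w
      proof (rule tendsto_unique[OF \<F>(2) lim[OF dyadic_borel]])
        have "(\<lambda>n. S n ?E w) \<longlonglongrightarrow> L w" by (intro tendsto_intros L)
        then show "((\<lambda>n. S n ?E w) \<longlongrightarrow> L w) \<F>" using \<F>(1) by (rule tendsto_mono[rotated])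
      qed
      then have GL: "G ?E = L" by (intro blinfun_eqI)
      have "S n ?E \<in> closure (span A)" for n using SV[of n] closure_subset[of "span A"] by (rule subsetD[rotated])
      then show "G ?E \<in> closure (span A)"
        unfolding GL by (intro closed_sequentially[OF closed_closure _ L])
    qed
  qed (fact Gadd, fact Gbd)
qed

section \<open>Functionals with small slices\<close>

definition norming_set :: "('w::real_normed_vector \<Rightarrow>\<^sub>L real) set \<Rightarrow> bool" where
  "norming_set D \<longleftrightarrow> (\<forall>d\<in>D. norm d \<le> 1 \<and> - d \<in> D) \<and> (\<forall>w \<kappa>. \<kappa> < norm w \<longrightarrow> (\<exists>d\<in>D. \<kappa> < d w))"

lemma norming_setD:
  assumes "norming_set D"
  shows "d \<in> D \<Longrightarrow> norm d \<le> 1" "d \<in> D \<Longrightarrow> - d \<in> D" "\<kappa> < norm w \<Longrightarrow> \<exists>d\<in>D. \<kappa> < d w"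
  using assms by (auto simp: norming_set_def)

lemma norming_set_abs_le: "norming_set D \<Longrightarrow> d \<in> D \<Longrightarrow> \<bar>d w\<bar> \<le> norm w"
  using norm_blinfun[of d w] norming_setD(1)[of D d] mult_right_mono[of "norm d" 1 "norm w"] by simp

lemma norming_set_le: "norming_set D \<Longrightarrow> d \<in> D \<Longrightarrow> d w \<le> norm w"
  using norming_set_abs_le[of D d w] by simp

lemma norming_set_norm_le:
  assumes "norming_set D" "\<And>d. d \<in> D \<Longrightarrow> d w \<le> c"
  shows "norm w \<le> c"
  using norming_setD(3)[OF assms(1), of c w] assms(2) by force

text \<open>
  Vectors that have this property for all positive \<open>\<epsilon>\<close> are called strongly exposing: the slices that they cut
  off \<open>D\<close> shrink to a point.
\<close>

definition small_slice :: "('w::real_normed_vector \<Rightarrow>\<^sub>L real) set \<Rightarrow> real \<Rightarrow> 'w \<Rightarrow> bool" where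
  "small_slice D \<epsilon> w \<longleftrightarrow> (\<exists>\<alpha>>0. \<forall>y\<in>D. \<forall>z\<in>D.
      norm w - \<alpha> < blinfun_apply y w \<longrightarrow> norm w - \<alpha> < blinfun_apply z w \<longrightarrow> norm (y - z) \<le> \<epsilon>)"

lemma small_slice_scale:
  assumes D: "norming_set D" and c: "c \<noteq> 0" and small: "small_slice D \<epsilon> (c *\<^sub>R w)"
  shows "small_slice D \<epsilon> w"
proof -
  obtain \<alpha> where \<alpha>: "0 < \<alpha>" and sl: "\<And>y z. y \<in> D \<Longrightarrow> z \<in> D \<Longrightarrow> norm (c *\<^sub>R w) - \<alpha> < blinfun_apply y (c *\<^sub>R w) \<Longrightarrow>
      norm (c *\<^sub>R w) - \<alpha> < blinfun_apply z (c *\<^sub>R w) \<Longrightarrow> norm (y - z) \<le> \<epsilon>"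
    using small unfolding small_slice_def by blast
  have *: "norm (c *\<^sub>R w) - \<alpha> < \<bar>c\<bar> * r" if "norm w - \<alpha> / \<bar>c\<bar> < r" for r
  proof -
    have "\<bar>c\<bar> * (norm w - \<alpha> / \<bar>c\<bar>) < \<bar>c\<bar> * r" using that c by (intro mult_strict_left_mono) auto
    then show ?thesis using c by (simp add: right_diff_distrib)
  qed
  show ?thesis
    unfolding small_slice_def
  proof (intro exI[of _ "\<alpha> / \<bar>c\<bar>"] conjI ballI impI)
    show "0 < \<alpha> / \<bar>c\<bar>" using \<alpha> c by simp
    fix y z assume yz: "y \<in> D" "z \<in> D" "norm w - \<alpha> / \<bar>c\<bar> < blinfun_apply y w" "norm w - \<alpha> / \<bar>c\<bar> < blinfun_apply z w"
    show "norm (y - z) \<le> \<epsilon>"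
    proof (cases "0 < c")
      case True
      then show ?thesis using sl[OF yz(1,2)] *[OF yz(3)] *[OF yz(4)] by (simp add: blinfun.scaleR_right)
    next
      case False
      then have "norm (- y - - z) \<le> \<epsilon>"
        using sl[of "- y" "- z"] *[OF yz(3)] *[OF yz(4)] yz(1,2) norming_setD(2)[OF D]
        by (simp add: blinfun.scaleR_right uminus_blinfun.rep_eq)
      then show ?thesis by (simp add: norm_minus_commute)
    qed
  qed
qed

lemma open_small_slice:
  assumes D: "norming_set D"
  shows "open {w. small_slice D \<epsilon> w}"
  unfolding open_dist
proof
  fix w assume "w \<in> {w. small_slice D \<epsilon> w}"
  then obtain \<alpha> where \<alpha>: "0 < \<alpha>" and sl: "\<And>y z. y \<in> D \<Longrightarrow> z \<in> D \<Longrightarrow> norm w - \<alpha> < blinfun_apply y w \<Longrightarrow>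
      norm w - \<alpha> < blinfun_apply z w \<Longrightarrow> norm (y - z) \<le> \<epsilon>"
    unfolding small_slice_def by blast
  show "\<exists>e>0. \<forall>v. dist v w < e \<longrightarrow> v \<in> {w. small_slice D \<epsilon> w}"
  proof (intro exI[of _ "\<alpha> / 3"] conjI allI impI CollectI)
    show "0 < \<alpha> / 3" using \<alpha> by simp
    fix v assume "dist v w < \<alpha> / 3"
    then have v: "norm (w - v) < \<alpha> / 3" by (simp add: dist_norm norm_minus_commute)
    have *: "norm w - \<alpha> < y w" if y: "y \<in> D" "norm v - \<alpha> / 3 < y v" for y
    proof -
      have "- norm (w - v) \<le> y (w - v)" using norming_set_abs_le[OF D y(1), of "w - v"] by simp
      then have "y v - norm (w - v) \<le> y w" by (simp add: blinfun.diff_right)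
      moreover have "norm w \<le> norm v + norm (w - v)" using norm_triangle_ineq[of v "w - v"] by simp
      ultimately show ?thesis using y(2) v by linarith
    qed
    show "small_slice D \<epsilon> v"
      unfolding small_slice_def using \<alpha> * sl by (intro exI[of _ "\<alpha> / 3"]) simp
  qed
qed

lemma split_points_subset:
  assumes "subspace X" "A \<subseteq> X"
  shows "split_points \<epsilon> f A \<subseteq> X"
  using assms by (auto simp: split_points_def intro!: subspace_scale subspace_add)

lemma exists_norm_witness:
  fixes x :: "'w::real_normed_vector \<Rightarrow>\<^sub>L real"
  assumes "\<epsilon> < norm x" "0 < \<epsilon>"
  obtains w where "norm w \<le> 1" "\<epsilon> \<le> x w"
proof -
  obtain w where w: "\<not> norm (x w) \<le> \<epsilon> * norm w"
    using norm_blinfun_bound[of \<epsilon> x] assms by force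
  then have w0: "w \<noteq> 0" by auto
  define v where "v = (sgn (x w) / norm w) *\<^sub>R w"
  have "x v = \<bar>x w\<bar> / norm w" by (simp add: v_def blinfun.scaleR_right sgn_mult_abs abs_sgn mult.commute)
  then have "\<epsilon> \<le> x v" using w w0 by (simp add: pos_le_divide_eq)
  moreover have "norm v \<le> 1" using w0 by (simp add: v_def sgn_real_def)
  ultimately show thesis by (rule that[rotated])
qed

lemma sublinear_sum_evaluation:
  fixes F :: "'w::real_normed_vector set"
  assumes "0 \<le> c"
  shows "sublinear (\<lambda>v :: 'w \<Rightarrow>\<^sub>L real. (\<Sum>w\<in>F. \<bar>blinfun_apply v w\<bar>) + c * norm v)"
proof -
  have "(\<Sum>w\<in>F. \<bar>blinfun_apply (u + v) w\<bar>) + c * norm (u + v)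
      \<le> (\<Sum>w\<in>F. \<bar>blinfun_apply u w\<bar>) + c * norm u + ((\<Sum>w\<in>F. \<bar>blinfun_apply v w\<bar>) + c * norm v)" for u v :: "'w \<Rightarrow>\<^sub>L real"
  proof -
    have "(\<Sum>w\<in>F. \<bar>blinfun_apply (u + v) w\<bar>) \<le> (\<Sum>w\<in>F. \<bar>blinfun_apply u w\<bar> + \<bar>blinfun_apply v w\<bar>)"
      by (intro sum_mono) (simp add: plus_blinfun.rep_eq)
    moreover have "c * norm (u + v) \<le> c * (norm u + norm v)"
      by (intro mult_left_mono norm_triangle_ineq assms)
    ultimately show ?thesis by (simp add: sum.distrib distrib_left)
  qed
  moreover have "(\<Sum>w\<in>F. \<bar>blinfun_apply (t *\<^sub>R v) w\<bar>) + c * norm (t *\<^sub>R v) = t * ((\<Sum>w\<in>F. \<bar>blinfun_apply v w\<bar>) + c * norm v)"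
    if "0 \<le> t" for t and v :: "'w \<Rightarrow>\<^sub>L real"
    using that by (simp add: scaleR_blinfun.rep_eq abs_mult sum_distrib_left distrib_left)
  ultimately show ?thesis unfolding sublinear_def by blast
qed

text \<open>
  If \<open>g\<close> is bounded on a large ball of the kernel of \<open>f\<close> by its own norm, then \<open>g\<close> is nearly
  proportional to \<open>f\<close>: subtracting a multiple of a fixed \<open>u\<close> with \<open>u f > 1/2\<close> moves any \<open>d\<close> into that kernel.
\<close>

lemma exposing_near_multiple:
  fixes f g :: "'w::real_normed_vector" and D X :: "('w \<Rightarrow>\<^sub>L real) set"
  assumes D: "norming_set D" and X: "subspace X" "D \<subseteq> X" and f: "norm f = 1" and R: "3 < R" and g: "g \<noteq> 0"
    and V: "\<And>v. v \<in> X \<Longrightarrow> blinfun_apply v f = 0 \<Longrightarrow> norm v \<le> R \<Longrightarrow> blinfun_apply v g \<le> norm g"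
  obtains c where "c \<noteq> 0" "norm (c *\<^sub>R g - f) \<le> 3 / (R - 3)"
proof -
  obtain u where u: "u \<in> D" "1 / 2 < u f" using norming_setD(3)[OF D, of "1 / 2" f] f by auto
  define a where "a = u g / u f"
  have "norm (g - a *\<^sub>R f) \<le> 3 / R * norm g"
  proof (rule norming_set_norm_le[OF D])
    fix d assume d: "d \<in> D"
    \<comment> \<open>The difference has norm at most 3, because \<open>\<bar>d f\<bar> \<le> 1\<close> and \<open>u f > 1 / 2\<close>.\<close>
    define v where "v = (R / 3) *\<^sub>R (d - (d f / u f) *\<^sub>R u)"
    have "v \<in> X" unfolding v_def using X d u by (intro subspace_scale subspace_diff) auto
    moreover have "v f = 0" using u by (simp add: v_def scaleR_blinfun.rep_eq minus_blinfun.rep_eq)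
    moreover have "norm v \<le> R"
    proof -
      have "\<bar>d f\<bar> \<le> 1" using norming_set_abs_le[OF D d, of f] f by simp
      then have "\<bar>d f / u f\<bar> \<le> 1 / (1 / 2)" using u unfolding abs_divide by (intro frac_le) auto
      then have "norm ((d f / u f) *\<^sub>R u) \<le> 2 * 1"
        unfolding norm_scaleR using norming_setD(1)[OF D u(1)] by (intro mult_mono) auto
      then have "norm (d - (d f / u f) *\<^sub>R u) \<le> 3"
        using norm_triangle_ineq4[of d "(d f / u f) *\<^sub>R u"] norming_setD(1)[OF D d] by simp
      then have "R / 3 * norm (d - (d f / u f) *\<^sub>R u) \<le> R / 3 * 3" using R by (intro mult_left_mono) auto
      then show ?thesis using R by (simp add: v_def)
    qed
    ultimately have "v g \<le> norm g" by (rule V)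
    also have "v g = R / 3 * d (g - a *\<^sub>R f)"
      by (simp add: v_def a_def scaleR_blinfun.rep_eq minus_blinfun.rep_eq blinfun.diff_right blinfun.scaleR_right)
    finally show "d (g - a *\<^sub>R f) \<le> 3 / R * norm g" using R by (simp add: field_simps)
  qed
  moreover have "norm g \<le> norm (g - a *\<^sub>R f) + \<bar>a\<bar>"
    using norm_triangle_ineq[of "g - a *\<^sub>R f" "a *\<^sub>R f"] f by simp
  ultimately have close: "R * norm (g - a *\<^sub>R f) \<le> 3 * norm g" and a: "norm g * (R - 3) \<le> \<bar>a\<bar> * R"
  proof -
    assume *: "norm (g - a *\<^sub>R f) \<le> 3 / R * norm g" "norm g \<le> norm (g - a *\<^sub>R f) + \<bar>a\<bar>"
    show 1: "R * norm (g - a *\<^sub>R f) \<le> 3 * norm g" using *(1) R by (simp add: field_simps)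
    have "R * norm g \<le> R * (norm (g - a *\<^sub>R f) + \<bar>a\<bar>)" using *(2) R by (intro mult_left_mono) auto
    then show "norm g * (R - 3) \<le> \<bar>a\<bar> * R" using 1 by (simp add: algebra_simps)
  qed
  have "0 < norm g * (R - 3)" using R g by simp
  then have a0: "a \<noteq> 0" using a by auto
  show thesis
  proof
    show "1 / a \<noteq> 0" using a0 by simp
    have "norm ((1 / a) *\<^sub>R g - f) = norm ((1 / a) *\<^sub>R (g - a *\<^sub>R f))" using a0 by (simp add: scaleR_diff_right)
    also have "\<dots> = norm (g - a *\<^sub>R f) / \<bar>a\<bar>" by simp
    also have "\<dots> \<le> 3 / (R - 3)"
    proof -
      have "(R - 3) * (R * norm (g - a *\<^sub>R f)) \<le> (R - 3) * (3 * norm g)"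
        using R close by (intro mult_left_mono) auto
      also have "\<dots> = 3 * (norm g * (R - 3))" by simp
      also have "\<dots> \<le> 3 * (\<bar>a\<bar> * R)" using a by simp
      finally have "R * ((R - 3) * norm (g - a *\<^sub>R f)) \<le> R * (3 * \<bar>a\<bar>)" by (simp add: mult_ac)
      then have "(R - 3) * norm (g - a *\<^sub>R f) \<le> 3 * \<bar>a\<bar>" using R by simp
      then show ?thesis using R a0 by (simp add: field_simps)
    qed
    finally show "norm ((1 / a) *\<^sub>R g - f) \<le> 3 / (R - 3)" .
  qed
qed

text \<open>
  Suppose that no slice by a vector near \<open>f\<close> is small, and add to \<open>D\<close> a large ball \<open>V\<close> of the kernel of \<open>f\<close>.
  A functional that separated a point of \<open>D \<union> V\<close> from the split midpoints would be below its norm on \<open>V\<close>, hence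
  a multiple of a vector near \<open>f\<close>, and would cut off a slice of \<open>D\<close>. This slice contains two distant points,
  whose midpoint is a split midpoint on the wrong side. So every point is a limit of means of split midpoints, and
  there is an oscillating measure. Here \<open>strong\<close> selects between norm approximation, where separating functionals
  are bounded, and weak-star approximation, where they are controlled by finitely many evaluations; in both cases
  \<open>repr\<close> says that they are evaluations.
\<close>

lemma small_slice_dense_unit:
  fixes D X :: "('w::real_normed_vector \<Rightarrow>\<^sub>L real) set" and strong :: bool
  assumes D: "norming_set D" and X: "subspace X" "D \<subseteq> X"
    and repr: "\<And>F \<phi>. finite F \<Longrightarrow> linear \<phi> \<Longrightarrow> (\<And>v. \<phi> v \<le> (\<Sum>w\<in>F. \<bar>blinfun_apply v w\<bar>) + of_bool strong * norm v) \<Longrightarrow>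
        \<exists>g. \<forall>v\<in>X. \<phi> v = blinfun_apply v g"
    and no_oscillation: "\<And>G C. (\<And>E E'. E \<in> sets borel \<Longrightarrow> E' \<in> sets borel \<Longrightarrow> E \<inter> E' = {} \<Longrightarrow> G (E \<union> E') = G E + G E') \<Longrightarrow>
        (\<And>E. E \<in> sets borel \<Longrightarrow> norm (G E) \<le> C * measure unit_measure E) \<Longrightarrow>
        (\<And>E. strong \<Longrightarrow> E \<in> sets borel \<Longrightarrow> G E \<in> closure X) \<Longrightarrow>
        dyadic_oscillation G \<longlonglongrightarrow> 0"
    and f: "norm f = 1" and \<epsilon>: "0 < \<epsilon>" and \<delta>: "0 < \<delta>"
  shows "\<exists>g. norm (g - f) < \<delta> \<and> small_slice D \<epsilon> g"
proof (rule ccontr)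
  assume "\<nexists>g. norm (g - f) < \<delta> \<and> small_slice D \<epsilon> g"
  then have bad: "\<not> small_slice D \<epsilon> g" if "norm (g - f) < \<delta>" for g using that by blast
  \<comment> \<open>This makes \<open>3 / (R - 3)\<close>, the distance that \<open>exposing_near_multiple\<close> yields, smaller than \<open>\<delta>\<close>.\<close>
  define R where "R = 4 + 3 / \<delta>"
  have R: "3 < R" using \<delta> by (simp add: R_def add_pos_pos)
  have R3: "3 / (R - 3) < \<delta>" using \<delta> by (simp add: R_def field_simps)
  define V where "V = {v \<in> X. blinfun_apply v f = 0 \<and> norm v \<le> R}"
  \<comment> \<open>The kernel part \<open>V\<close> forces separating functionals to be near multiples of \<open>f\<close>.\<close>
  define A where "A = D \<union> V"
  have AX: "A \<subseteq> X" using X by (auto simp: A_def V_def)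
  have AR: "norm x \<le> R" if "x \<in> A" for x
    using that R norming_setD(1)[OF D, of x] by (auto simp: A_def V_def)
  have VP: "v \<in> split_points \<epsilon> f A" if "v \<in> V" for v
    unfolding split_points_def using that
    by (intro CollectI exI[of _ v] conjI exI[of _ 0]) (auto simp: A_def V_def simp flip: scaleR_2)
  have DP: "(y + z) /\<^sub>R 2 \<in> split_points \<epsilon> f A" if yz: "y \<in> D" "z \<in> D" "\<epsilon> < norm (y - z)" for y z
  proof -
    obtain w where w: "norm w \<le> 1" "\<epsilon> \<le> (y - z) w" using exists_norm_witness[OF yz(3) \<epsilon>] .
    have "((y + z) /\<^sub>R 2) f \<le> 1"
      using norming_set_le[OF D yz(1), of f] norming_set_le[OF D yz(2), of f] f
      by (simp add: scaleR_blinfun.rep_eq plus_blinfun.rep_eq)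
    then have "\<epsilon> * ((y + z) /\<^sub>R 2) f \<le> \<epsilon> * 1" using \<epsilon> by (intro mult_left_mono) auto
    then show ?thesis using yz w unfolding split_points_def A_def by force
  qed
  have V0: "0 \<in> V" using X R by (auto simp: V_def subspace_0)
  obtain x0 where x0: "x0 \<in> D" "1 / 2 < x0 f" using norming_setD(3)[OF D, of "1 / 2" f] f by auto
  have split: "\<exists>n. \<exists>h\<in>dyadic_means (split_points \<epsilon> f A) n.
        (\<forall>w\<in>F. \<bar>blinfun_apply (x - h) w\<bar> \<le> \<eta>) \<and> (strong \<longrightarrow> norm (x - h) \<le> \<eta>)"
    if x: "x \<in> A" and F: "finite F" and \<eta>: "0 < \<eta>" for x F \<eta>
  proof -
    let ?q = "\<lambda>v. (\<Sum>w\<in>F. \<bar>blinfun_apply v w\<bar>) + of_bool strong * norm v"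
    have ne: "split_points \<epsilon> f A \<noteq> {}" using VP[OF V0] by blast
    have q: "sublinear ?q" by (rule sublinear_sum_evaluation) simp
    show ?thesis
    proof (rule approximate_or_separate[OF q ne, of x \<eta>])
      fix n h assume h: "h \<in> dyadic_means (split_points \<epsilon> f A) n" "?q (x - h) < \<eta>"
      have "\<bar>(x - h) w\<bar> \<le> \<eta>" if "w \<in> F" for w
      proof -
        have "\<bar>(x - h) w\<bar> \<le> (\<Sum>w\<in>F. \<bar>(x - h) w\<bar>)" by (rule member_le_sum) (use that F in auto)
        moreover have "0 \<le> of_bool strong * norm (x - h)" by simp
        ultimately show ?thesis using h(2) by linarith
      qed
      moreover have "norm (x - h) \<le> \<eta>" if strong
      proof -
        have "0 \<le> (\<Sum>w\<in>F. \<bar>(x - h) w\<bar>)" by (intro sum_nonneg) simp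
        moreover have "(\<Sum>w\<in>F. \<bar>(x - h) w\<bar>) + norm (x - h) < \<eta>" using h(2) that by simp
        ultimately show ?thesis by linarith
      qed
      ultimately show ?thesis using h(1) by blast
    next
      fix \<phi> assume \<phi>: "linear \<phi>" "\<And>y. \<phi> y \<le> ?q y" "\<And>a. a \<in> split_points \<epsilon> f A \<Longrightarrow> \<phi> a + \<eta> \<le> \<phi> x"
      obtain g where g: "\<And>v. v \<in> X \<Longrightarrow> \<phi> v = v g" using repr[OF F \<phi>(1,2)] by blast
      have Pg: "p g + \<eta> \<le> x g" if "p \<in> split_points \<epsilon> f A" for p
        using \<phi>(3)[OF that] g split_points_subset[OF X(1) AX] that x AX by (metis subsetD)
      have "x \<notin> V" using Pg[OF VP] \<eta> by force
      then have xD: "x \<in> D" using x by (simp add: A_def)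
      have xg: "x g \<le> norm g" by (rule norming_set_le[OF D xD])
      have "0 < x g" using Pg[OF VP[OF V0]] \<eta> by simp
      then have g0: "g \<noteq> 0" by auto
      have "v g \<le> norm g" if "v \<in> X" "blinfun_apply v f = 0" "norm v \<le> R" for v
      proof -
        have "v \<in> V" using that by (simp add: V_def)
        then show ?thesis using Pg[OF VP, of v] xg \<eta> by simp
      qed
      then obtain c where c: "c \<noteq> 0" "norm (c *\<^sub>R g - f) \<le> 3 / (R - 3)"
        using exposing_near_multiple[OF D X f R g0] by blast
      have "\<not> small_slice D \<epsilon> (c *\<^sub>R g)" using c(2) R3 by (intro bad) simp
      moreover have "small_slice D \<epsilon> (c *\<^sub>R g)" if "small_slice D \<epsilon> g"
        by (rule small_slice_scale[OF D, of "inverse c"]) (use c that in auto)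
      ultimately have "\<not> small_slice D \<epsilon> g" by blast
      moreover have "0 < norm g - (x g - \<eta>)" using xg \<eta> by simp
      ultimately obtain y z where yz: "y \<in> D" "z \<in> D" "\<epsilon> < norm (y - z)"
        "norm g - (norm g - (x g - \<eta>)) < y g" "norm g - (norm g - (x g - \<eta>)) < z g"
        unfolding small_slice_def by (meson not_le)
      have "(y g + z g) / 2 + \<eta> \<le> x g"
        using Pg[OF DP[OF yz(1-3)]] by (simp add: scaleR_blinfun.rep_eq plus_blinfun.rep_eq)
      then have "y g + z g + 2 * \<eta> \<le> 2 * x g" by (simp add: field_simps)
      moreover have "x g - \<eta> < y g" "x g - \<eta> < z g" using yz(4,5) by simp_all
      ultimately have False by argo
      then show ?thesis ..
    qed
  qed
  have "x0 \<in> A" "0 < x0 f" using x0 by (auto simp: A_def)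
  then obtain G where "\<And>E E'. E \<in> sets borel \<Longrightarrow> E' \<in> sets borel \<Longrightarrow> E \<inter> E' = {} \<Longrightarrow> G (E \<union> E') = G E + G E'"
    "\<And>E. E \<in> sets borel \<Longrightarrow> norm (G E) \<le> R * measure unit_measure E"
    and cl: "\<And>E. strong \<Longrightarrow> E \<in> sets borel \<Longrightarrow> G E \<in> closure (span A)"
    and osc: "\<not> dyadic_oscillation G \<longlonglongrightarrow> 0"
    using oscillating_measure[OF AR _ _ \<epsilon> split] by blast
  moreover have "closure (span A) \<subseteq> closure X" by (intro closure_mono span_minimal AX X)
  ultimately show False using no_oscillation[of G R] by blast
qed

text \<open>
  Baire's theorem applied to the open dense sets of vectors with a slice of diameter at most \<open>1 / n\<close>.
\<close>

lemma strongly_exposing_dense: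
  fixes D :: "('w::banach \<Rightarrow>\<^sub>L real) set"
  assumes D: "norming_set D" and nz: "\<exists>w::'w. w \<noteq> 0"
    and dense: "\<And>f \<epsilon> \<delta>. norm f = 1 \<Longrightarrow> 0 < \<epsilon> \<Longrightarrow> 0 < \<delta> \<Longrightarrow> \<exists>g. norm (g - f) < \<delta> \<and> small_slice D \<epsilon> g"
    and \<delta>: "0 < \<delta>"
  obtains g where "norm (g - f) < \<delta>" "\<And>\<epsilon>. 0 < \<epsilon> \<Longrightarrow> small_slice D \<epsilon> g"
proof -
  have near_nz: "\<exists>g. norm (g - f) < \<delta> \<and> small_slice D \<epsilon> g" if f: "f \<noteq> 0" "0 < \<epsilon>" "0 < \<delta>" for f \<epsilon> \<delta>
  proof -
    have "norm (f /\<^sub>R norm f) = 1" "0 < \<delta> / norm f" using f by simp_all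
    then obtain g where g: "norm (g - f /\<^sub>R norm f) < \<delta> / norm f" "small_slice D \<epsilon> g"
      using dense[of "f /\<^sub>R norm f" \<epsilon> "\<delta> / norm f"] f by blast
    have "norm f *\<^sub>R g - f = norm f *\<^sub>R (g - f /\<^sub>R norm f)" using f by (simp add: scaleR_diff_right)
    then have "norm (norm f *\<^sub>R g - f) = norm f * norm (g - f /\<^sub>R norm f)" by (simp only: norm_scaleR abs_norm_cancel)
    also have "\<dots> < norm f * (\<delta> / norm f)" using g(1) f(1) by (intro mult_strict_left_mono) auto
    also have "\<dots> = \<delta>" using f(1) by simp
    finally have "norm (norm f *\<^sub>R g - f) < \<delta>" .
    moreover have "small_slice D \<epsilon> (norm f *\<^sub>R g)"
      by (rule small_slice_scale[OF D, of "inverse (norm f)"]) (use f g in auto)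
    ultimately show ?thesis by blast
  qed
  have near: "\<exists>g. norm (g - f) < \<delta> \<and> small_slice D \<epsilon> g" if pos: "0 < \<epsilon>" "0 < \<delta>" for f \<epsilon> \<delta>
  proof (cases "f = 0")
    case True
    obtain w :: 'w where w: "w \<noteq> 0" using nz by blast
    define e where "e = (\<delta> / 2 / norm w) *\<^sub>R w"
    have e: "e \<noteq> 0" "norm e = \<delta> / 2" using w pos by (auto simp: e_def)
    obtain g where g: "norm (g - e) < \<delta> / 2" "small_slice D \<epsilon> g"
      using near_nz[OF e(1) pos(1), of "\<delta> / 2"] pos by auto
    then have "norm (g - f) < \<delta>" using norm_triangle_ineq[of "g - e" e] e True by simp
    with g(2) show ?thesis by blast
  qed (rule near_nz[OF _ pos])
  let ?U = "\<lambda>n :: nat. {g. small_slice D (1 / Suc n) g}"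
  have "euclidean closure_of \<Inter>(range ?U) = topspace euclidean"
  proof (rule Baire_category)
    fix T assume "T \<in> range ?U"
    then obtain n where T: "T = ?U n" by blast
    have "open T" unfolding T by (rule open_small_slice[OF D])
    moreover have "euclidean closure_of T = UNIV"
    proof -
      have "f \<in> closure T" for f
        unfolding closure_approachable
      proof (intro allI impI)
        fix e :: real assume "0 < e"
        then obtain g where "norm (g - f) < e" "small_slice D (1 / Suc n) g" using near[of "1 / Suc n" e f] by auto
        then show "\<exists>g\<in>T. dist g f < e" unfolding T by (intro bexI[of _ g]) (auto simp: dist_norm)
      qed
      then show ?thesis by auto
    qed
    ultimately show "openin euclidean T \<and> euclidean closure_of T = topspace euclidean"
      by (simp only: open_openin topspace_euclidean)
  qed (auto simp: completely_metrizable_space_euclidean)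
  then have "f \<in> closure (\<Inter>(range ?U))" by simp
  then obtain g where g: "g \<in> \<Inter>(range ?U)" "norm (g - f) < \<delta>"
    using \<delta> unfolding closure_approachable dist_norm by blast
  have "small_slice D \<epsilon> g" if pos: "0 < \<epsilon>" for \<epsilon>
  proof -
    obtain n where n: "1 / Suc n < \<epsilon>" by (rule nat_approx_posE[OF pos])
    have "small_slice D (1 / Suc n) g" using g by blast
    then obtain \<alpha> where \<alpha>: "0 < \<alpha>" "\<And>y z. y \<in> D \<Longrightarrow> z \<in> D \<Longrightarrow> norm g - \<alpha> < blinfun_apply y g \<Longrightarrow>
        norm g - \<alpha> < blinfun_apply z g \<Longrightarrow> norm (y - z) \<le> 1 / Suc n"
      unfolding small_slice_def by blast
    have "norm (y - z) \<le> \<epsilon>" if "y \<in> D" "z \<in> D" "norm g - \<alpha> < blinfun_apply y g" "norm g - \<alpha> < blinfun_apply z g" for y z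
      using \<alpha>(2)[OF that] n by linarith
    with \<alpha>(1) show ?thesis unfolding small_slice_def by blast
  qed
  with g(2) show thesis by (rule that)
qed

section \<open>The ball covering property as a descent property\<close>

lemma norm_decrease_shorter_step:
  fixes z x :: "'z::real_normed_vector"
  assumes "0 \<le> s" "s \<le> t" "0 < t"
  shows "norm (z - s *\<^sub>R x) \<le> norm z - s / t * (norm z - norm (z - t *\<^sub>R x))"
proof -
  have "z - s *\<^sub>R x = (1 - s / t) *\<^sub>R z + (s / t) *\<^sub>R (z - t *\<^sub>R x)"
    using assms by (simp add: algebra_simps)
  also have "norm \<dots> \<le> (1 - s / t) * norm z + s / t * norm (z - t *\<^sub>R x)"
    using assms by (intro norm_triangle_le) simp
  finally show ?thesis by (simp add: algebra_simps)
qed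

lemma norm_less_imp_nonzero: "norm a < norm b \<Longrightarrow> b \<noteq> 0"
  by auto

text \<open>
  Every nonzero \<open>x\<close> is a direction of strict decrease for the norm at some member of the family. By convexity
  of the norm it does not matter how short the step is.
\<close>

definition descent_family :: "'z::real_normed_vector set \<Rightarrow> bool" where
  "descent_family S \<longleftrightarrow> (\<forall>x. x \<noteq> 0 \<longrightarrow> (\<exists>z\<in>S. \<exists>t>0. norm (z - t *\<^sub>R x) < norm z))"

text \<open>
  A ball around \<open>z\<close> with radius at most \<open>norm z\<close> contains \<open>x\<close> only if \<open>x\<close> is a direction of decrease at \<open>z\<close>.
  Conversely, if \<open>x\<close> is such a direction, then a large multiple \<open>n z\<close> is closer to \<open>x\<close> than to the origin.
  The zero space has the descent property with the empty family, which is why a nonzero element is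
  demanded separately.
\<close>

theorem ball_covering_property_iff:
  "ball_covering_property TYPE('z::banach) \<longleftrightarrow>
    (\<exists>z::'z. z \<noteq> 0) \<and> (\<exists>S::'z set. countable S \<and> descent_family S)"
proof
  assume "ball_covering_property TYPE('z)"
  then obtain z :: "nat \<Rightarrow> 'z" and r where r: "\<And>n. 0 < r n" "\<And>n. r n \<le> norm (z n)"
    and cover: "sphere 0 1 \<subseteq> (\<Union>n. ball (z n) (r n))"
    unfolding ball_covering_property_def by blast
  have "z 0 \<noteq> 0" using r[of 0] by auto
  moreover have "descent_family (range z)"
    unfolding descent_family_def
  proof (intro allI impI)
    fix x :: 'z assume x: "x \<noteq> 0"
    have "x /\<^sub>R norm x \<in> sphere 0 1" using x by simp
    then have "x /\<^sub>R norm x \<in> (\<Union>n. ball (z n) (r n))" using cover by (rule subsetD[rotated])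
    then obtain n where "dist (z n) (x /\<^sub>R norm x) < r n" by (auto simp only: UN_iff mem_ball)
    then have "norm (z n - (1 / norm x) *\<^sub>R x) < norm (z n)"
      using r(2)[of n] by (simp add: dist_norm divide_inverse_commute)
    then show "\<exists>z\<in>range z. \<exists>t>0. norm (z - t *\<^sub>R x) < norm z"
      using x by (intro bexI[of _ "z n"] exI[of _ "1 / norm x"]) auto
  qed
  ultimately show "(\<exists>z::'z. z \<noteq> 0) \<and> (\<exists>S::'z set. countable S \<and> descent_family S)"
    by (meson countableI_type countable_image)
next
  assume "(\<exists>z::'z. z \<noteq> 0) \<and> (\<exists>S::'z set. countable S \<and> descent_family S)"
  then obtain e :: 'z and S :: "'z set" where e: "e \<noteq> 0" and S: "countable S" "descent_family S" by blast
  have "S \<noteq> {}" using S(2) e unfolding descent_family_def by blast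
  define a where "a n = from_nat_into S n" for n
  \<comment> \<open>All positive integer multiples of the members of \<open>S\<close> in one sequence; the vector \<open>e\<close> stands in for a zero member, whose ball would have radius 0.\<close>
  define c where "c n = (if a (fst (prod_decode n)) = 0 then e else real (Suc (snd (prod_decode n))) *\<^sub>R a (fst (prod_decode n)))" for n
  have c0: "c n \<noteq> 0" for n using e by (simp add: c_def)
  have "x \<in> (\<Union>n. ball (c n) (norm (c n)))" if x: "x \<in> sphere 0 1" for x
  proof -
    have "x \<noteq> 0" using x by auto
    then obtain z t where z: "z \<in> S" "0 < t" "norm (z - t *\<^sub>R x) < norm z"
      using S(2) unfolding descent_family_def by blast
    obtain m where m: "a m = z" using z(1) from_nat_into_surj[OF S(1)] unfolding a_def by blast
    obtain k where k: "1 / real (Suc k) < t" by (rule nat_approx_posE[OF z(2)])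
    have z0: "z \<noteq> 0" by (rule norm_less_imp_nonzero[OF z(3)])
    have ck: "c (prod_encode (m, k)) = real (Suc k) *\<^sub>R z" by (simp add: c_def m z0)
    have "norm (z - (1 / Suc k) *\<^sub>R x) \<le> norm z - (1 / Suc k) / t * (norm z - norm (z - t *\<^sub>R x))"
      using k z(2) by (intro norm_decrease_shorter_step) auto
    also have "\<dots> < norm z" using z by simp
    finally have "real (Suc k) * norm (z - (1 / Suc k) *\<^sub>R x) < real (Suc k) * norm z"
      by (intro mult_strict_left_mono) auto
    moreover have "real (Suc k) *\<^sub>R z - x = real (Suc k) *\<^sub>R (z - (1 / Suc k) *\<^sub>R x)"
      by (simp add: scaleR_diff_right)
    ultimately have "dist (c (prod_encode (m, k))) x < norm (c (prod_encode (m, k)))"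
      by (simp only: ck dist_norm norm_scaleR abs_of_nat)
    then show ?thesis by auto
  qed
  then show "ball_covering_property TYPE('z)"
    unfolding ball_covering_property_def using c0
    by (intro exI[of _ c] exI[of _ "\<lambda>n. norm (c n)"]) auto
qed

text \<open>
  If \<open>J y\<close> is a direction of decrease at \<open>v\<close>, then applying a contraction \<open>L\<close> that almost preserves the norm of
  \<open>v\<close> shows that \<open>L (J y)\<close>, a multiple of \<open>y\<close>, is a direction of decrease at \<open>L v\<close>. Countably many \<open>L\<close> suffice
  for a countable family of \<open>v\<close>, and the sign of the multiple is absorbed by using \<open>L v\<close> and \<open>- L v\<close>.
\<close>

lemma ball_covering_property_transfer:
  fixes J :: "'y::banach \<Rightarrow> 'z::banach" and \<L> :: "('z \<Rightarrow> 'y) set"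
  assumes bcp: "ball_covering_property TYPE('z)" and nz: "\<exists>y::'y. y \<noteq> 0"
    and J: "\<And>y. y \<noteq> 0 \<Longrightarrow> J y \<noteq> 0"
    and lin: "\<And>L v w t. L \<in> \<L> \<Longrightarrow> L (v - t *\<^sub>R w) = L v - t *\<^sub>R L w"
    and contr: "\<And>L v. L \<in> \<L> \<Longrightarrow> norm (L v) \<le> norm v"
    and norming: "\<And>v \<kappa>. v \<noteq> 0 \<Longrightarrow> \<kappa> < norm v \<Longrightarrow> \<exists>L\<in>\<L>. \<kappa> < norm (L v)"
    and LJ: "\<And>L. L \<in> \<L> \<Longrightarrow> \<exists>c. \<forall>y. L (J y) = c *\<^sub>R y"
  shows "ball_covering_property TYPE('y)"
proof -
  obtain S :: "'z set" where S: "countable S" "descent_family S"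
    using bcp unfolding ball_covering_property_iff by blast
  have "\<exists>L. v \<noteq> 0 \<longrightarrow> L \<in> \<L> \<and> norm v - 1 / Suc k < norm (L v)" for v :: 'z and k
    using norming[of v "norm v - 1 / Suc k"] by force
  then obtain L where L: "\<And>v k. v \<noteq> 0 \<Longrightarrow> L v k \<in> \<L>" "\<And>v k. v \<noteq> 0 \<Longrightarrow> norm v - 1 / Suc k < norm (L v k v)"
    by metis
  let ?S = "(\<lambda>(v, k, c). c *\<^sub>R L v k v) ` (S \<times> (UNIV :: nat set) \<times> {1, - 1 :: real})"
  have "descent_family ?S"
    unfolding descent_family_def
  proof (intro allI impI)
    fix y :: 'y assume "y \<noteq> 0"
    then obtain v t where v: "v \<in> S" "0 < t" "norm (v - t *\<^sub>R J y) < norm v"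
      using S(2) J unfolding descent_family_def by blast
    have v0: "v \<noteq> 0" by (rule norm_less_imp_nonzero[OF v(3)])
    obtain k where "1 / Suc k < norm v - norm (v - t *\<^sub>R J y)" using nat_approx_posE[of "norm v - norm (v - t *\<^sub>R J y)"] v(3) by auto
    then have "norm (v - t *\<^sub>R J y) < norm (L v k v)" using L(2)[OF v0, of k] by linarith
    moreover obtain c where c: "\<And>y. L v k (J y) = c *\<^sub>R y" using LJ[OF L(1)[OF v0]] by blast
    moreover have "norm (L v k v - (t * c) *\<^sub>R y) \<le> norm (v - t *\<^sub>R J y)"
      using contr[OF L(1)[OF v0], of k "v - t *\<^sub>R J y"] lin[OF L(1)[OF v0], of k v t "J y"] c by simp
    ultimately have less: "norm (L v k v - (t * c) *\<^sub>R y) < norm (L v k v)" by linarith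
    have c0: "c \<noteq> 0" using less by auto
    have "sgn c *\<^sub>R L v k v \<in> ?S"
      using v(1) c0 by (intro image_eqI[of _ _ "(v, k, sgn c)"]) (auto simp: sgn_real_def)
    moreover have "norm (sgn c *\<^sub>R L v k v - (t * \<bar>c\<bar>) *\<^sub>R y) < norm (sgn c *\<^sub>R L v k v)"
    proof -
      have "sgn c *\<^sub>R L v k v - (t * \<bar>c\<bar>) *\<^sub>R y = sgn c *\<^sub>R (L v k v - (t * c) *\<^sub>R y)"
        by (simp add: scaleR_diff_right abs_sgn mult_ac)
      then show ?thesis using less c0 by (simp add: sgn_real_def)
    qed
    moreover have "0 < t * \<bar>c\<bar>" using v(2) c0 by simp
    ultimately show "\<exists>z\<in>?S. \<exists>t>0. norm (z - t *\<^sub>R y) < norm z" by blast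
  qed
  moreover have "countable ?S" using S(1) by (intro countable_image countable_SIGMA) auto
  ultimately show ?thesis unfolding ball_covering_property_iff using nz by blast
qed

text \<open>
  For fixed \<open>x\<close> and \<open>t\<close>, strict decrease is an open condition on the point at which it holds, so the members of a
  descent family may be replaced by sequences converging to them.
\<close>

lemma strongly_exposing_descent_family:
  fixes S :: "'w::real_normed_vector set" and P :: "'w \<Rightarrow> bool"
  assumes S: "countable S" "descent_family S"
    and dense: "\<And>f \<delta>. 0 < \<delta> \<Longrightarrow> \<exists>g. norm (g - f) < \<delta> \<and> P g"
  obtains S' where "countable S'" "descent_family S'" "\<And>g. g \<in> S' \<Longrightarrow> P g"
proof -
  have "\<exists>g. norm (g - f) < 1 / real (Suc k) \<and> P g" for f :: 'w and k :: nat using dense[of "1 / Suc k" f] by simp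
  then obtain g :: "'w \<Rightarrow> nat \<Rightarrow> 'w" where g: "\<And>f k. norm (g f k - f) < 1 / Suc k" "\<And>f k. P (g f k)" by metis
  let ?S = "(\<lambda>(f, k). g f k) ` (S \<times> (UNIV :: nat set))"
  have "descent_family ?S"
    unfolding descent_family_def
  proof (intro allI impI)
    fix x :: 'w assume "x \<noteq> 0"
    then obtain z t where z: "z \<in> S" "0 < t" "norm (z - t *\<^sub>R x) < norm z"
      using S(2) unfolding descent_family_def by blast
    obtain k where k: "1 / Suc k < (norm z - norm (z - t *\<^sub>R x)) / 2"
      using nat_approx_posE[of "(norm z - norm (z - t *\<^sub>R x)) / 2"] z(3) by auto
    have "norm (g z k - t *\<^sub>R x) \<le> norm (z - t *\<^sub>R x) + norm (g z k - z)"
      using norm_triangle_ineq[of "z - t *\<^sub>R x" "g z k - z"] by simp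
    moreover have "norm z \<le> norm (g z k) + norm (g z k - z)"
      using norm_triangle_ineq4[of "g z k" "g z k - z"] by simp
    ultimately have "norm (g z k - t *\<^sub>R x) < norm (g z k)" using g(1)[of z k] k by argo
    then show "\<exists>z\<in>?S. \<exists>t>0. norm (z - t *\<^sub>R x) < norm z" using z by force
  qed
  moreover have "countable ?S" using S(1) by auto
  ultimately show thesis using g(2) by (intro that[of ?S]) auto
qed

section \<open>Descent at elementary tensors\<close>

text \<open>
  The functionals that nearly attain the norm of \<open>u\<close> form a Cauchy filter base, and \<open>T\<close> is Lipschitz in them.
\<close>

lemma strongly_exposed_limit:
  fixes d :: "'i \<Rightarrow> ('u::real_normed_vector \<Rightarrow>\<^sub>L real)" and T :: "'i \<Rightarrow> 'w::banach"
  assumes D: "norming_set (d ` I)" and lip: "\<And>i i'. i \<in> I \<Longrightarrow> i' \<in> I \<Longrightarrow> norm (T i - T i') \<le> norm (d i - d i') * K"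
    and K: "0 \<le> K" and exposing: "\<And>\<epsilon>. 0 < \<epsilon> \<Longrightarrow> small_slice (d ` I) \<epsilon> u"
  obtains y where "\<And>\<rho>. 0 < \<rho> \<Longrightarrow> \<exists>\<alpha>>0. \<forall>i\<in>I. norm u - \<alpha> < d i u \<longrightarrow> norm (T i - y) \<le> \<rho>"
proof -
  have "\<exists>i\<in>I. norm u - 1 / real (Suc n) < d i u" for n
    using norming_setD(3)[OF D, of "norm u - 1 / Suc n" u] by auto
  then obtain i where i: "\<And>n. i n \<in> I" "\<And>n. norm u - 1 / real (Suc n) < d (i n) u" by metis
  have slice: "\<exists>\<alpha>>0. \<forall>j\<in>I. \<forall>k\<in>I. norm u - \<alpha> < d j u \<longrightarrow> norm u - \<alpha> < d k u \<longrightarrow> norm (T j - T k) \<le> \<rho>"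
    if \<rho>: "0 < \<rho>" for \<rho>
  proof -
    have "0 < \<rho> / (K + 1)" using \<rho> K by simp
    from exposing[OF this] obtain \<alpha> where \<alpha>: "0 < \<alpha>" and sl: "\<And>j k. j \<in> I \<Longrightarrow> k \<in> I \<Longrightarrow>
        norm u - \<alpha> < d j u \<Longrightarrow> norm u - \<alpha> < d k u \<Longrightarrow> norm (d j - d k) \<le> \<rho> / (K + 1)"
      unfolding small_slice_def by blast
    have "norm (T j - T k) \<le> \<rho>" if "j \<in> I" "k \<in> I" "norm u - \<alpha> < d j u" "norm u - \<alpha> < d k u" for j k
    proof -
      have "norm (T j - T k) \<le> norm (d j - d k) * K" by (rule lip[OF that(1,2)])
      also have "\<dots> \<le> \<rho> / (K + 1) * K" by (rule mult_right_mono[OF sl[OF that] K])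
      also have "\<dots> \<le> \<rho>" using \<rho> K by (simp add: divide_le_eq)
      finally show ?thesis .
    qed
    with \<alpha> show ?thesis by blast
  qed
  have eventually: "\<exists>N. \<forall>n\<ge>N. norm u - \<alpha> < d (i n) u" if pos: "0 < \<alpha>" for \<alpha>
  proof -
    obtain N where N: "1 / Suc N < \<alpha>" by (rule nat_approx_posE[OF pos])
    have "norm u - \<alpha> < d (i n) u" if "N \<le> n" for n
    proof -
      have "1 / real (Suc n) \<le> 1 / real (Suc N)" using that by (intro divide_left_mono) auto
      then show ?thesis using i(2)[of n] N by linarith
    qed
    then show ?thesis by blast
  qed
  have "Cauchy (\<lambda>n. T (i n))"
  proof (rule CauchyI)
    fix e :: real assume "0 < e"
    then obtain \<alpha> where \<alpha>: "0 < \<alpha>" "\<And>j k. j \<in> I \<Longrightarrow> k \<in> I \<Longrightarrow>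
        norm u - \<alpha> < d j u \<Longrightarrow> norm u - \<alpha> < d k u \<Longrightarrow> norm (T j - T k) \<le> e / 2" using slice[of "e / 2"] by auto
    obtain N where N: "\<And>n. N \<le> n \<Longrightarrow> norm u - \<alpha> < d (i n) u" using eventually[OF \<alpha>(1)] by blast
    have "norm (T (i m) - T (i n)) < e" if "N \<le> m" "N \<le> n" for m n
      using \<alpha>(2)[OF i(1) i(1) N[OF that(1)] N[OF that(2)]] \<open>0 < e\<close> by linarith
    then show "\<exists>M. \<forall>m\<ge>M. \<forall>n\<ge>M. norm (T (i m) - T (i n)) < e" by blast
  qed
  then obtain y where y: "(\<lambda>n. T (i n)) \<longlonglongrightarrow> y" using Cauchy_convergent convergent_def by blast
  show thesis
  proof (rule that[of y])
    fix \<rho> :: real assume "0 < \<rho>"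
    then obtain \<alpha> where \<alpha>: "0 < \<alpha>" "\<And>j k. j \<in> I \<Longrightarrow> k \<in> I \<Longrightarrow>
        norm u - \<alpha> < d j u \<Longrightarrow> norm u - \<alpha> < d k u \<Longrightarrow> norm (T j - T k) \<le> \<rho>" using slice[of \<rho>] by auto
    obtain N where N: "\<And>n. N \<le> n \<Longrightarrow> norm u - \<alpha> < d (i n) u" using eventually[OF \<alpha>(1)] by blast
    have "norm (T j - y) \<le> \<rho>" if "j \<in> I" "norm u - \<alpha> < d j u" for j
    proof (rule tendsto_upperbound)
      show "(\<lambda>n. norm (T j - T (i n))) \<longlonglongrightarrow> norm (T j - y)" by (intro tendsto_intros y)
      show "\<forall>\<^sub>F n in sequentially. norm (T j - T (i n)) \<le> \<rho>"
        unfolding eventually_sequentially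
        by (intro exI[of _ N] allI impI \<alpha>(2)[OF that(1) i(1) that(2) N])
    qed simp
    with \<alpha>(1) show "\<exists>\<alpha>>0. \<forall>i\<in>I. norm u - \<alpha> < d i u \<longrightarrow> norm (T i - y) \<le> \<rho>" by blast
  qed
qed

text \<open>
  The bounded bilinear form \<open>(i, j) \<mapsto> d i (TU j) = e j (TW i)\<close> is an operator \<open>T\<close>, and
  \<open>(i, j) \<mapsto> d i u * e j w\<close> is the elementary tensor of \<open>u\<close> and \<open>w\<close>. To have descent at the tensor in direction
  \<open>T\<close>, the values of \<open>T\<close> must be bounded below where the tensor nearly attains its norm. First \<open>u\<close> is chosen for
  \<open>TU j0\<close>. Since \<open>u\<close> is strongly exposing, \<open>TW i\<close> is close to a fixed vector \<open>y\<close> on a small slice by \<open>u\<close>,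
  and \<open>y \<noteq> 0\<close> by the choice of \<open>u\<close>. Then \<open>w\<close> is chosen for \<open>y\<close>. The formulation with index sets lets either
  factor of the space of Lipschitz maps play the role of the first one.
\<close>

lemma elementary_tensor_descent:
  fixes d :: "'i \<Rightarrow> ('u::real_normed_vector \<Rightarrow>\<^sub>L real)" and e :: "'j \<Rightarrow> ('w::banach \<Rightarrow>\<^sub>L real)"
    and TU :: "'j \<Rightarrow> 'u" and TW :: "'i \<Rightarrow> 'w"
  assumes D: "norming_set (d ` I)" and E: "norming_set (e ` J)"
    and pairing: "\<And>i j. i \<in> I \<Longrightarrow> j \<in> J \<Longrightarrow> d i (TU j) = e j (TW i)"
    and bound: "\<And>j. j \<in> J \<Longrightarrow> norm (TU j) \<le> K"
    and nonzero: "j0 \<in> J" "TU j0 \<noteq> 0"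
    and SU: "descent_family SU" "\<And>u \<epsilon>. u \<in> SU \<Longrightarrow> 0 < \<epsilon> \<Longrightarrow> small_slice (d ` I) \<epsilon> u"
    and SW: "descent_family SW"
  obtains u w r \<mu> where "u \<in> SU" "w \<in> SW" "0 < r" "\<mu> < norm u * norm w"
    "\<And>i j. i \<in> I \<Longrightarrow> j \<in> J \<Longrightarrow> \<bar>d i u * e j w - r * d i (TU j)\<bar> \<le> \<mu>"
proof -
  have K: "0 \<le> K" using order_trans[OF norm_ge_zero bound[OF nonzero(1)]] .
  have lip: "norm (TW i - TW i') \<le> norm (d i - d i') * K" if i: "i \<in> I" "i' \<in> I" for i i'
  proof (rule norming_set_norm_le[OF E])
    fix \<phi> assume "\<phi> \<in> e ` J"
    then obtain j where j: "j \<in> J" "\<phi> = e j" by blast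
    have "\<phi> (TW i - TW i') = (d i - d i') (TU j)"
      using pairing[OF i(1) j(1)] pairing[OF i(2) j(1)] j(2) by (simp add: blinfun.diff_right minus_blinfun.rep_eq)
    also have "\<dots> \<le> norm (d i - d i') * norm (TU j)" using norm_blinfun[of "d i - d i'" "TU j"] by simp
    also have "\<dots> \<le> norm (d i - d i') * K" by (intro mult_left_mono bound j) simp
    finally show "\<phi> (TW i - TW i') \<le> norm (d i - d i') * K" .
  qed
  obtain u t where u: "u \<in> SU" "0 < t" "norm (u - t *\<^sub>R TU j0) < norm u"
    using SU(1) nonzero(2) unfolding descent_family_def by blast
  define \<kappa> where "\<kappa> = norm u - norm (u - t *\<^sub>R TU j0)"
  have \<kappa>: "0 < \<kappa>" using u by (simp add: \<kappa>_def)
  obtain y where y: "\<And>\<rho>. 0 < \<rho> \<Longrightarrow> \<exists>\<alpha>>0. \<forall>i\<in>I. norm u - \<alpha> < d i u \<longrightarrow> norm (TW i - y) \<le> \<rho>"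
    using strongly_exposed_limit[of d I TW K u, OF D lip K SU(2)[OF u(1)]] by blast
  have "y \<noteq> 0"
  proof
    assume y0: "y = 0"
    have "0 < \<kappa> / (4 * t)" using \<kappa> u by simp
    from y[OF this] obtain \<alpha> where \<alpha>: "0 < \<alpha>"
      "\<And>i. i \<in> I \<Longrightarrow> norm u - \<alpha> < d i u \<Longrightarrow> norm (TW i - y) \<le> \<kappa> / (4 * t)" by blast
    obtain i where i: "i \<in> I" "norm u - min \<alpha> (\<kappa> / 2) < d i u"
      using norming_setD(3)[OF D, of "norm u - min \<alpha> (\<kappa> / 2)" u] \<alpha>(1) \<kappa> by auto
    have "t * d i (TU j0) = d i u - d i (u - t *\<^sub>R TU j0)" by (simp add: blinfun.diff_right blinfun.scaleR_right)
    also have "\<dots> > \<kappa> / 2"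
      using i(2) norming_set_le[OF D imageI[OF i(1)], of "u - t *\<^sub>R TU j0"] \<kappa>_def
        min.cobounded2[of \<alpha> "\<kappa> / 2"] by linarith
    finally have "\<kappa> / 2 < t * d i (TU j0)" .
    also have "d i (TU j0) \<le> norm (TW i)"
      using norming_set_le[OF E, of "e j0" "TW i"] nonzero(1) pairing[OF i(1) nonzero(1)] by simp
    also have "norm (TW i) \<le> \<kappa> / (4 * t)" using \<alpha>(2)[OF i(1)] i(2) y0 by simp
    finally have "\<kappa> / 2 < t * (\<kappa> / (4 * t))" using u(2) by simp
    then show False using u(2) \<kappa> by simp
  qed
  then obtain w t' where w: "w \<in> SW" "0 < t'" "norm (w - t' *\<^sub>R y) < norm w"
    using SW unfolding descent_family_def by blast
  define \<gamma> where "\<gamma> = norm w - norm (w - t' *\<^sub>R y)"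
  define \<rho> where "\<rho> = \<gamma> / (2 * t')"
  have \<rho>: "0 < \<rho>" using w by (simp add: \<gamma>_def \<rho>_def)
  have nu: "0 < norm u" and nw: "0 < norm w" using norm_less_imp_nonzero[OF u(3)] norm_less_imp_nonzero[OF w(3)] by simp_all
  obtain \<alpha>' where \<alpha>': "0 < \<alpha>'" "\<And>i. i \<in> I \<Longrightarrow> norm u - \<alpha>' < d i u \<Longrightarrow> norm (TW i - y) \<le> \<rho>"
    using y[OF \<rho>] by blast
  \<comment> \<open>The bound by \<open>norm u / 2\<close> keeps \<open>d i u\<close> away from 0 on the slice, since the tensor is divided by it below.\<close>
  define \<alpha> where "\<alpha> = min \<alpha>' (norm u / 2)"
  have \<alpha>: "0 < \<alpha>" "\<alpha> \<le> \<alpha>'" "\<alpha> \<le> norm u / 2" using \<alpha>'(1) nu by (auto simp: \<alpha>_def)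
  \<comment> \<open>The first bound keeps \<open>r / a \<le> t'\<close> within the slice; the second keeps the step harmless off the slice.\<close>
  define r where "r = min (t' * norm u / 2) (\<alpha> * norm w / (2 * (K + 1)))"
  have r: "0 < r" "r \<le> t' * norm u / 2" "r \<le> \<alpha> * norm w / (2 * (K + 1))"
  proof -
    have "0 < t' * norm u / 2" "0 < \<alpha> * norm w / (2 * (K + 1))" using w(2) nu nw \<alpha>(1) K by simp_all
    then show "0 < r" unfolding r_def by (simp only: min_less_iff_conj)
    show "r \<le> t' * norm u / 2" "r \<le> \<alpha> * norm w / (2 * (K + 1))" by (simp_all only: r_def min.cobounded1 min.cobounded2)
  qed
  have rK: "r * K \<le> \<alpha> * norm w / 2"
  proof -
    have "r * K \<le> r * (K + 1)" using r(1) by simp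
    also have "\<dots> \<le> \<alpha> * norm w / (2 * (K + 1)) * (K + 1)" using r(3) K by (intro mult_right_mono) auto
    also have "\<dots> = \<alpha> * norm w / 2" using K by (simp add: field_simps)
    finally show ?thesis .
  qed
  have in_slice: "\<bar>d i u * e j w - r * d i (TU j)\<bar> \<le> norm u * norm w - r * \<rho>"
    if i: "i \<in> I" "norm u - \<alpha> < d i u" and j: "j \<in> J" for i j
  proof -
    define a where "a = d i u"
    have a: "norm u / 2 \<le> a" "0 < a" "a \<le> norm u"
      using i(2) \<alpha>(3) nu norming_set_le[OF D, of "d i" u] i(1) by (auto simp: a_def)
    have "r / a \<le> t'"
    proof -
      have "r \<le> t' * (norm u / 2)" using r(2) by simp
      also have "\<dots> \<le> t' * a" using a w(2) by (intro mult_left_mono) auto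
      finally show ?thesis using a(2) by (simp add: divide_le_eq)
    qed
    then have "norm (w - (r / a) *\<^sub>R y) \<le> norm w - r / a / t' * \<gamma>"
      unfolding \<gamma>_def using r(1) a(2) w(2) by (intro norm_decrease_shorter_step) auto
    then have "a * norm (w - (r / a) *\<^sub>R y) \<le> a * (norm w - r / a / t' * \<gamma>)"
      using a(2) by (intro mult_left_mono) auto
    also have "\<dots> = a * norm w - 2 * (r * \<rho>)" using a(2) w(2) by (simp add: \<rho>_def field_simps)
    also have "a * norm w \<le> norm u * norm w" using a(3) by (intro mult_right_mono) auto
    finally have 1: "a * norm (w - (r / a) *\<^sub>R y) \<le> norm u * norm w - 2 * (r * \<rho>)" by simp
    have "norm (TW i - y) \<le> \<rho>" using i \<alpha>(2) by (intro \<alpha>'(2)) auto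
    then have 2: "r * norm (TW i - y) \<le> r * \<rho>" using r(1) by (intro mult_left_mono) auto
    have "a *\<^sub>R w - r *\<^sub>R TW i = a *\<^sub>R (w - (r / a) *\<^sub>R y) - r *\<^sub>R (TW i - y)"
      using a(2) by (simp add: scaleR_diff_right)
    then have "norm (a *\<^sub>R w - r *\<^sub>R TW i) \<le> a * norm (w - (r / a) *\<^sub>R y) + r * norm (TW i - y)"
      using norm_triangle_ineq4[of "a *\<^sub>R (w - (r / a) *\<^sub>R y)" "r *\<^sub>R (TW i - y)"] a(2) r(1) by simp
    with 1 2 have "norm (a *\<^sub>R w - r *\<^sub>R TW i) \<le> norm u * norm w - r * \<rho>" by argo
    moreover have "d i u * e j w - r * d i (TU j) = e j (a *\<^sub>R w - r *\<^sub>R TW i)"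
      using pairing[OF i(1) j] by (simp add: a_def blinfun.diff_right blinfun.scaleR_right)
    ultimately show ?thesis
      using norming_set_abs_le[OF E, of "e j" "a *\<^sub>R w - r *\<^sub>R TW i"] j by simp
  qed
  define \<mu> where "\<mu> = max (norm u * norm w - r * \<rho>) (norm u * norm w - \<alpha> * norm w / 2)"
  have bound_all: "\<bar>d i u * e j w - r * d i (TU j)\<bar> \<le> \<mu>" if ij: "i \<in> I" "j \<in> J" for i j
  proof -
    consider "norm u - \<alpha> < d i u" | "norm u - \<alpha> < - d i u" | "\<bar>d i u\<bar> \<le> norm u - \<alpha>" by linarith
    then show ?thesis
    proof cases
      case 1
      then show ?thesis using in_slice[OF ij(1) 1 ij(2)] by (simp add: \<mu>_def)
    next
      case 2
      obtain i' where i': "i' \<in> I" "d i' = - d i" using norming_setD(2)[OF D, of "d i"] ij(1) by auto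
      have "d i' v = - d i v" for v by (simp add: i' uminus_blinfun.rep_eq)
      then have "\<bar>d i u * e j w - r * d i (TU j)\<bar> = \<bar>d i' u * e j w - r * d i' (TU j)\<bar>" "norm u - \<alpha> < d i' u"
        using 2 by simp_all
      then show ?thesis using in_slice[OF i'(1) _ ij(2)] by (simp add: \<mu>_def)
    next
      case 3
      have "\<bar>d i u * e j w\<bar> \<le> (norm u - \<alpha>) * norm w"
        unfolding abs_mult using 3 norming_set_abs_le[OF E, of "e j" w] ij(2) by (intro mult_mono) auto
      moreover have "\<bar>r * d i (TU j)\<bar> \<le> r * K"
        unfolding abs_mult using r(1) norming_set_abs_le[OF D, of "d i" "TU j"] ij bound[OF ij(2)]
        by (intro mult_mono) auto
      moreover have "(norm u - \<alpha>) * norm w = norm u * norm w - \<alpha> * norm w" by (simp add: left_diff_distrib)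
      ultimately have "\<bar>d i u * e j w - r * d i (TU j)\<bar> \<le> norm u * norm w - \<alpha> * norm w / 2"
        using rK by argo
      then show ?thesis by (simp add: \<mu>_def)
    qed
  qed
  have "\<mu> < norm u * norm w" using r(1) \<rho> \<alpha>(1) nw by (simp add: \<mu>_def)
  with u(1) w(1) r(1) show thesis using bound_all by (rule that)
qed

section \<open>Slopes of Lipschitz maps\<close>

lift_definition lip0_tensor :: "('m::{metric_space, zero}, real) lip0 \<Rightarrow> 'y::real_normed_vector \<Rightarrow> ('m, 'y) lip0"
  is "\<lambda>f y t. f t *\<^sub>R y"
proof -
  fix f :: "'m \<Rightarrow> real" and y :: 'y
  assume "f 0 = 0 \<and> (\<exists>C. C-lipschitz_on UNIV f)"
  then obtain C where f: "f 0 = 0" "C-lipschitz_on UNIV f" by blast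
  have "(C * norm y)-lipschitz_on UNIV (\<lambda>t. f t *\<^sub>R y)"
  proof (rule lipschitz_onI)
    fix t s
    have "dist (f t *\<^sub>R y) (f s *\<^sub>R y) = dist (f t) (f s) * norm y"
      by (simp add: dist_norm flip: scaleR_diff_left)
    also have "\<dots> \<le> C * dist t s * norm y" by (intro mult_right_mono lipschitz_onD[OF f(2)]) auto
    finally show "dist (f t *\<^sub>R y) (f s *\<^sub>R y) \<le> C * norm y * dist t s" by (simp add: mult_ac)
  qed (use lipschitz_on_nonneg[OF f(2)] in simp)
  then show "f 0 *\<^sub>R y = 0 \<and> (\<exists>C. C-lipschitz_on UNIV (\<lambda>t. f t *\<^sub>R y))" using f(1) by auto
qed

lift_definition lip0_compose :: "('y::real_normed_vector \<Rightarrow>\<^sub>L real) \<Rightarrow> ('m::{metric_space, zero}, 'y) lip0 \<Rightarrow> ('m, real) lip0"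
  is "\<lambda>\<phi> f t. blinfun_apply \<phi> (f t)"
proof -
  fix \<phi> :: "'y \<Rightarrow>\<^sub>L real" and f :: "'m \<Rightarrow> 'y"
  assume "f 0 = 0 \<and> (\<exists>C. C-lipschitz_on UNIV f)"
  then obtain C where f: "f 0 = 0" "C-lipschitz_on UNIV f" by blast
  have "(norm \<phi> * C)-lipschitz_on UNIV (\<lambda>t. \<phi> (f t))"
  proof (rule lipschitz_onI)
    fix t s
    have "dist (\<phi> (f t)) (\<phi> (f s)) \<le> norm \<phi> * dist (f t) (f s)"
      using norm_blinfun[of \<phi> "f t - f s"] by (simp add: dist_norm blinfun.diff_right)
    also have "\<dots> \<le> norm \<phi> * (C * dist t s)" by (intro mult_left_mono lipschitz_onD[OF f(2)]) auto
    finally show "dist (\<phi> (f t)) (\<phi> (f s)) \<le> norm \<phi> * C * dist t s" by (simp add: mult_ac)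
  qed (use lipschitz_on_nonneg[OF f(2)] in simp)
  then show "\<phi> (f 0) = 0 \<and> (\<exists>C. C-lipschitz_on UNIV (\<lambda>t. \<phi> (f t)))" using f(1) by auto
qed

definition slope :: "('m::{metric_space, zero}, 'y::real_normed_vector) lip0 \<Rightarrow> 'm \<times> 'm \<Rightarrow> 'y" where
  "slope f p = (lip0_apply f (fst p) - lip0_apply f (snd p)) /\<^sub>R dist (fst p) (snd p)"

definition distinct_pairs :: "('m \<times> 'm) set" where
  "distinct_pairs = {p. fst p \<noteq> snd p}"

lemma slope_diff_scale: "slope (f - c *\<^sub>R g) p = slope f p - c *\<^sub>R slope g p"
  by (simp add: slope_def minus_lip0.rep_eq scaleR_lip0.rep_eq algebra_simps)

lemma norm_slope_le: "norm (slope f p) \<le> norm f"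
proof (cases "fst p = snd p")
  case True
  then show ?thesis by (simp add: slope_def)
next
  case False
  then show ?thesis
    using norm_lip0_bound[of f "fst p" "snd p"] by (simp add: slope_def divide_inverse_commute[symmetric] pos_divide_le_eq)
qed

lemma norm_lip0_le_slope:
  assumes "0 \<le> C" "\<And>p. p \<in> distinct_pairs \<Longrightarrow> norm (slope f p) \<le> C"
  shows "norm f \<le> C"
proof (rule norm_lip0_le[OF assms(1)])
  fix t s
  show "norm (lip0_apply f t - lip0_apply f s) \<le> C * dist t s"
  proof (cases "t = s")
    case False
    then have "norm (slope f (t, s)) \<le> C" by (intro assms(2)) (simp add: distinct_pairs_def)
    then show ?thesis using False by (simp add: slope_def divide_inverse_commute[symmetric] pos_divide_le_eq)
  qed simp
qed

lemma slope_norming: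
  assumes "f \<noteq> 0" "\<kappa> < norm f"
  shows "\<exists>p\<in>distinct_pairs. \<kappa> < norm (slope f p)"
proof (rule ccontr)
  assume "\<not> ?thesis"
  then have le: "norm (slope f p) \<le> \<kappa>" if "p \<in> distinct_pairs" for p using that by force
  have "norm f \<le> max 0 \<kappa>"
    by (rule norm_lip0_le_slope) (use le in \<open>auto intro: le_max_iff_disj[THEN iffD2]\<close>)
  then have "norm f \<le> 0 \<or> norm f \<le> \<kappa>" by linarith
  moreover have "0 < norm f" using assms(1) by simp
  ultimately show False using assms(2) by linarith
qed

lemma slope_tensor: "slope (lip0_tensor f y) p = slope f p *\<^sub>R y"
  by (simp add: slope_def lip0_tensor.rep_eq scaleR_diff_left[symmetric])

lemma slope_compose: "slope (lip0_compose \<phi> f) p = \<phi> (slope f p)"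
  by (simp add: slope_def lip0_compose.rep_eq blinfun.scaleR_right blinfun.diff_right)

lemma norm_lip0_compose_le: "norm (lip0_compose \<phi> f) \<le> norm \<phi> * norm f"
proof (rule norm_lip0_le_slope)
  fix p
  have "norm (slope (lip0_compose \<phi> f) p) \<le> norm \<phi> * norm (slope f p)"
    unfolding slope_compose by (rule norm_blinfun)
  also have "\<dots> \<le> norm \<phi> * norm f" by (intro mult_left_mono norm_slope_le) simp
  finally show "norm (slope (lip0_compose \<phi> f) p) \<le> norm \<phi> * norm f" .
qed simp

lemma norm_lip0_tensor_ge: "norm f * norm y \<le> norm (lip0_tensor f y)"
proof (cases "y = 0 \<or> f = 0")
  case False
  then have y: "0 < norm y" by simp
  have "norm f \<le> norm (lip0_tensor f y) / norm y"
  proof (rule norm_lip0_le_slope)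
    fix p
    have "norm (slope f p) * norm y \<le> norm (lip0_tensor f y)"
      using norm_slope_le[of "lip0_tensor f y" p] by (simp add: slope_tensor)
    then show "norm (slope f p) \<le> norm (lip0_tensor f y) / norm y" using y by (simp add: pos_le_divide_eq)
  qed simp
  then show ?thesis using y by (simp add: pos_le_divide_eq)
qed auto

lemma lip0_tensor_nonzero: "f \<noteq> 0 \<Longrightarrow> y \<noteq> 0 \<Longrightarrow> lip0_tensor f y \<noteq> 0"
  using norm_lip0_tensor_ge[of f y] by (auto simp: mult_le_0_iff)

lemma lip0_nonzero_slope: "f \<noteq> 0 \<Longrightarrow> \<exists>p\<in>distinct_pairs. slope f p \<noteq> 0"
  using slope_norming[of f 0] by auto

definition dual_ball :: "('y::real_normed_vector \<Rightarrow>\<^sub>L real) set" where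
  "dual_ball = {\<phi>. norm \<phi> \<le> 1}"

lemma norming_set_dual_ball: "norming_set (dual_ball :: ('y::real_normed_vector \<Rightarrow>\<^sub>L real) set)"
  unfolding norming_set_def
proof (intro conjI ballI allI impI)
  fix w :: 'y and \<kappa> assume "\<kappa> < norm w"
  moreover obtain \<phi> :: "'y \<Rightarrow>\<^sub>L real" where "norm \<phi> \<le> 1" "\<phi> w = norm w" using norming_functional[of w] .
  ultimately show "\<exists>d\<in>dual_ball. \<kappa> < d w" by (auto simp: dual_ball_def)
qed (auto simp: dual_ball_def)

text \<open>
  The slope at a pair of points as an element of the Lipschitz-free space. The norm of a Lipschitz map is the
  supremum of its slopes, so the molecules are norming.
\<close>

definition molecule :: "'m \<times> 'm \<Rightarrow> ('m::{metric_space, zero}, real) lip0 \<Rightarrow>\<^sub>L real" where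
  "molecule p = (lip0_delta (fst p) - lip0_delta (snd p)) /\<^sub>R dist (fst p) (snd p)"

lemma molecule_apply [simp]: "molecule p f = slope f p"
  by (simp add: molecule_def slope_def scaleR_blinfun.rep_eq minus_blinfun.rep_eq lip0_delta.rep_eq)

lemma norming_set_molecules:
  assumes "f0 \<noteq> (0 :: ('m::{metric_space, zero}, real) lip0)"
  shows "norming_set (molecule ` (distinct_pairs :: ('m \<times> 'm) set))"
  unfolding norming_set_def
proof (intro conjI ballI allI impI)
  fix d :: "('m, real) lip0 \<Rightarrow>\<^sub>L real" assume "d \<in> molecule ` distinct_pairs"
  then obtain p where p: "d = molecule p" "p \<in> distinct_pairs" by blast
  show "norm d \<le> 1"
  proof (rule norm_blinfun_bound)
    show "norm (d f) \<le> 1 * norm f" for f using norm_slope_le[of f p] by (simp add: p)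
  qed simp
  have "- d = molecule (snd p, fst p)"
    by (simp add: p molecule_def dist_commute flip: scaleR_minus_right)
  moreover have "(snd p, fst p) \<in> distinct_pairs" using p(2) by (auto simp: distinct_pairs_def)
  ultimately show "- d \<in> molecule ` distinct_pairs" by blast
next
  fix f :: "('m, real) lip0" and \<kappa> assume \<kappa>: "\<kappa> < norm f"
  have "\<exists>p\<in>distinct_pairs. \<kappa> < \<bar>slope f p\<bar>"
  proof (cases "f = 0")
    case True
    obtain p :: "'m \<times> 'm" where "p \<in> distinct_pairs" using lip0_nonzero_slope[OF assms] by blast
    then show ?thesis using \<kappa> True by (intro bexI[of _ p]) auto
  next
    case False
    then show ?thesis using slope_norming[OF False \<kappa>] by simp
  qed
  then obtain p where p: "p \<in> distinct_pairs" "\<kappa> < \<bar>slope f p\<bar>" by blast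
  have "slope f (snd p, fst p) = - slope f p"
    by (simp add: slope_def dist_commute algebra_simps)
  then have "\<kappa> < slope f p \<or> \<kappa> < slope f (snd p, fst p)" using p(2) by linarith
  moreover have "(snd p, fst p) \<in> distinct_pairs" using p(1) by (auto simp: distinct_pairs_def)
  ultimately show "\<exists>d\<in>molecule ` distinct_pairs. \<kappa> < d f" using p(1) by force
qed

lemma norm_lip0_le_dual:
  fixes f :: "('m::{metric_space, zero}, 'y::real_normed_vector) lip0"
  assumes "0 \<le> C" "\<And>p \<phi>. p \<in> distinct_pairs \<Longrightarrow> norm \<phi> \<le> 1 \<Longrightarrow> blinfun_apply \<phi> (slope f p) \<le> C"
  shows "norm f \<le> C"
proof (rule norm_lip0_le_slope[OF assms(1)])
  fix p :: "'m \<times> 'm" assume "p \<in> distinct_pairs"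
  then show "norm (slope f p) \<le> C"
    using assms(2) by (intro norming_set_norm_le[OF norming_set_dual_ball]) (auto simp: dual_ball_def)
qed

text \<open>
  For a fixed nonzero scalar \<open>f\<close>, the space of values embeds as \<open>y \<mapsto> f \<otimes> y\<close>, and slopes are the contractions
  that lead back.
\<close>

lemma ball_covering_property_lip0_imp_target:
  assumes bcp: "ball_covering_property TYPE(('m::{metric_space, zero}, 'y::banach) lip0)"
  shows "ball_covering_property TYPE('y)"
proof -
  obtain T :: "('m, 'y) lip0" where T: "T \<noteq> 0" using bcp unfolding ball_covering_property_iff by blast
  obtain p where p: "slope T p \<noteq> 0" using lip0_nonzero_slope[OF T] by blast
  obtain \<phi> :: "'y \<Rightarrow>\<^sub>L real" where \<phi>: "\<phi> (slope T p) = norm (slope T p)" using norming_functional[of "slope T p"] by blast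
  define f where "f = lip0_compose \<phi> T"
  have "slope f p \<noteq> 0" using p \<phi> by (simp add: f_def slope_compose)
  then have f: "f \<noteq> 0" by (auto simp: slope_def zero_lip0.rep_eq)
  show ?thesis
  proof (rule ball_covering_property_transfer[OF bcp, of "lip0_tensor f" "(\<lambda>p v. slope v p) ` distinct_pairs"])
    show "\<exists>y::'y. y \<noteq> 0" using p by blast
    show "lip0_tensor f y \<noteq> 0" if "y \<noteq> 0" for y :: 'y using f that by (rule lip0_tensor_nonzero)
    show "\<exists>L\<in>(\<lambda>p v. slope v p) ` distinct_pairs. \<kappa> < norm (L v)" if v: "v \<noteq> 0" "\<kappa> < norm v" for v :: "('m, 'y) lip0" and \<kappa>
    proof -
      obtain p where "p \<in> distinct_pairs" "\<kappa> < norm (slope v p)" using slope_norming[OF v] by blast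
      then show ?thesis by (intro bexI[of _ "\<lambda>v. slope v p"]) auto
    qed
  qed (auto simp: slope_diff_scale norm_slope_le slope_tensor)
qed

text \<open>
  For a fixed nonzero \<open>y\<close>, the scalar maps embed as \<open>f \<mapsto> f \<otimes> y\<close>, and composition with functionals from the
  dual unit ball leads back.
\<close>

lemma ball_covering_property_lip0_imp_scalar:
  assumes bcp: "ball_covering_property TYPE(('m::{metric_space, zero}, 'y::banach) lip0)"
  shows "ball_covering_property TYPE(('m, real) lip0)"
proof -
  obtain T :: "('m, 'y) lip0" where T: "T \<noteq> 0" using bcp unfolding ball_covering_property_iff by blast
  obtain p where p: "slope T p \<noteq> 0" using lip0_nonzero_slope[OF T] by blast
  obtain \<phi> :: "'y \<Rightarrow>\<^sub>L real" where \<phi>: "\<phi> (slope T p) = norm (slope T p)" using norming_functional[of "slope T p"] by blast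
  have "slope (lip0_compose \<phi> T) p \<noteq> 0" using p \<phi> by (simp add: slope_compose)
  then have f: "lip0_compose \<phi> T \<noteq> 0" by (auto simp: slope_def zero_lip0.rep_eq)
  show ?thesis
  proof (rule ball_covering_property_transfer[OF bcp, of "\<lambda>f. lip0_tensor f (slope T p)" "lip0_compose ` dual_ball"])
    show "\<exists>y::('m, real) lip0. y \<noteq> 0" using f by blast
    show "lip0_tensor f (slope T p) \<noteq> 0" if "f \<noteq> 0" for f :: "('m, real) lip0" using that p by (rule lip0_tensor_nonzero)
  next
    fix L :: "('m, 'y) lip0 \<Rightarrow> ('m, real) lip0" and v w :: "('m, 'y) lip0" and t
    assume "L \<in> lip0_compose ` dual_ball"
    then obtain \<phi> where \<phi>: "L = lip0_compose \<phi>" "norm \<phi> \<le> 1" by (auto simp: dual_ball_def)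
    show "L (v - t *\<^sub>R w) = L v - t *\<^sub>R L w"
      unfolding \<phi> by transfer (simp add: blinfun.diff_right blinfun.scaleR_right)
    show "norm (L v) \<le> norm v"
      unfolding \<phi> using norm_lip0_compose_le[of \<phi> v] mult_right_mono[OF \<phi>(2), of "norm v"] by simp
    have "L (lip0_tensor f (slope T p)) = blinfun_apply \<phi> (slope T p) *\<^sub>R f" for f
      unfolding \<phi> by transfer (simp add: blinfun.scaleR_right mult.commute)
    then show "\<exists>c. \<forall>f. L (lip0_tensor f (slope T p)) = c *\<^sub>R f" by blast
  next
    fix v :: "('m, 'y) lip0" and \<kappa> assume v: "v \<noteq> 0" "\<kappa> < norm v"
    obtain q where q: "\<kappa> < norm (slope v q)" using slope_norming[OF v] by blast
    obtain \<phi> :: "'y \<Rightarrow>\<^sub>L real" where \<phi>: "norm \<phi> \<le> 1" "\<phi> (slope v q) = norm (slope v q)" using norming_functional .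
    have "norm (slope v q) = norm (slope (lip0_compose \<phi> v) q)" by (simp add: slope_compose \<phi>)
    also have "\<dots> \<le> norm (lip0_compose \<phi> v)" by (rule norm_slope_le)
    finally show "\<exists>L\<in>lip0_compose ` dual_ball. \<kappa> < norm (L v)" using q \<phi>(1) by (force simp: dual_ball_def)
  qed
qed

lemma tensor_descent_norm:
  fixes T :: "('m::{metric_space, zero}, 'y::real_normed_vector) lip0"
  assumes \<mu>: "\<mu> < norm f * norm y"
    and le: "\<And>p \<phi>. p \<in> distinct_pairs \<Longrightarrow> norm \<phi> \<le> 1 \<Longrightarrow>
        \<bar>slope f p * blinfun_apply \<phi> y - r * blinfun_apply \<phi> (slope T p)\<bar> \<le> \<mu>"
    and f: "f \<noteq> 0"
  shows "norm (lip0_tensor f y - r *\<^sub>R T) < norm (lip0_tensor f y)"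
proof -
  obtain p :: "'m \<times> 'm" where "p \<in> distinct_pairs" using lip0_nonzero_slope[OF f] by blast
  then have "0 \<le> \<mu>" using order_trans[OF abs_ge_zero le[of p 0]] by simp
  then have "norm (lip0_tensor f y - r *\<^sub>R T) \<le> \<mu>"
  proof (rule norm_lip0_le_dual)
    fix p :: "'m \<times> 'm" and \<phi> :: "'y \<Rightarrow>\<^sub>L real" assume "p \<in> distinct_pairs" "norm \<phi> \<le> 1"
    from le[OF this] show "\<phi> (slope (lip0_tensor f y - r *\<^sub>R T) p) \<le> \<mu>"
      by (simp add: slope_diff_scale slope_tensor blinfun.diff_right blinfun.scaleR_right)
  qed
  also have "\<dots> < norm (lip0_tensor f y)" using \<mu> norm_lip0_tensor_ge[of f y] by linarith
  finally show ?thesis .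
qed

section \<open>Density of strongly exposing vectors\<close>

text \<open>
  Induction on \<open>F\<close>: if some \<open>u\<close> vanishes on \<open>F\<close> but not at \<open>w\<close>, then subtracting \<open>\<phi> u / u w\<close> times the
  evaluation at \<open>w\<close> leaves a functional that is zero whenever \<open>F\<close> alone is annihilated.
\<close>

lemma functional_in_span_of_evaluations:
  fixes F :: "'w::real_normed_vector set" and \<phi> :: "('w \<Rightarrow>\<^sub>L real) \<Rightarrow> real"
  assumes "finite F" "linear \<phi>" "\<And>v. (\<And>w. w \<in> F \<Longrightarrow> blinfun_apply v w = 0) \<Longrightarrow> \<phi> v = 0"
  shows "\<exists>g. \<forall>v. \<phi> v = blinfun_apply v g"
  using assms
proof (induction F arbitrary: \<phi> rule: finite_induct)
  case empty
  then show ?case by (intro exI[of _ 0]) simp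
next
  case (insert w F)
  show ?case
  proof (cases "\<exists>v :: 'w \<Rightarrow>\<^sub>L real. (\<forall>x\<in>F. blinfun_apply v x = 0) \<and> blinfun_apply v w \<noteq> 0")
    case False
    have "\<phi> v = 0" if v: "\<And>x. x \<in> F \<Longrightarrow> blinfun_apply v x = 0" for v
    proof -
      have "blinfun_apply v w = 0" using False v by blast
      then have "blinfun_apply v x = 0" if "x \<in> insert w F" for x using that v by (elim insertE) auto
      then show ?thesis by (rule insert.prems(2))
    qed
    then show ?thesis by (rule insert.IH[OF insert.prems(1)])
  next
    case True
    then obtain u :: "'w \<Rightarrow>\<^sub>L real" where u: "\<And>x. x \<in> F \<Longrightarrow> blinfun_apply u x = 0" "blinfun_apply u w \<noteq> 0" by blast
    define c where "c = \<phi> u / u w"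
    define \<psi> where "\<psi> v = \<phi> v - c * blinfun_apply v w" for v
    have "linear \<psi>"
      by (rule linearI) (simp_all add: \<psi>_def linear_add[OF insert.prems(1)] linear_scale[OF insert.prems(1)]
          plus_blinfun.rep_eq scaleR_blinfun.rep_eq algebra_simps)
    moreover have "\<psi> v = 0" if v: "\<And>x. x \<in> F \<Longrightarrow> blinfun_apply v x = 0" for v
    proof -
      have "\<phi> (v - (v w / u w) *\<^sub>R u) = 0"
        using v u by (intro insert.prems(2)) (auto simp: minus_blinfun.rep_eq scaleR_blinfun.rep_eq)
      then show ?thesis
        using u(2) by (simp add: \<psi>_def c_def linear_diff[OF insert.prems(1)] linear_scale[OF insert.prems(1)])
    qed
    ultimately obtain g where g: "\<And>v. \<psi> v = blinfun_apply v g" using insert.IH[of \<psi>] by blast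
    have "\<phi> v = blinfun_apply v (g + c *\<^sub>R w)" for v
      using g[of v] by (simp add: \<psi>_def blinfun.add_right blinfun.scaleR_right)
    then show ?thesis by blast
  qed
qed

text \<open>
  Slices of the dual ball by vectors of \<open>Y\<close> are weak-star slices, so the tree is built with weak-star
  approximation. The limit measure takes its values in the dual of \<open>Y\<close>, which is the space that has the
  Radon-Nikodym property.
\<close>

lemma strongly_exposing_dense_dual_rnp:
  assumes rnp: "radon_nikodym_property TYPE('y::banach \<Rightarrow>\<^sub>L real)" and nz: "\<exists>y::'y. y \<noteq> 0" and \<delta>: "0 < \<delta>"
  shows "\<exists>g::'y. norm (g - f) < \<delta> \<and> (\<forall>\<epsilon>>0. small_slice dual_ball \<epsilon> g)"
proof -
  have "\<exists>g. norm (g - f) < \<delta> \<and> small_slice dual_ball \<epsilon> g" if "norm f = 1" "0 < \<epsilon>" "0 < \<delta>" for f :: 'y and \<epsilon> \<delta>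
  proof (rule small_slice_dense_unit[where X = UNIV and strong = False])
    fix F :: "'y set" and \<phi> :: "('y \<Rightarrow>\<^sub>L real) \<Rightarrow> real"
    assume F: "finite F" and \<phi>: "linear \<phi>" "\<And>v. \<phi> v \<le> (\<Sum>w\<in>F. \<bar>blinfun_apply v w\<bar>) + of_bool False * norm v"
    have "\<phi> v = 0" if v: "\<And>w. w \<in> F \<Longrightarrow> blinfun_apply v w = 0" for v
    proof -
      have "\<phi> v \<le> 0" "\<phi> (- v) \<le> 0" using \<phi>(2)[of v] \<phi>(2)[of "- v"] v by (simp_all add: uminus_blinfun.rep_eq)
      then show ?thesis using linear_neg[OF \<phi>(1), of v] by simp
    qed
    then show "\<exists>g. \<forall>v\<in>UNIV. \<phi> v = blinfun_apply v g"
      using functional_in_span_of_evaluations[OF F \<phi>(1)] by blast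
  next
    fix G :: "real set \<Rightarrow> 'y \<Rightarrow>\<^sub>L real" and C
    assume "\<And>E E'. E \<in> sets borel \<Longrightarrow> E' \<in> sets borel \<Longrightarrow> E \<inter> E' = {} \<Longrightarrow> G (E \<union> E') = G E + G E'"
      and "\<And>E. E \<in> sets borel \<Longrightarrow> norm (G E) \<le> C * measure unit_measure E"
    then show "dyadic_oscillation G \<longlonglongrightarrow> 0"
      by (rule rnp_dyadic_oscillation[OF rnp])
  qed (use that in \<open>auto simp: norming_set_dual_ball\<close>)
  then show ?thesis
    using strongly_exposing_dense[OF norming_set_dual_ball nz _ \<delta>, of f] by blast
qed

lemma norm_lip0_delta_diff_le: "norm (lip0_delta t - lip0_delta s) \<le> dist t s"
proof (rule norm_blinfun_bound)
  show "norm (blinfun_apply (lip0_delta t - lip0_delta s) f) \<le> dist t s * norm f" for f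
    using norm_lip0_bound[of f t s] by (simp add: minus_blinfun.rep_eq lip0_delta.rep_eq mult.commute)
qed simp

text \<open>
  The dual of the Lipschitz-free space is the space of Lipschitz functions: \<open>\<phi>\<close> is evaluation at
  \<open>t \<mapsto> \<phi> (\<delta>\<^sub>t)\<close>.
\<close>

lemma lip_free_functional_represented:
  fixes \<phi> :: "(('m::{metric_space, zero}, real) lip0 \<Rightarrow>\<^sub>L real) \<Rightarrow> real"
  assumes \<phi>: "bounded_linear \<phi>"
  shows "\<exists>g. \<forall>v\<in>closure (span (range lip0_delta)). \<phi> v = blinfun_apply v g"
proof -
  interpret \<phi>: bounded_linear \<phi> by fact
  obtain B where B: "0 \<le> B" "\<And>v. norm (\<phi> v) \<le> norm v * B" using \<phi>.nonneg_bounded by blast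
  define g where "g t = \<phi> (lip0_delta t)" for t
  have delta0: "lip0_delta (0 :: 'm) = 0"
    by (rule blinfun_eqI) (simp add: lip0_delta.rep_eq)
  have "B-lipschitz_on UNIV g"
  proof (rule lipschitz_onI[OF _ B(1)])
    fix t s
    have "dist (g t) (g s) = norm (\<phi> (lip0_delta t - lip0_delta s))" by (simp add: g_def dist_norm \<phi>.diff)
    also have "\<dots> \<le> norm (lip0_delta t - lip0_delta s) * B" by (rule B(2))
    also have "\<dots> \<le> dist t s * B" by (intro mult_right_mono norm_lip0_delta_diff_le B(1))
    finally show "dist (g t) (g s) \<le> B * dist t s" by (simp add: mult.commute)
  qed
  moreover have "g 0 = 0" by (simp add: g_def delta0 \<phi>.zero)
  ultimately have g: "lip0_apply (Lip0 g) = g" by (intro Lip0_inverse) blast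
  let ?E = "{v. \<phi> v - blinfun_apply v (Lip0 g) = 0}"
  have "subspace ?E"
    by (auto simp: subspace_def \<phi>.zero \<phi>.add \<phi>.scale plus_blinfun.rep_eq scaleR_blinfun.rep_eq)
  moreover have "range lip0_delta \<subseteq> ?E" by (auto simp: lip0_delta.rep_eq g g_def)
  ultimately have "span (range lip0_delta) \<subseteq> ?E" by (rule span_minimal[rotated])
  moreover have "closed ?E"
    by (intro closed_Collect_eq continuous_intros \<phi>.continuous_on)
  ultimately have "closure (span (range lip0_delta)) \<subseteq> ?E" by (rule closure_minimal)
  then show ?thesis by (intro exI[of _ "Lip0 g"]) auto
qed

text \<open>
  Here the approximation is in norm. It keeps the limit measure, a priori with values in the dual of the space of
  Lipschitz functions, inside the Lipschitz-free space, where the Radon-Nikodym property is assumed.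
\<close>

lemma strongly_exposing_dense_free_rnp:
  assumes rnp: "radon_nikodym_property TYPE('m::{metric_space, zero} lip_free)"
    and nz: "\<exists>f::('m, real) lip0. f \<noteq> 0" and \<delta>: "0 < \<delta>"
  shows "\<exists>g::('m, real) lip0. norm (g - f) < \<delta> \<and> (\<forall>\<epsilon>>0. small_slice (molecule ` distinct_pairs) \<epsilon> g)"
proof -
  let ?X = "closure (span (range (lip0_delta :: 'm \<Rightarrow> _)))"
  have D: "norming_set (molecule ` (distinct_pairs :: ('m \<times> 'm) set))" using nz norming_set_molecules by blast
  have "\<exists>g. norm (g - f) < \<delta> \<and> small_slice (molecule ` distinct_pairs) \<epsilon> g"
    if "norm f = 1" "0 < \<epsilon>" "0 < \<delta>" for f :: "('m, real) lip0" and \<epsilon> \<delta>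
  proof (rule small_slice_dense_unit[where X = ?X and strong = True])
    show "molecule ` distinct_pairs \<subseteq> ?X"
    proof -
      have "molecule p \<in> span (range lip0_delta)" for p :: "'m \<times> 'm"
        unfolding molecule_def by (intro span_scale span_diff span_base rangeI)
      then show ?thesis using closure_subset[of "span (range (lip0_delta :: 'm \<Rightarrow> _))"] by blast
    qed
  next
    fix F :: "('m, real) lip0 set" and \<phi> :: "(('m, real) lip0 \<Rightarrow>\<^sub>L real) \<Rightarrow> real"
    assume F: "finite F" and \<phi>: "linear \<phi>" "\<And>v. \<phi> v \<le> (\<Sum>w\<in>F. \<bar>blinfun_apply v w\<bar>) + of_bool True * norm v"
    let ?B = "(\<Sum>w\<in>F. norm w) + 1"
    have le: "\<phi> v \<le> norm v * ?B" for v
    proof -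
      have "(\<Sum>w\<in>F. \<bar>blinfun_apply v w\<bar>) \<le> (\<Sum>w\<in>F. norm v * norm w)"
        using norm_blinfun[of v] by (intro sum_mono) simp
      then show ?thesis using \<phi>(2)[of v] by (simp add: distrib_left sum_distrib_left)
    qed
    have "norm (\<phi> v) \<le> norm v * ?B" for v
      using le[of v] le[of "- v"] linear_neg[OF \<phi>(1), of v] by simp
    then have "bounded_linear \<phi>"
      using \<phi>(1) by (intro bounded_linear_intro[of _ ?B]) (auto simp: linear_add linear_scale)
    then show "\<exists>g. \<forall>v\<in>?X. \<phi> v = blinfun_apply v g" by (rule lip_free_functional_represented)
  next
    fix G :: "real set \<Rightarrow> ('m, real) lip0 \<Rightarrow>\<^sub>L real" and C
    assume add: "\<And>E E'. E \<in> sets borel \<Longrightarrow> E' \<in> sets borel \<Longrightarrow> E \<inter> E' = {} \<Longrightarrow> G (E \<union> E') = G E + G E'"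
      and bd: "\<And>E. E \<in> sets borel \<Longrightarrow> norm (G E) \<le> C * measure unit_measure E"
      and X: "\<And>E. True \<Longrightarrow> E \<in> sets borel \<Longrightarrow> G E \<in> closure ?X"
    have rep: "lip_free_rep (Lip_free (G E)) = G E" if "E \<in> sets borel" for E
      using X[OF _ that] by (intro Lip_free_inverse) simp
    let ?H = "\<lambda>E. Lip_free (G E)"
    have "dyadic_oscillation ?H \<longlonglongrightarrow> 0"
    proof (rule rnp_dyadic_oscillation[OF rnp])
      fix A B :: "real set" assume AB: "A \<in> sets borel" "B \<in> sets borel" "A \<inter> B = {}"
      then have "A \<union> B \<in> sets borel" by auto
      then have "lip_free_rep (?H (A \<union> B)) = lip_free_rep (?H A + ?H B)"
        unfolding plus_lip_free.rep_eq rep[OF AB(1)] rep[OF AB(2)] rep add[OF AB, symmetric] by (rule rep)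
      then show "?H (A \<union> B) = ?H A + ?H B" by (simp add: lip_free_rep_inject)
    next
      fix A :: "real set" assume "A \<in> sets borel"
      then show "norm (?H A) \<le> C * measure unit_measure A"
        using bd[of A] by (simp only: norm_lip_free.rep_eq rep)
    qed
    then show "dyadic_oscillation G \<longlonglongrightarrow> 0"
      by (simp add: norm_lip_free.rep_eq minus_lip_free.rep_eq rep)
  qed (use that in \<open>auto intro: D subspace_closure_span\<close>)
  then show ?thesis
    using strongly_exposing_dense[OF D nz _ \<delta>, of f] by blast
qed

section \<open>The ball covering property of spaces of Lipschitz maps\<close>

text \<open>
  The two cases differ only in which factor supplies the strongly exposing vectors: scalar Lipschitz functions,
  tested on molecules, or vectors of the value space, tested on the dual ball.
\<close>

lemma lip0_ball_covering_property:
  assumes rnp: "radon_nikodym_property TYPE('m::{metric_space, zero} lip_free) \<or>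
      radon_nikodym_property TYPE('y::banach \<Rightarrow>\<^sub>L real)"
    and bcp: "ball_covering_property TYPE(('m, real) lip0)" "ball_covering_property TYPE('y)"
  shows "ball_covering_property TYPE(('m, 'y) lip0)"
proof -
  obtain f0 :: "('m, real) lip0" and S1 where f0: "f0 \<noteq> 0" and S1: "countable S1" "descent_family (S1 :: ('m, real) lip0 set)"
    using bcp(1) unfolding ball_covering_property_iff by blast
  obtain y0 :: 'y and S2 where y0: "y0 \<noteq> 0" and S2: "countable S2" "descent_family (S2 :: 'y set)"
    using bcp(2) unfolding ball_covering_property_iff by blast
  have D: "norming_set (molecule ` (distinct_pairs :: ('m \<times> 'm) set))" by (rule norming_set_molecules[OF f0])
  have E: "norming_set ((\<lambda>\<phi>. \<phi>) ` (dual_ball :: ('y \<Rightarrow>\<^sub>L real) set))" by (simp add: norming_set_dual_ball)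
  have compose_le: "norm (lip0_compose \<phi> T) \<le> norm T" if "\<phi> \<in> dual_ball" for \<phi> and T :: "('m, 'y) lip0"
    using norm_lip0_compose_le[of \<phi> T] mult_right_mono[of "norm \<phi>" 1 "norm T"] that by (simp add: dual_ball_def)
  have "\<exists>S1 S2. countable S1 \<and> countable S2 \<and> (\<forall>T::('m, 'y) lip0. T \<noteq> 0 \<longrightarrow>
      (\<exists>f\<in>S1. \<exists>y\<in>S2. \<exists>r>0. \<exists>\<mu>. \<mu> < norm f * norm y \<and>
        (\<forall>p\<in>distinct_pairs. \<forall>\<phi>\<in>dual_ball. \<bar>slope f p * blinfun_apply \<phi> y - r * blinfun_apply \<phi> (slope T p)\<bar> \<le> \<mu>)))"
    using rnp
  proof
    assume free: "radon_nikodym_property TYPE('m lip_free)"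
    obtain S1' :: "('m, real) lip0 set" where S1': "countable S1'" "descent_family S1'"
      "\<And>g. g \<in> S1' \<Longrightarrow> \<forall>\<epsilon>>0. small_slice (molecule ` distinct_pairs) \<epsilon> g"
      using strongly_exposing_descent_family[OF S1 strongly_exposing_dense_free_rnp[OF free]] f0 by blast
    have "\<exists>f\<in>S1'. \<exists>y\<in>S2. \<exists>r>0. \<exists>\<mu>. \<mu> < norm f * norm y \<and>
        (\<forall>p\<in>distinct_pairs. \<forall>\<phi>\<in>dual_ball. \<bar>slope f p * blinfun_apply \<phi> y - r * blinfun_apply \<phi> (slope T p)\<bar> \<le> \<mu>)"
      if T: "T \<noteq> 0" for T :: "('m, 'y) lip0"
    proof -
      obtain p where p: "slope T p \<noteq> 0" using lip0_nonzero_slope[OF T] by blast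
      obtain \<phi>0 :: "'y \<Rightarrow>\<^sub>L real" where \<phi>0: "norm \<phi>0 \<le> 1" "\<phi>0 (slope T p) = norm (slope T p)"
        using norming_functional .
      have "slope (lip0_compose \<phi>0 T) p \<noteq> 0" using p \<phi>0 by (simp add: slope_compose)
      then have nz: "lip0_compose \<phi>0 T \<noteq> 0" by (auto simp: slope_def zero_lip0.rep_eq)
      obtain f y r \<mu> where "f \<in> S1'" "y \<in> S2" "0 < r" "\<mu> < norm f * norm y"
        "\<And>p \<phi>. p \<in> distinct_pairs \<Longrightarrow> \<phi> \<in> dual_ball \<Longrightarrow>
          \<bar>molecule p f * blinfun_apply \<phi> y - r * molecule p (lip0_compose \<phi> T)\<bar> \<le> \<mu>"
        using elementary_tensor_descent[OF D E, of "\<lambda>\<phi>. lip0_compose \<phi> T" "slope T" "norm T" \<phi>0 S1' S2]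
          S1' S2 nz \<phi>0 compose_le by (simp add: slope_compose dual_ball_def) blast
      then show ?thesis
        by (intro bexI[of _ f] bexI[of _ y] exI[of _ r] exI[of _ \<mu>] conjI ballI) (simp_all add: slope_compose)
    qed
    then show ?thesis using S1' S2 by blast
  next
    assume dual: "radon_nikodym_property TYPE('y \<Rightarrow>\<^sub>L real)"
    obtain S2' :: "'y set" where S2': "countable S2'" "descent_family S2'"
      "\<And>g. g \<in> S2' \<Longrightarrow> \<forall>\<epsilon>>0. small_slice dual_ball \<epsilon> g"
      using strongly_exposing_descent_family[OF S2 strongly_exposing_dense_dual_rnp[OF dual]] y0 by blast
    have "\<exists>f\<in>S1. \<exists>y\<in>S2'. \<exists>r>0. \<exists>\<mu>. \<mu> < norm f * norm y \<and>
        (\<forall>p\<in>distinct_pairs. \<forall>\<phi>\<in>dual_ball. \<bar>slope f p * blinfun_apply \<phi> y - r * blinfun_apply \<phi> (slope T p)\<bar> \<le> \<mu>)"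
      if T: "T \<noteq> 0" for T :: "('m, 'y) lip0"
    proof -
      obtain p0 :: "'m \<times> 'm" where p0: "p0 \<in> distinct_pairs" "slope T p0 \<noteq> 0" using lip0_nonzero_slope[OF T] by blast
      obtain y f r \<mu> where "y \<in> S2'" "f \<in> S1" "0 < r" "\<mu> < norm y * norm f"
        "\<And>\<phi> p. \<phi> \<in> dual_ball \<Longrightarrow> p \<in> distinct_pairs \<Longrightarrow>
          \<bar>blinfun_apply \<phi> y * molecule p f - r * blinfun_apply \<phi> (slope T p)\<bar> \<le> \<mu>"
        using elementary_tensor_descent[OF E D, of "slope T" "\<lambda>\<phi>. lip0_compose \<phi> T" "norm T" p0 S2' S1]
          S2' S1 p0 norm_slope_le[of T] by (simp add: slope_compose) blast
      then show ?thesis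
        by (intro bexI[of _ f] bexI[of _ y] exI[of _ r] exI[of _ \<mu>] conjI ballI) (auto simp: mult.commute)
    qed
    then show ?thesis using S1 S2' by blast
  qed
  then obtain S1 S2 where S: "countable S1" "countable S2" and descent: "\<And>T::('m, 'y) lip0. T \<noteq> 0 \<Longrightarrow>
      \<exists>f\<in>S1. \<exists>y\<in>S2. \<exists>r>0. \<exists>\<mu>. \<mu> < norm f * norm y \<and>
        (\<forall>p\<in>distinct_pairs. \<forall>\<phi>\<in>dual_ball. \<bar>slope f p * blinfun_apply \<phi> y - r * blinfun_apply \<phi> (slope T p)\<bar> \<le> \<mu>)"
    by blast
  let ?S = "(\<lambda>(f, y). lip0_tensor f y) ` (S1 \<times> S2)"
  have "descent_family ?S"
    unfolding descent_family_def
  proof (intro allI impI)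
    fix T :: "('m, 'y) lip0" assume T: "T \<noteq> 0"
    obtain f y r \<mu> where *: "f \<in> S1" "y \<in> S2" "0 < r" "\<mu> < norm f * norm y"
      "\<And>p \<phi>. p \<in> distinct_pairs \<Longrightarrow> \<phi> \<in> dual_ball \<Longrightarrow>
        \<bar>slope f p * blinfun_apply \<phi> y - r * blinfun_apply \<phi> (slope T p)\<bar> \<le> \<mu>"
      using descent[OF T] by blast
    obtain p :: "'m \<times> 'm" where "p \<in> distinct_pairs" using lip0_nonzero_slope[OF f0] by blast
    then have "0 \<le> \<mu>" using order_trans[OF abs_ge_zero *(5)[of p 0]] by (simp add: dual_ball_def)
    then have "f \<noteq> 0" using *(4) by auto
    then have "norm (lip0_tensor f y - r *\<^sub>R T) < norm (lip0_tensor f y)"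
      using *(4,5) by (intro tensor_descent_norm) (auto simp: dual_ball_def)
    then show "\<exists>z\<in>?S. \<exists>t>0. norm (z - t *\<^sub>R T) < norm z" using *(1-3) by force
  qed
  moreover have "countable ?S" using S by auto
  moreover have "lip0_tensor f0 y0 \<noteq> 0" using f0 y0 by (rule lip0_tensor_nonzero)
  ultimately show ?thesis unfolding ball_covering_property_iff by blast
qed

theorem theorem1p4:
  assumes "radon_nikodym_property TYPE('m::{metric_space, zero} lip_free) \<or>
    radon_nikodym_property TYPE('y::banach \<Rightarrow>\<^sub>L real)"
  shows "ball_covering_property TYPE(('m, 'y) lip0) \<longleftrightarrow>
    ball_covering_property TYPE(('m, real) lip0) \<and> ball_covering_property TYPE('y)"
  using lip0_ball_covering_property[OF assms] ball_covering_property_lip0_imp_target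
    ball_covering_property_lip0_imp_scalar by blast

end
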